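(* Let $\{X_n\}_{n\in\mathbb{N}}$ be a uniformly integrable $\mathcal{SL}$-submartingale. Then, taking $X_\infty=\lim_nX_n$ (quasi-sure limit), the process $\{X_n\}_{n\in\mathbb{N}\cup\{\infty\}}$ is also a uniformly integrable $\mathcal{SL}$-submartingale. In particular, $X_\infty\in L^1_b$.
   Context: Let $(\Omega,\mathcal{F})$ be a measurable space with a discrete-time filtration $\{\mathcal{F}_t\}_{t\in\mathbb{N}}$, $\mathbb{N}=\{0,1,2,\dots\}$, such that $\mathcal{F}=\mathcal{F}_\infty=\sigma(\bigcup_t\mathcal{F}_t)$ and $\mathcal{F}_0$ is trivial. $m\mathcal{F}_t$ denotes the $\mathcal{F}_t$-measurable $\mathbb{R}\cup\{\pm\infty\}$-valued functions. $\mathcal{H}$ is a linear space of $\mathcal{F}$-measurable $\mathbb{R}$-valued functions on $\Omega$ containing the constants, such that $X\in\mathcal{H}$ implies $|X|\in\mathcal{H}$ and $I_AX\in\mathcal{H}$ for all $A\in\mathcal{F}$; $\mathcal{H}_t:=\mathcal{H}\cap m\mathcal{F}_t$. $\mathcal{E}$ is an $\mathcal{SL}$-expectation: a family of maps $\mathcal{E}_t:\mathcal{H}\to\mathcal{H}_t$ such that for all $X,Y\in\mathcal{H}$, $s\le t$: (i) $X\ge Y$ implies $\mathcal{E}_t(X)\ge\mathcal{E}_t(Y)$; (ii) $\mathcal{E}_s(Y)=\mathcal{E}_s(\mathcal{E}_t(Y))$; (iii) $\mathcal{E}_t(I_AY)=I_A\mathcal{E}_t(Y)$ for $A\in\mathcal{F}_t$;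 (iv) $\mathcal{E}_t(Y)=Y$ for $Y\in\mathcal{H}_t$; (v) $\mathcal{E}_t(X+Y)\le\mathcal{E}_t(X)+\mathcal{E}_t(Y)$; (vi) $\mathcal{E}_t(\lambda Y)=\lambda^+\mathcal{E}_t(Y)+\lambda^-\mathcal{E}_t(-Y)$ for $\lambda\in\mathcal{H}_t$ with $\lambda Y\in\mathcal{H}$; (vii) if $X_i\in\mathcal{H}$ and $X_i(\omega)\downarrow0$ for every $\omega$, then $\mathcal{E}_0(X_i)\to0$. Write $\mathcal{E}=\mathcal{E}_0$ (real-valued). Such $\mathcal{E}$ has a representation $\mathcal{E}(Y)=\sup_{\theta\in\Theta}E_\theta[Y]$ for a collection $\Theta$ of ($\sigma$-additive) probability measures. A statement holds quasi-surely (q.s.) if it holds outside a set $N$ with $\mathcal{E}(I_N)=0$. $L^1$ is the completion of $\{X\in\mathcal{H}:\mathcal{E}(|X|)<\infty\}$ under $\|X\|_1=\mathcal{E}(|X|)$, modulo equality in $\|\cdot\|_1$; its elements are regarded as $\mathcal{F}$-measurable functions (up to q.s. equality), and each $\mathcal{E}_t$ extends to $L^1$ by $\mathcal{E}_t(X)=\lim\mathcal{E}_t(X_n)$ (limit in $L^1$) for $X_n\to X$ in $L^1$; $\mathcal{E}_\infty(X)=X$. $L^1_b\subset L^1$ is the completion under $\|\cdot\|_1$ of the bounded functions in $\mathcal{H}$. A set $K\subset L^1$ is uniformly integrable if $\mathcal{E}(I_{\{|X|\ge c\}}|X|)\to0$ uniformly in $X\in K$ as $c\to\infty$. An $\mathcal{SL}$-submartingale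 is a process $X$ with $X_t\in L^1\cap m\mathcal{F}_t$ for all $t$ and $X_s\le\mathcal{E}_s(X_t)$ for all $s\le t$ in the index set (relations in $L^1$ are understood q.s.). *)

theory Defs
  imports "HOL-Probability.Stopping_Time" "HOL-Library.Extended_Nat"
begin

text \<open>
  \<open>M\<close> is the space \<open>(\<Omega>, \<F>)\<close>, \<open>F\<close> the filtration, \<open>H\<close> the space of functions on which the
  conditional expectations \<open>E t\<close> are defined. Functions are total on the type \<open>'a\<close>; only
  their restriction to \<open>space M\<close> matters, so all relations between them are relative to \<open>space M\<close>.
\<close>

locale sl_data =
  fixes M :: "'a measure"
    and F :: "nat \<Rightarrow> 'a measure"
    and H :: "('a \<Rightarrow> real) set"
    and E :: "nat \<Rightarrow> ('a \<Rightarrow> real) \<Rightarrow> 'a \<Rightarrow> real"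
begin

text \<open>
  \<open>F 0\<close> is going to be trivial, so \<open>E 0 X\<close> is constant on the (nonempty) set \<open>space M\<close>; the real
  number \<open>expect X\<close> is its value.
\<close>

definition expect :: "('a \<Rightarrow> real) \<Rightarrow> real" where
  "expect X = E 0 X (SOME \<omega>. \<omega> \<in> space M)"

definition qs :: "('a \<Rightarrow> bool) \<Rightarrow> bool" where
  "qs P \<longleftrightarrow> (\<exists>N\<in>sets M. expect (indicator N) = 0 \<and> (\<forall>\<omega>\<in>space M - N. P \<omega>))"

text \<open>
  Elements of the completion are regarded as functions: the class of a Cauchy sequence that
  converges quasi-surely is identified with its quasi-sure limit. Every Cauchy sequence has a
  subsequence of this kind. The values \<open>\<plusminus>\<infinity>\<close> are allowed (on a null set).
\<close>

definition represents :: "(nat \<Rightarrow> 'a \<Rightarrow> real) \<Rightarrow> ('a \<Rightarrow> ereal) \<Rightarrow> bool" where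
  "represents Xs X \<longleftrightarrow>
     (\<forall>n. Xs n \<in> H) \<and>
     (\<forall>e>0. \<exists>N. \<forall>m\<ge>N. \<forall>n\<ge>N. expect (\<lambda>\<omega>. \<bar>Xs m \<omega> - Xs n \<omega>\<bar>) < e) \<and>
     qs (\<lambda>\<omega>. (\<lambda>n. ereal (Xs n \<omega>)) \<longlonglongrightarrow> X \<omega>)"

definition completion :: "('a \<Rightarrow> real) set \<Rightarrow> ('a \<Rightarrow> ereal) set" where
  "completion K = {X \<in> borel_measurable M. \<exists>Xs. (\<forall>n. Xs n \<in> K) \<and> represents Xs X}"

text \<open>Since \<open>expect\<close> is real-valued, \<open>expect \<bar>X\<bar> < \<infinity>\<close> holds for every \<open>X \<in> H\<close>.\<close>

definition L1 :: "('a \<Rightarrow> ereal) set" where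
  "L1 = completion H"

definition L1b :: "('a \<Rightarrow> ereal) set" where
  "L1b = completion {X \<in> H. bounded (X ` space M)}"

text \<open>The limit does not depend on the representing sequence, so \<open>THE\<close> is meaningful for \<open>X \<in> L1\<close>.\<close>

definition expect_L1 :: "('a \<Rightarrow> ereal) \<Rightarrow> real" where
  "expect_L1 X = (THE c. \<forall>Xs. represents Xs X \<longrightarrow> (\<lambda>n. expect (Xs n)) \<longlonglongrightarrow> c)"

definition norm_L1 :: "('a \<Rightarrow> ereal) \<Rightarrow> real" where
  "norm_L1 X = expect_L1 (\<lambda>\<omega>. \<bar>X \<omega>\<bar>)"

definition tendsto_L1 :: "(nat \<Rightarrow> 'a \<Rightarrow> real) \<Rightarrow> ('a \<Rightarrow> ereal) \<Rightarrow> bool" where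
  "tendsto_L1 Xs X \<longleftrightarrow> (\<lambda>n. norm_L1 (\<lambda>\<omega>. ereal (Xs n \<omega>) - X \<omega>)) \<longlonglongrightarrow> 0"

text \<open>
  The extension of \<open>E t\<close> to \<open>L1\<close> is determined up to quasi-sure equality only; \<open>cond_L1\<close> picks
  some version of it.
\<close>

definition cond_L1 :: "enat \<Rightarrow> ('a \<Rightarrow> ereal) \<Rightarrow> 'a \<Rightarrow> ereal" where
  "cond_L1 t X = (case t of
      enat k \<Rightarrow> (SOME Y. Y \<in> L1 \<and>
         (\<forall>Xs. (\<forall>n. Xs n \<in> H) \<and> tendsto_L1 Xs X \<longrightarrow> tendsto_L1 (\<lambda>n. E k (Xs n)) Y))
    | \<infinity> \<Rightarrow> X)"

definition uniformly_integrable :: "('a \<Rightarrow> ereal) set \<Rightarrow> bool" where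
  "uniformly_integrable K \<longleftrightarrow> K \<subseteq> L1 \<and>
     uniform_limit K
       (\<lambda>c X. expect_L1 (\<lambda>\<omega>. indicator {\<omega> \<in> space M. ereal c \<le> \<bar>X \<omega>\<bar>} \<omega> * \<bar>X \<omega>\<bar>))
       (\<lambda>_. 0) at_top"

definition filt :: "enat \<Rightarrow> 'a measure" where
  "filt t = (case t of enat k \<Rightarrow> F k | \<infinity> \<Rightarrow> M)"

definition sl_submartingale :: "enat set \<Rightarrow> (enat \<Rightarrow> 'a \<Rightarrow> ereal) \<Rightarrow> bool" where
  "sl_submartingale T X \<longleftrightarrow>
     (\<forall>t\<in>T. X t \<in> L1 \<and> X t \<in> borel_measurable (filt t)) \<and>
     (\<forall>s\<in>T. \<forall>t\<in>T. s \<le> t \<longrightarrow> qs (\<lambda>\<omega>. X s \<omega> \<le> cond_L1 s (X t) \<omega>))"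

end

locale sl_expectation = sl_data M F H E + filtration "space M" F
  for M :: "'a measure"
    and F :: "nat \<Rightarrow> 'a measure"
    and H :: "('a \<Rightarrow> real) set"
    and E :: "nat \<Rightarrow> ('a \<Rightarrow> real) \<Rightarrow> 'a \<Rightarrow> real" +
  assumes space_nonempty: "space M \<noteq> {}"
    and sets_M: "sets M = sigma_sets (space M) (\<Union>t. sets (F t))"
    and sets_F0: "sets (F 0) = {{}, space M}"
    and H_measurable: "H \<subseteq> borel_measurable M"
    and H_const: "(\<lambda>_. c) \<in> H"
    and H_add: "X \<in> H \<Longrightarrow> Y \<in> H \<Longrightarrow> (\<lambda>\<omega>. X \<omega> + Y \<omega>) \<in> H"
    and H_scale: "X \<in> H \<Longrightarrow> (\<lambda>\<omega>. c * X \<omega>) \<in> H"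
    and H_abs: "X \<in> H \<Longrightarrow> (\<lambda>\<omega>. \<bar>X \<omega>\<bar>) \<in> H"
    and H_indicator: "X \<in> H \<Longrightarrow> A \<in> sets M \<Longrightarrow> (\<lambda>\<omega>. indicator A \<omega> * X \<omega>) \<in> H"
    and E_range: "X \<in> H \<Longrightarrow> E t X \<in> H \<inter> borel_measurable (F t)"
    and E_mono: "X \<in> H \<Longrightarrow> Y \<in> H \<Longrightarrow> (\<And>\<omega>. \<omega> \<in> space M \<Longrightarrow> Y \<omega> \<le> X \<omega>) \<Longrightarrow>
      \<omega> \<in> space M \<Longrightarrow> E t Y \<omega> \<le> E t X \<omega>"
    and E_tower: "Y \<in> H \<Longrightarrow> s \<le> t \<Longrightarrow> \<omega> \<in> space M \<Longrightarrow> E s Y \<omega> = E s (E t Y) \<omega>"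
    and E_indicator: "Y \<in> H \<Longrightarrow> A \<in> sets (F t) \<Longrightarrow> \<omega> \<in> space M \<Longrightarrow>
      E t (\<lambda>\<omega>. indicator A \<omega> * Y \<omega>) \<omega> = indicator A \<omega> * E t Y \<omega>"
    and E_adapted: "Y \<in> H \<Longrightarrow> Y \<in> borel_measurable (F t) \<Longrightarrow> \<omega> \<in> space M \<Longrightarrow> E t Y \<omega> = Y \<omega>"
    and E_subadd: "X \<in> H \<Longrightarrow> Y \<in> H \<Longrightarrow> \<omega> \<in> space M \<Longrightarrow>
      E t (\<lambda>\<omega>. X \<omega> + Y \<omega>) \<omega> \<le> E t X \<omega> + E t Y \<omega>"
    and E_scale: "l \<in> H \<Longrightarrow> l \<in> borel_measurable (F t) \<Longrightarrow> Y \<in> H \<Longrightarrow>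
      (\<lambda>\<omega>. l \<omega> * Y \<omega>) \<in> H \<Longrightarrow> \<omega> \<in> space M \<Longrightarrow>
      E t (\<lambda>\<omega>. l \<omega> * Y \<omega>) \<omega>
        = max (l \<omega>) 0 * E t Y \<omega> + max (- l \<omega>) 0 * E t (\<lambda>\<omega>. - Y \<omega>) \<omega>"
    and E_continuous: "(\<And>i. Xs i \<in> H) \<Longrightarrow>
      (\<And>\<omega>. \<omega> \<in> space M \<Longrightarrow> decseq (\<lambda>i. Xs i \<omega>) \<and> (\<lambda>i. Xs i \<omega>) \<longlonglongrightarrow> 0) \<Longrightarrow>
      (\<lambda>i. expect (Xs i)) \<longlonglongrightarrow> 0"

end

theory Submission
  imports Defs
begin

text \<open>
  Pointwise continuity at \<open>0\<close> gives monotone convergence and hence completeness of the space of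
  functions \<open>f\<close> with \<open>\<E> (\<bar>f\<bar> - n)\<^sup>+ \<longlonglongrightarrow> 0\<close>; this space is \<open>L\<^sup>1\<close> and also \<open>L\<^sup>1\<^sub>b\<close>.

  An \<open>\<S>\<L>\<close>-submartingale \<open>X\<close> is in general not a submartingale under every measure representing
  \<open>\<E>\<close>, so upcrossing counts are controlled only from below and do not give quasi-sure convergence
  directly. Instead, let \<open>A\<close> be the event that \<open>X\<close> is infinitely often \<open>\<ge> b\<close> and infinitely often
  \<open>\<le> a\<close>, where \<open>a < b\<close>, and let \<open>B\<close> be an \<open>F k\<close>-measurable approximation of \<open>A\<close>. Trading in
  \<open>(X - a)\<^sup>+\<close> after time \<open>k\<close> from the first value \<open>\<ge> b\<close> to the next value \<open>\<le> a\<close> has a gain with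
  nonnegative conditional expectation given \<open>F k\<close>, although on \<open>A\<close> it finally equals at most
  \<open>-(b - a)\<close>. Comparing the two on \<open>B\<close> and using uniform integrability to bound the gain off \<open>A\<close>
  yields \<open>\<E> (I\<^sub>B)\<close> small, so \<open>\<E> (I\<^sub>A) = 0\<close>. Uniform integrability turns the resulting quasi-sure
  convergence into convergence in \<open>L\<^sup>1\<close>, which preserves \<open>X\<^sub>s \<le> \<E>\<^sub>s (X\<^sub>t)\<close> as \<open>t \<longlonglongrightarrow> \<infinity>\<close>.
\<close>

section \<open>Finite expectations and the upper integral\<close>

context sl_expectation
begin

text \<open>An unconditional inequality \<open>0 <= expect W\<close> for the gain \<open>W\<close>
  says nothing about the crossing event: \<open>expect\<close> behaves like a supremum over
  scenarios, and a scenario in which the event is null may already attain it. The conditional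
  inequality \<open>0 <= E k W\<close> holds quasi-surely and can be read on any event of
  \<open>F k\<close>. This is why the crossing event is replaced by some \<open>B\<close> in
  \<open>F k\<close> and trading starts only at \<open>k\<close>. Continuity at 0 supplies
  \<open>B\<close>, since it makes the union of the \<open>F t\<close> dense among the events. The
  position held is long: \<open>E t\<close> commutes with indicators of \<open>F t\<close>, whereas
  a negative multiple would bring in \<open>E t\<close> of the negated process, on which the
  submartingale property is silent. Off the crossing event the gain is bounded only by the last
  value of \<open>(X - a)^+\<close>, which costs a constant \<open>c\<close> plus a uniformly small
  tail. Uniform integrability fixes \<open>c\<close> before \<open>k\<close> and \<open>B\<close>
  are chosen, so the approximation error can be made small compared with \<open>b - a + c\<close>,
  the weight of a point on which \<open>B\<close> misjudges the event.\<close>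

lemma sets_F_subset: "sets (F t) \<subseteq> sets M"
  using sets_M by (auto intro: sigma_sets.Basic)

lemma H_borel [measurable_dest]: "X \<in> H \<Longrightarrow> X \<in> borel_measurable M"
  using H_measurable by auto

lemma H_uminus: "X \<in> H \<Longrightarrow> (\<lambda>\<omega>. - X \<omega>) \<in> H"
  using H_scale[of X "-1"] by simp

lemma H_diff: "X \<in> H \<Longrightarrow> Y \<in> H \<Longrightarrow> (\<lambda>\<omega>. X \<omega> - Y \<omega>) \<in> H"
  using H_add[OF _ H_uminus, of X Y] by simp

lemma H_max:
  assumes "X \<in> H" "Y \<in> H" shows "(\<lambda>\<omega>. max (X \<omega>) (Y \<omega>)) \<in> H"
proof -
  have "(\<lambda>\<omega>. (1/2) * ((X \<omega> + Y \<omega>) + \<bar>X \<omega> - Y \<omega>\<bar>)) \<in> H"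
    by (intro H_scale H_add H_abs H_diff assms)
  also have "(\<lambda>\<omega>. (1/2) * ((X \<omega> + Y \<omega>) + \<bar>X \<omega> - Y \<omega>\<bar>)) = (\<lambda>\<omega>. max (X \<omega>) (Y \<omega>))"
    by (auto simp: fun_eq_iff max_def)
  finally show ?thesis .
qed

lemma H_sum: "finite I \<Longrightarrow> (\<And>i. i \<in> I \<Longrightarrow> X i \<in> H) \<Longrightarrow> (\<lambda>\<omega>. \<Sum>i\<in>I. X i \<omega>) \<in> H"
  by (induction I rule: finite_induct) (auto intro: H_add H_const)

lemma H_indicator_const: "A \<in> sets M \<Longrightarrow> (\<lambda>\<omega>. indicator A \<omega> * c) \<in> H"
  by (intro H_indicator H_const)

lemma H_indicator_set: "A \<in> sets M \<Longrightarrow> indicator A \<in> H"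
  using H_indicator_const[of A 1] by (simp add: fun_eq_iff[symmetric])

text \<open>Membership in \<open>H\<close> concerns the function on the whole type, so a function
  known only on \<open>space M\<close> is set to 0 elsewhere before it is written with indicators of
  measurable sets.\<close>

lemma H_simple_function:
  assumes "simple_function M f"
  shows "(\<lambda>\<omega>. indicator (space M) \<omega> * f \<omega>) \<in> H"
proof -
  have "(\<lambda>\<omega>. \<Sum>y\<in>f ` space M. indicator (f -` {y} \<inter> space M) \<omega> * y) \<in> H"
    using assms by (intro H_sum H_indicator_const) (auto simp: simple_function_def)
  also have "(\<lambda>\<omega>. \<Sum>y\<in>f ` space M. indicator (f -` {y} \<inter> space M) \<omega> * y)
      = (\<lambda>\<omega>. indicator (space M) \<omega> * f \<omega>)"
  proof
    fix \<omega>
    show "(\<Sum>y\<in>f ` space M. indicator (f -` {y} \<inter> space M) \<omega> * y) = indicator (space M) \<omega> * f \<omega>"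
    proof (cases "\<omega> \<in> space M")
      case True
      then have "(\<Sum>y\<in>f ` space M. indicator (f -` {y} \<inter> space M) \<omega> * y)
          = (\<Sum>y\<in>f ` space M. if y = f \<omega> then y else 0)"
        by (intro sum.cong) (auto simp: indicator_def)
      with True assms show ?thesis by (simp add: simple_function_def)
    qed (simp add: indicator_def)
  qed
  finally show ?thesis .
qed

section \<open>Sublinear calculus of \<open>E t\<close> and of its value \<open>expect\<close> at
  time 0\<close>

lemma E_H: "X \<in> H \<Longrightarrow> E t X \<in> H"
  using E_range by auto

lemma E_const: "\<omega> \<in> space M \<Longrightarrow> E t (\<lambda>_. c) \<omega> = c"
  by (rule E_adapted) (auto intro: H_const)

lemma E_cmult: "X \<in> H \<Longrightarrow> 0 \<le> c \<Longrightarrow> \<omega> \<in> space M \<Longrightarrow> E t (\<lambda>\<omega>. c * X \<omega>) \<omega> = c * E t X \<omega>"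
  using E_scale[of "\<lambda>_. c" t X \<omega>] by (simp add: H_const H_scale)

lemma E_diff_le:
  assumes "X \<in> H" "Y \<in> H" "\<omega> \<in> space M"
  shows "E t X \<omega> - E t Y \<omega> \<le> E t (\<lambda>\<omega>. X \<omega> - Y \<omega>) \<omega>"
  using E_subadd[of "\<lambda>\<omega>. X \<omega> - Y \<omega>" Y \<omega> t] H_diff[of X Y] assms by simp

text \<open>Subadditivity gives \<open><=\<close>. Applied once more, after subtracting the adapted
  \<open>X\<close> again, it gives \<open>>=\<close>, because \<open>E t\<close> fixes both
  \<open>X\<close> and \<open>- X\<close>.\<close>

lemma E_add_adapted:
  assumes "X \<in> H" "X \<in> borel_measurable (F t)" "Y \<in> H" and \<omega>: "\<omega> \<in> space M"
  shows "E t (\<lambda>\<omega>. X \<omega> + Y \<omega>) \<omega> = X \<omega> + E t Y \<omega>"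
proof -
  have "E t X \<omega> = X \<omega>" using assms by (intro E_adapted)
  moreover have "E t (\<lambda>\<omega>. - X \<omega>) \<omega> = - X \<omega>"
    using assms by (intro E_adapted H_uminus) auto
  moreover have "E t (\<lambda>\<omega>. X \<omega> + Y \<omega> + - X \<omega>) \<omega> \<le> E t (\<lambda>\<omega>. X \<omega> + Y \<omega>) \<omega> + E t (\<lambda>\<omega>. - X \<omega>) \<omega>"
    using assms by (intro E_subadd H_add H_uminus)
  moreover have "E t (\<lambda>\<omega>. X \<omega> + Y \<omega>) \<omega> \<le> E t X \<omega> + E t Y \<omega>"
    using assms by (intro E_subadd)
  ultimately show ?thesis by simp
qed

text \<open>A level set of \<open>E 0 X\<close> lies in the trivial \<open>F 0\<close>; the one
  through the point chosen in \<open>expect\<close> is nonempty, hence the whole space.\<close>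

lemma E0_eq_expect:
  assumes "X \<in> H" "\<omega> \<in> space M" shows "E 0 X \<omega> = expect X"
proof -
  define \<omega>0 where "\<omega>0 = (SOME \<omega>. \<omega> \<in> space M)"
  have \<omega>0: "\<omega>0 \<in> space M"
    unfolding \<omega>0_def using space_nonempty by (auto intro: someI_ex)
  have m: "E 0 X \<in> borel_measurable (F 0)" using E_range assms by auto
  have "{\<omega> \<in> space (F 0). E 0 X \<omega> = E 0 X \<omega>0} \<in> sets (F 0)"
    using m by measurable
  then have "{\<omega> \<in> space M. E 0 X \<omega> = E 0 X \<omega>0} = space M"
    using \<omega>0 sets_F0 space_F by auto
  with assms show ?thesis by (auto simp: expect_def \<omega>0_def)
qed

lemma ex_space: "\<exists>\<omega>. \<omega> \<in> space M"
  using space_nonempty by auto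

lemma expect_mono:
  assumes "X \<in> H" "Y \<in> H" "\<And>\<omega>. \<omega> \<in> space M \<Longrightarrow> Y \<omega> \<le> X \<omega>"
  shows "expect Y \<le> expect X"
  using ex_space E_mono[OF assms] E0_eq_expect assms by metis

lemma expect_add_le:
  assumes "X \<in> H" "Y \<in> H" shows "expect (\<lambda>\<omega>. X \<omega> + Y \<omega>) \<le> expect X + expect Y"
proof -
  obtain \<omega> where "\<omega> \<in> space M" using ex_space by blast
  with E_subadd[of X Y \<omega> 0] assms show ?thesis
    by (simp add: E0_eq_expect H_add H_diff H_scale H_const E_H)
qed

lemma expect_diff_le:
  assumes "X \<in> H" "Y \<in> H" shows "expect X - expect Y \<le> expect (\<lambda>\<omega>. X \<omega> - Y \<omega>)"
proof -
  obtain \<omega> where "\<omega> \<in> space M" using ex_space by blast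
  with E_diff_le[of X Y \<omega> 0] assms show ?thesis
    by (simp add: E0_eq_expect H_add H_diff H_scale H_const E_H)
qed

lemma expect_cmult:
  assumes "X \<in> H" "0 \<le> c" shows "expect (\<lambda>\<omega>. c * X \<omega>) = c * expect X"
proof -
  obtain \<omega> where "\<omega> \<in> space M" using ex_space by blast
  with E_cmult[of X c \<omega> 0] assms show ?thesis
    by (simp add: E0_eq_expect H_add H_diff H_scale H_const E_H)
qed

lemma expect_const: "expect (\<lambda>_. c) = c"
  using ex_space E_const[of _ 0 c] E0_eq_expect[OF H_const, of _ c] by auto

lemma expect_nonneg: "X \<in> H \<Longrightarrow> (\<And>\<omega>. \<omega> \<in> space M \<Longrightarrow> 0 \<le> X \<omega>) \<Longrightarrow> 0 \<le> expect X"
  using expect_mono[of X "\<lambda>_. 0"] expect_const[of 0] H_const by auto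

lemma expect_E:
  assumes "X \<in> H" shows "expect (E t X) = expect X"
proof -
  obtain \<omega> where "\<omega> \<in> space M" using ex_space by blast
  with E_tower[of X 0 t \<omega>] assms show ?thesis
    by (simp add: E0_eq_expect H_add H_diff H_scale H_const E_H)
qed

text \<open>Continuity along sequences decreasing to 0 applies to \<open>Y - X n\<close>; the
  reverse triangle inequality carries it over to \<open>X n\<close> although \<open>expect\<close>
  is not additive.\<close>

lemma expect_LIMSEQ_mono:
  assumes X: "\<And>n. X n \<in> H" and Y: "Y \<in> H"
    and inc: "\<And>\<omega>. \<omega> \<in> space M \<Longrightarrow> incseq (\<lambda>n. X n \<omega>)"
    and lim: "\<And>\<omega>. \<omega> \<in> space M \<Longrightarrow> (\<lambda>n. X n \<omega>) \<longlonglongrightarrow> Y \<omega>"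
  shows "(\<lambda>n. expect (X n)) \<longlonglongrightarrow> expect Y"
proof -
  have "(\<lambda>n. expect (\<lambda>\<omega>. Y \<omega> - X n \<omega>)) \<longlonglongrightarrow> 0"
  proof (rule E_continuous, safe)
    fix \<omega> assume \<omega>: "\<omega> \<in> space M"
    show "decseq (\<lambda>n. Y \<omega> - X n \<omega>)"
      using inc[OF \<omega>] by (auto simp: incseq_def decseq_def)
    have "(\<lambda>n. Y \<omega> - X n \<omega>) \<longlonglongrightarrow> Y \<omega> - Y \<omega>" by (intro tendsto_intros lim \<omega>)
    then show "(\<lambda>n. Y \<omega> - X n \<omega>) \<longlonglongrightarrow> 0" by simp
  qed (intro H_diff X Y)
  then have "(\<lambda>n. expect Y - expect (\<lambda>\<omega>. Y \<omega> - X n \<omega>)) \<longlonglongrightarrow> expect Y - 0"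
    by (intro tendsto_intros)
  then have l: "(\<lambda>n. expect Y - expect (\<lambda>\<omega>. Y \<omega> - X n \<omega>)) \<longlonglongrightarrow> expect Y" by simp
  show ?thesis
  proof (rule tendsto_sandwich[OF _ _ l tendsto_const])
    show "\<forall>\<^sub>F n in sequentially. expect Y - expect (\<lambda>\<omega>. Y \<omega> - X n \<omega>) \<le> expect (X n)"
      using expect_diff_le[OF Y X] by (intro always_eventually allI) (simp add: algebra_simps)
    show "\<forall>\<^sub>F n in sequentially. expect (X n) \<le> expect Y"
      using incseq_le[OF inc lim] by (intro always_eventually allI expect_mono X Y)
  qed
qed

text \<open>
  The extension of \<open>\<E>\<close> to nonnegative functions, in place of \<open>sup\<^sub>\<theta> \<integral> f d\<theta>\<close>; the representing
  measures are never needed.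
\<close>

definition upper :: "('a \<Rightarrow> ennreal) \<Rightarrow> ennreal" where
  "upper f = (SUP Y\<in>{Y \<in> H. \<forall>\<omega>\<in>space M. 0 \<le> Y \<omega> \<and> ennreal (Y \<omega>) \<le> f \<omega>}. ennreal (expect Y))"

lemma upper_mono: "(\<And>\<omega>. \<omega> \<in> space M \<Longrightarrow> f \<omega> \<le> g \<omega>) \<Longrightarrow> upper f \<le> upper g"
  unfolding upper_def by (rule SUP_subset_mono) (auto intro: order_trans)

lemma upper_cong: "(\<And>\<omega>. \<omega> \<in> space M \<Longrightarrow> f \<omega> = g \<omega>) \<Longrightarrow> upper f = upper g"
  by (intro antisym upper_mono) auto

lemma upper_H:
  assumes "Y \<in> H" "\<And>\<omega>. \<omega> \<in> space M \<Longrightarrow> 0 \<le> Y \<omega>"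
  shows "upper (\<lambda>\<omega>. ennreal (Y \<omega>)) = ennreal (expect Y)"
  unfolding upper_def
proof (rule antisym)
  show "(SUP Z\<in>{Z \<in> H. \<forall>\<omega>\<in>space M. 0 \<le> Z \<omega> \<and> ennreal (Z \<omega>) \<le> ennreal (Y \<omega>)}. ennreal (expect Z))
      \<le> ennreal (expect Y)"
    by (rule SUP_least) (use assms in \<open>auto intro!: ennreal_leI expect_mono\<close>)
qed (use assms in \<open>auto intro!: SUP_upper\<close>)

text \<open>As for the Lebesgue integral, a minorant \<open>Y\<close> of the supremum is shrunk by a
  factor \<open>\<alpha> < 1\<close>, so that \<open>f n\<close> exceeds it on sets
  \<open>A n\<close> exhausting the space. The restrictions \<open>Z n\<close> stay in
  \<open>H\<close>, where monotone convergence is known.\<close>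

lemma upper_SUP_le:
  assumes [measurable]: "\<And>n. f n \<in> borel_measurable M"
    and inc: "\<And>\<omega>. \<omega> \<in> space M \<Longrightarrow> incseq (\<lambda>n. f n \<omega>)"
  shows "upper (\<lambda>\<omega>. SUP n. f n \<omega>) \<le> (SUP n. upper (f n))"
  unfolding upper_def[of "\<lambda>\<omega>. SUP n. f n \<omega>"]
proof (rule SUP_least, clarify)
  fix Y assume Y: "Y \<in> H" and le: "\<forall>\<omega>\<in>space M. 0 \<le> Y \<omega> \<and> ennreal (Y \<omega>) \<le> (SUP n. f n \<omega>)"
  have *: "ennreal (\<alpha> * expect Y) \<le> (SUP n. upper (f n))" if \<alpha>: "0 < \<alpha>" "\<alpha> < 1" for \<alpha> :: real
  proof -
    define A where "A n = {\<omega>\<in>space M. ennreal (\<alpha> * Y \<omega>) \<le> f n \<omega>}" for n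
    define Z where "Z n \<omega> = indicator (A n) \<omega> * (\<alpha> * Y \<omega>)" for n \<omega>
    have A: "A n \<in> sets M" for n
      unfolding A_def using Y by measurable
    have ZH: "Z n \<in> H" for n
      unfolding Z_def[abs_def] using A Y by (intro H_indicator H_scale)
    have "(\<lambda>n. expect (Z n)) \<longlonglongrightarrow> expect (\<lambda>\<omega>. \<alpha> * Y \<omega>)"
    proof (rule expect_LIMSEQ_mono)
      fix \<omega> assume \<omega>: "\<omega> \<in> space M"
      have mono: "\<omega> \<in> A m \<Longrightarrow> m \<le> n \<Longrightarrow> \<omega> \<in> A n" for m n
        using inc[OF \<omega>] by (auto simp: A_def incseq_def intro: order_trans)
      show "incseq (\<lambda>n. Z n \<omega>)"
        using mono le \<alpha> \<omega> by (auto simp: incseq_def Z_def indicator_def)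
      have "\<exists>m. \<omega> \<in> A m"
      proof (cases "Y \<omega> = 0")
        case False
        with le \<omega> have "0 < Y \<omega>" by force
        with \<alpha> have "\<alpha> * Y \<omega> < Y \<omega>" by simp
        then have "ennreal (\<alpha> * Y \<omega>) < ennreal (Y \<omega>)"
          using \<open>0 < Y \<omega>\<close> \<alpha> by (intro ennreal_lessI) auto
        also have "\<dots> \<le> (SUP n. f n \<omega>)" using le \<omega> by auto
        finally show ?thesis using \<omega> by (auto simp: less_SUP_iff A_def intro: less_imp_le)
      qed (auto simp: A_def \<omega>)
      then obtain m where "\<omega> \<in> A m" ..
      then have "\<forall>\<^sub>F n in sequentially. Z n \<omega> = \<alpha> * Y \<omega>"
        unfolding eventually_sequentially using mono by (intro exI[of _ m]) (auto simp: Z_def)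
      then show "(\<lambda>n. Z n \<omega>) \<longlonglongrightarrow> \<alpha> * Y \<omega>" by (rule tendsto_eventually)
    qed (use ZH H_scale Y in auto)
    then have "(\<lambda>n. expect (Z n)) \<longlonglongrightarrow> \<alpha> * expect Y"
      using \<alpha> Y by (simp add: expect_cmult)
    then have "(\<lambda>n. ennreal (expect (Z n))) \<longlonglongrightarrow> ennreal (\<alpha> * expect Y)"
      by (rule tendsto_ennrealI)
    moreover have "ennreal (expect (Z n)) \<le> (SUP n. upper (f n))" for n
    proof -
      have "ennreal (expect (Z n)) \<le> upper (f n)"
        unfolding upper_def using \<alpha> le
        by (intro SUP_upper CollectI conjI ballI ZH) (auto simp: Z_def A_def indicator_def)
      also have "\<dots> \<le> (SUP n. upper (f n))" by (rule SUP_upper) simp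
      finally show ?thesis .
    qed
    ultimately show ?thesis by (intro LIMSEQ_le_const2[where x="ennreal (\<alpha> * expect Y)"]) auto
  qed
  have "((\<lambda>\<alpha>. ennreal (\<alpha> * expect Y)) \<longlongrightarrow> ennreal (1 * expect Y)) (at_left 1)"
    by (intro tendsto_ennrealI tendsto_intros)
  moreover have "\<forall>\<^sub>F \<alpha> in at_left (1::real). ennreal (\<alpha> * expect Y) \<le> (SUP n. upper (f n))"
    using eventually_at_left_real[of 0 1] by (auto elim!: eventually_mono intro: *)
  ultimately show "ennreal (expect Y) \<le> (SUP n. upper (f n))"
    using tendsto_upperbound[of _ "ennreal (1 * expect Y)" "at_left (1::real)"] by simp
qed

lemma upper_SUP:
  assumes "\<And>n. f n \<in> borel_measurable M" "\<And>\<omega>. \<omega> \<in> space M \<Longrightarrow> incseq (\<lambda>n. f n \<omega>)"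
  shows "upper (\<lambda>\<omega>. SUP n. f n \<omega>) = (SUP n. upper (f n))"
  by (intro antisym upper_SUP_le assms SUP_least upper_mono) (auto intro: SUP_upper)

text \<open>\<open>H\<close> need not contain every bounded measurable function, but it reaches all
  nonnegative measurable ones from below. Properties of \<open>expect\<close> pass to
  \<open>upper\<close> along such sequences.\<close>

lemma H_approx:
  assumes "f \<in> borel_measurable M"
  obtains Y :: "nat \<Rightarrow> 'a \<Rightarrow> real" where "\<And>n. Y n \<in> H" "\<And>n \<omega>. 0 \<le> Y n \<omega>"
    "\<And>\<omega>. incseq (\<lambda>n. ennreal (Y n \<omega>))" "\<And>\<omega>. \<omega> \<in> space M \<Longrightarrow> (SUP n. ennreal (Y n \<omega>)) = f \<omega>"
proof -
  obtain U where U: "\<And>i. simple_function M (U i)" "incseq U" "\<And>i \<omega>. U i \<omega> < top"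
    and sup: "\<And>\<omega>. (SUP i. U i \<omega>) = f \<omega>"
    using borel_measurable_implies_simple_function_sequence'[OF assms] by blast
  define Y where "Y n \<omega> = indicator (space M) \<omega> * enn2real (U n \<omega>)" for n \<omega>
  have Y: "ennreal (Y n \<omega>) = (if \<omega> \<in> space M then U n \<omega> else 0)" for n \<omega>
    using U(3)[of n \<omega>] by (auto simp: Y_def)
  show ?thesis
  proof (rule that)
    show "Y n \<in> H" for n
      unfolding Y_def[abs_def] by (rule H_simple_function[OF simple_function_compose1[OF U(1)]])
    show "0 \<le> Y n \<omega>" for n \<omega> by (simp add: Y_def)
    show "incseq (\<lambda>n. ennreal (Y n \<omega>))" for \<omega>
      using U(2) by (auto simp: incseq_def Y le_fun_def)
    show "(SUP n. ennreal (Y n \<omega>)) = f \<omega>" if "\<omega> \<in> space M" for \<omega>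
      using that sup by (simp add: Y)
  qed
qed

text \<open>A minorant of \<open>f + g\<close> in \<open>H\<close> does not visibly split into
  minorants of \<open>f\<close> and of \<open>g\<close> in \<open>H\<close>; approximating both from
  below moves the question to subadditivity of \<open>expect\<close>.\<close>

lemma upper_add:
  assumes "f \<in> borel_measurable M" "g \<in> borel_measurable M"
  shows "upper (\<lambda>\<omega>. f \<omega> + g \<omega>) \<le> upper f + upper g"
proof -
  obtain Y where Y: "\<And>n. Y n \<in> H" "\<And>n \<omega>. 0 \<le> Y n \<omega>"
    "\<And>\<omega>. incseq (\<lambda>n. ennreal (Y n \<omega>))" "\<And>\<omega>. \<omega> \<in> space M \<Longrightarrow> (SUP n. ennreal (Y n \<omega>)) = f \<omega>"
    using H_approx[OF assms(1)] by blast
  obtain Z where Z: "\<And>n. Z n \<in> H" "\<And>n \<omega>. 0 \<le> Z n \<omega>"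
    "\<And>\<omega>. incseq (\<lambda>n. ennreal (Z n \<omega>))" "\<And>\<omega>. \<omega> \<in> space M \<Longrightarrow> (SUP n. ennreal (Z n \<omega>)) = g \<omega>"
    using H_approx[OF assms(2)] by blast
  have "upper (\<lambda>\<omega>. f \<omega> + g \<omega>) = upper (\<lambda>\<omega>. SUP n. ennreal (Y n \<omega>) + ennreal (Z n \<omega>))"
    by (rule upper_cong) (simp add: Y Z ennreal_SUP_add)
  also have "\<dots> = (SUP n. upper (\<lambda>\<omega>. ennreal (Y n \<omega>) + ennreal (Z n \<omega>)))"
    using Y Z by (intro upper_SUP) (auto simp: incseq_def intro!: add_mono dest: H_borel)
  also have "\<dots> \<le> upper f + upper g"
  proof (rule SUP_least)
    fix n
    have "upper (\<lambda>\<omega>. ennreal (Y n \<omega>) + ennreal (Z n \<omega>)) = upper (\<lambda>\<omega>. ennreal (Y n \<omega> + Z n \<omega>))"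
      using Y Z by simp
    also have "\<dots> = ennreal (expect (\<lambda>\<omega>. Y n \<omega> + Z n \<omega>))"
      using Y Z by (intro upper_H H_add) auto
    also have "\<dots> \<le> ennreal (expect (Y n) + expect (Z n))"
      using Y Z by (intro ennreal_leI expect_add_le) auto
    also have "\<dots> = upper (\<lambda>\<omega>. ennreal (Y n \<omega>)) + upper (\<lambda>\<omega>. ennreal (Z n \<omega>))"
      using Y Z by (simp add: upper_H expect_nonneg)
    also have "\<dots> \<le> upper f + upper g"
      using Y(4) Z(4) by (intro add_mono upper_mono) (auto intro: SUP_upper2 simp: Y(4)[symmetric] Z(4)[symmetric])
    finally show "upper (\<lambda>\<omega>. ennreal (Y n \<omega>) + ennreal (Z n \<omega>)) \<le> upper f + upper g" .
  qed
  finally show ?thesis .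
qed

lemma upper_cmult:
  assumes "f \<in> borel_measurable M" "0 \<le> c"
  shows "upper (\<lambda>\<omega>. ennreal c * f \<omega>) = ennreal c * upper f"
proof -
  obtain Y where Y: "\<And>n. Y n \<in> H" "\<And>n \<omega>. 0 \<le> Y n \<omega>"
    "\<And>\<omega>. incseq (\<lambda>n. ennreal (Y n \<omega>))" "\<And>\<omega>. \<omega> \<in> space M \<Longrightarrow> (SUP n. ennreal (Y n \<omega>)) = f \<omega>"
    using H_approx[OF assms(1)] by blast
  have "upper (\<lambda>\<omega>. ennreal c * f \<omega>) = upper (\<lambda>\<omega>. SUP n. ennreal c * ennreal (Y n \<omega>))"
    by (rule upper_cong) (simp add: Y SUP_mult_left_ennreal[symmetric])
  also have "\<dots> = (SUP n. upper (\<lambda>\<omega>. ennreal c * ennreal (Y n \<omega>)))"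
    using Y by (intro upper_SUP) (auto simp: incseq_def intro!: mult_left_mono dest: H_borel)
  also have "\<dots> = (SUP n. ennreal c * upper (\<lambda>\<omega>. ennreal (Y n \<omega>)))"
  proof (intro SUP_cong refl)
    fix n
    have "upper (\<lambda>\<omega>. ennreal c * ennreal (Y n \<omega>)) = upper (\<lambda>\<omega>. ennreal (c * Y n \<omega>))"
      using assms Y by (simp add: ennreal_mult)
    also have "\<dots> = ennreal (expect (\<lambda>\<omega>. c * Y n \<omega>))"
      using Y assms by (intro upper_H H_scale) auto
    also have "\<dots> = ennreal c * upper (\<lambda>\<omega>. ennreal (Y n \<omega>))"
      using Y assms by (simp add: upper_H expect_cmult ennreal_mult expect_nonneg)
    finally show "upper (\<lambda>\<omega>. ennreal c * ennreal (Y n \<omega>)) = ennreal c * upper (\<lambda>\<omega>. ennreal (Y n \<omega>))" .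
  qed
  also have "\<dots> = ennreal c * upper (\<lambda>\<omega>. SUP n. ennreal (Y n \<omega>))"
    using Y by (subst upper_SUP) (auto simp: SUP_mult_left_ennreal[symmetric] dest: H_borel)
  also have "upper (\<lambda>\<omega>. SUP n. ennreal (Y n \<omega>)) = upper f"
    by (rule upper_cong) (simp add: Y)
  finally show ?thesis .
qed

lemma upper_zero: "upper (\<lambda>_. 0) = 0"
  using upper_H[OF H_const, of 0] by (simp add: expect_const)

lemma upper_sum:
  assumes "finite I" "\<And>i. i \<in> I \<Longrightarrow> f i \<in> borel_measurable M"
  shows "upper (\<lambda>\<omega>. \<Sum>i\<in>I. f i \<omega>) \<le> (\<Sum>i\<in>I. upper (f i))"
  using assms
proof (induction I rule: finite_induct)
  case (insert i I)
  have "upper (\<lambda>\<omega>. f i \<omega> + (\<Sum>i\<in>I. f i \<omega>)) \<le> upper (f i) + upper (\<lambda>\<omega>. \<Sum>i\<in>I. f i \<omega>)"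
    using insert by (intro upper_add) auto
  also have "\<dots> \<le> upper (f i) + (\<Sum>i\<in>I. upper (f i))"
    using insert by (intro add_mono) auto
  finally show ?case using insert by simp
qed (simp add: upper_zero)

lemma upper_suminf:
  fixes f :: "nat \<Rightarrow> 'a \<Rightarrow> ennreal"
  assumes [measurable]: "\<And>i. f i \<in> borel_measurable M"
  shows "upper (\<lambda>\<omega>. \<Sum>i. f i \<omega>) \<le> (\<Sum>i. upper (f i))"
proof -
  have "upper (\<lambda>\<omega>. \<Sum>i. f i \<omega>) = (SUP n. upper (\<lambda>\<omega>. \<Sum>i<n. f i \<omega>))"
    unfolding suminf_eq_SUP
    by (intro upper_SUP) (auto simp: incseq_def intro!: sum_mono2)
  also have "\<dots> \<le> (SUP n. \<Sum>i<n. upper (f i))"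
    by (intro SUP_mono' upper_sum) auto
  finally show ?thesis by (simp add: suminf_eq_SUP)
qed

lemma upper_Fatou:
  fixes f :: "nat \<Rightarrow> 'a \<Rightarrow> ennreal"
  assumes [measurable]: "\<And>n. f n \<in> borel_measurable M"
  shows "upper (\<lambda>\<omega>. liminf (\<lambda>n. f n \<omega>)) \<le> liminf (\<lambda>n. upper (f n))"
proof -
  have "upper (\<lambda>\<omega>. liminf (\<lambda>n. f n \<omega>)) = (SUP n. upper (\<lambda>\<omega>. INF m\<in>{n..}. f m \<omega>))"
    unfolding liminf_SUP_INF
    by (intro upper_SUP) (auto simp: incseq_def intro!: INF_superset_mono)
  also have "\<dots> \<le> liminf (\<lambda>n. upper (f n))"
    unfolding liminf_SUP_INF
    by (intro SUP_mono' INF_greatest upper_mono INF_lower) auto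
  finally show ?thesis .
qed

end

section \<open>Quasi-sure relations\<close>

lemma ennreal_tendsto_0_iff:
  "(f \<longlongrightarrow> (0::ennreal)) G \<longleftrightarrow> (\<forall>e::real. 0 < e \<longrightarrow> (\<forall>\<^sub>F x in G. f x \<le> ennreal e))"
proof
  assume "(f \<longlongrightarrow> 0) G"
  then show "\<forall>e::real. 0 < e \<longrightarrow> (\<forall>\<^sub>F x in G. f x \<le> ennreal e)"
    using order_tendstoD(2)[of f 0 G "ennreal e" for e] by (fastforce elim: eventually_mono)
next
  assume *: "\<forall>e::real. 0 < e \<longrightarrow> (\<forall>\<^sub>F x in G. f x \<le> ennreal e)"
  show "(f \<longlongrightarrow> 0) G"
  proof (rule order_tendstoI)
    fix a :: ennreal assume "0 < a"
    then obtain e where e: "0 < e" "e < a" using dense by blast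
    then have "0 < enn2real e" "ennreal (enn2real e) = e"
      by (auto simp: enn2real_positive_iff less_top[symmetric] top_unique intro!: ennreal_enn2real)
    with *[rule_format, of "enn2real e"] e show "\<forall>\<^sub>F x in G. f x < a"
      by (auto elim: eventually_mono)
  qed simp
qed

lemma ennreal_tendsto_0_le:
  "(g \<longlongrightarrow> (0::ennreal)) G \<Longrightarrow> (\<And>x. f x \<le> g x) \<Longrightarrow> (f \<longlongrightarrow> 0) G"
  by (rule tendsto_sandwich[where f="\<lambda>_. 0" and h=g]) auto

lemma ennreal_tendsto_0_add:
  "(f \<longlongrightarrow> (0::ennreal)) G \<Longrightarrow> (g \<longlongrightarrow> 0) G \<Longrightarrow> ((\<lambda>x. f x + g x) \<longlongrightarrow> 0) G"
  using tendsto_add[of f 0 G g 0] by simp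

lemma ennreal_tendsto_0_cmult:
  assumes "(f \<longlongrightarrow> (0::ennreal)) G" "0 \<le> c"
  shows "((\<lambda>x. ennreal c * f x) \<longlongrightarrow> 0) G"
  unfolding ennreal_tendsto_0_iff
proof (intro allI impI)
  fix e :: real assume "0 < e"
  \<comment> \<open>The \<open>+ 1\<close> keeps the quotient positive when
    \<open>c = 0\<close>.\<close>
  with assms have "\<forall>\<^sub>F x in G. f x \<le> ennreal (e / (c + 1))"
    by (simp add: ennreal_tendsto_0_iff)
  then show "\<forall>\<^sub>F x in G. ennreal c * f x \<le> ennreal e"
  proof eventually_elim
    case (elim x)
    then have "ennreal c * f x \<le> ennreal c * ennreal (e / (c + 1))" by (intro mult_left_mono) auto
    also have "\<dots> = ennreal (c * (e / (c + 1)))" using assms \<open>0 < e\<close> by (intro ennreal_mult[symmetric]) auto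
    also have "\<dots> \<le> ennreal e" using assms \<open>0 < e\<close> by (intro ennreal_leI) (simp add: field_simps)
    finally show ?case .
  qed
qed

text \<open>Only an inequality, since \<open>ennreal\<close> sends negative numbers to 0: this is
  subadditivity of the positive part.\<close>

lemma ennreal_add_le: "ennreal (a + b) \<le> ennreal a + ennreal b"
proof (cases "0 \<le> a \<and> 0 \<le> b")
  case False
  then show ?thesis
    by (cases "0 \<le> a"; cases "0 \<le> b") (auto simp: ennreal_neg intro: ennreal_leI)
qed auto

context sl_expectation
begin

text \<open>Coercion to \<^typ>\<open>ennreal\<close> truncates at \<open>0\<close>, so this is the upper integral of the positive part.\<close>

abbreviation upos :: "('a \<Rightarrow> real) \<Rightarrow> ennreal" where
  "upos f \<equiv> upper (\<lambda>\<omega>. ennreal (f \<omega>))"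

lemma upper_indicator: "A \<in> sets M \<Longrightarrow> upper (indicator A) = ennreal (expect (indicator A))"
  using upper_H[OF H_indicator_set, of A] by (simp add: ennreal_indicator)

lemma qs_iff: "qs Q \<longleftrightarrow> (\<exists>N\<in>sets M. upper (indicator N) = 0 \<and> (\<forall>\<omega>\<in>space M - N. Q \<omega>))"
  unfolding qs_def
  by (intro bex_cong refl) (auto simp: upper_indicator expect_nonneg H_indicator_set ennreal_eq_0_iff intro: antisym)

lemma qsI: "N \<in> sets M \<Longrightarrow> upper (indicator N) = 0 \<Longrightarrow> (\<And>\<omega>. \<omega> \<in> space M \<Longrightarrow> \<omega> \<notin> N \<Longrightarrow> Q \<omega>) \<Longrightarrow> qs Q"
  by (auto simp: qs_iff)

lemma qs_mono: "qs Q \<Longrightarrow> (\<And>\<omega>. \<omega> \<in> space M \<Longrightarrow> Q \<omega> \<Longrightarrow> R \<omega>) \<Longrightarrow> qs R"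
  unfolding qs_iff by blast

lemma qs_space: "(\<And>\<omega>. \<omega> \<in> space M \<Longrightarrow> Q \<omega>) \<Longrightarrow> qs Q"
  by (rule qsI[of "{}"]) (auto simp: upper_zero cong: upper_cong)

text \<open>Countable subadditivity of \<open>upper\<close> makes a countable union of null sets
  null.\<close>

lemma qs_all_nat:
  fixes Q :: "nat \<Rightarrow> 'a \<Rightarrow> bool"
  assumes "\<And>i. qs (Q i)" shows "qs (\<lambda>\<omega>. \<forall>i. Q i \<omega>)"
proof -
  obtain N where N: "\<And>i. N i \<in> sets M" "\<And>i. upper (indicator (N i)) = 0"
    "\<And>i \<omega>. \<omega> \<in> space M - N i \<Longrightarrow> Q i \<omega>"
    using assms unfolding qs_iff by metis
  have "upper (indicator (\<Union>i. N i)) \<le> upper (\<lambda>\<omega>. \<Sum>i. indicator (N i) \<omega>)"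
  proof (rule upper_mono)
    fix \<omega>
    have "\<omega> \<in> N i \<Longrightarrow> 1 \<le> (\<Sum>i. indicator (N i) \<omega> :: ennreal)" for i
      using sum_le_suminf[of "\<lambda>i. indicator (N i) \<omega> :: ennreal" "{i}"] by simp
    then show "indicator (\<Union>i. N i) \<omega> \<le> (\<Sum>i. indicator (N i) \<omega> :: ennreal)"
      by (auto simp: indicator_def[of "\<Union>i. N i"])
  qed
  also have "\<dots> \<le> (\<Sum>i. upper (indicator (N i)))"
    using N by (intro upper_suminf) auto
  finally have "upper (indicator (\<Union>i. N i)) = 0" by (simp add: N)
  then show ?thesis using N by (intro qsI[of "\<Union>i. N i"]) auto
qed

lemma qs_conj: assumes "qs Q" "qs R" shows "qs (\<lambda>\<omega>. Q \<omega> \<and> R \<omega>)"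
proof -
  have "qs (if i = 0 then Q else R)" for i :: nat using assms by simp
  from qs_all_nat[of "\<lambda>i. if i = 0 then Q else R", OF this] show ?thesis
    by (rule qs_mono) (metis zero_neq_one)
qed

text \<open>Monotone convergence along the factors \<open>real k\<close> reaches the factor
  \<open>top\<close>. With it a null set can absorb arbitrary, even infinite, values.\<close>

lemma upper_top_mult:
  assumes [measurable]: "f \<in> borel_measurable M"
  shows "upper (\<lambda>\<omega>. top * f \<omega>) = top * upper f"
proof -
  have top: "top * x = (SUP k. ennreal (real k) * x)" for x :: ennreal
    unfolding SUP_mult_right_ennreal[symmetric] ennreal_of_nat_eq_real_of_nat[symmetric]
    by (simp only: ennreal_SUP_of_nat_eq_top)
  have "upper (\<lambda>\<omega>. SUP k. ennreal (real k) * f \<omega>) = (SUP k. upper (\<lambda>\<omega>. ennreal (real k) * f \<omega>))"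
    by (intro upper_SUP) (auto simp: incseq_def intro!: mult_right_mono ennreal_leI)
  then show ?thesis by (simp add: top upper_cmult)
qed

lemma upper_mono_qs:
  assumes [measurable]: "g \<in> borel_measurable M" and "qs (\<lambda>\<omega>. f \<omega> \<le> g \<omega>)"
  shows "upper f \<le> upper g"
proof -
  obtain N where [measurable]: "N \<in> sets M" and N: "upper (indicator N) = 0" "\<forall>\<omega>\<in>space M - N. f \<omega> \<le> g \<omega>"
    using assms(2) unfolding qs_iff by blast
  \<comment> \<open>The added term dominates \<open>f\<close> on the exceptional set and has upper
    integral 0.\<close>
  have "upper f \<le> upper (\<lambda>\<omega>. g \<omega> + top * indicator N \<omega>)"
    using N(2) by (intro upper_mono) (auto simp: indicator_def)
  also have "\<dots> \<le> upper g + upper (\<lambda>\<omega>. top * indicator N \<omega>)"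
    by (intro upper_add) auto
  also have "upper (\<lambda>\<omega>. top * indicator N \<omega>) = 0"
    using N(1) by (subst upper_top_mult) auto
  finally show ?thesis by simp
qed

lemma upos_add_qs:
  assumes [measurable]: "g \<in> borel_measurable M" "h \<in> borel_measurable M"
    and "qs (\<lambda>\<omega>. f \<omega> \<le> g \<omega> + h \<omega>)"
  shows "upos f \<le> upos g + upos h"
proof -
  have "upos f \<le> upper (\<lambda>\<omega>. ennreal (g \<omega>) + ennreal (h \<omega>))"
    using assms(3) by (intro upper_mono_qs)
      (auto elim!: qs_mono intro: order_trans[OF ennreal_leI ennreal_add_le])
  also have "\<dots> \<le> upos g + upos h" by (intro upper_add) auto
  finally show ?thesis .
qed

lemma upos_add:
  assumes "g \<in> borel_measurable M" "h \<in> borel_measurable M"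
    "\<And>\<omega>. \<omega> \<in> space M \<Longrightarrow> f \<omega> \<le> g \<omega> + h \<omega>"
  shows "upos f \<le> upos g + upos h"
  using assms by (intro upos_add_qs qs_space)

lemma upos_mono: "(\<And>\<omega>. \<omega> \<in> space M \<Longrightarrow> f \<omega> \<le> g \<omega>) \<Longrightarrow> upos f \<le> upos g"
  by (intro upper_mono ennreal_leI)

lemma upos_cmult:
  assumes "f \<in> borel_measurable M" "0 \<le> c" shows "upos (\<lambda>\<omega>. c * f \<omega>) = ennreal c * upos f"
  using upper_cmult[of "\<lambda>\<omega>. ennreal (f \<omega>)" c] assms by (simp add: ennreal_mult')

lemma upos_const: "upos (\<lambda>_. c) = ennreal c"
proof (cases "0 \<le> c")
  case True
  then show ?thesis using upper_H[OF H_const, of c] by (simp add: expect_const)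
qed (simp add: ennreal_neg upper_zero)

lemma upos_H:
  assumes "Y \<in> H" shows "upos Y = ennreal (expect (\<lambda>\<omega>. max (Y \<omega>) 0))"
proof -
  have "upos Y = upos (\<lambda>\<omega>. max (Y \<omega>) 0)"
    by (intro upper_cong) (auto simp: max_def ennreal_neg)
  then show ?thesis using upper_H[OF H_max[OF assms H_const], of 0] by simp
qed

lemma upos_H_finite: "Y \<in> H \<Longrightarrow> upos Y < top"
  by (simp add: upos_H)

text \<open>Markov's inequality with an infinite factor: \<open>top\<close> times the indicator of
  \<open>f = top\<close> is still below \<open>f\<close>.\<close>

lemma upper_finite_qs:
  assumes [measurable]: "f \<in> borel_measurable M" and "upper f < top"
  shows "qs (\<lambda>\<omega>. f \<omega> < top)"
proof (rule qsI)
  let ?N = "{\<omega>\<in>space M. f \<omega> = top}"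
  show "?N \<in> sets M" by simp
  have "upper (\<lambda>\<omega>. top * indicator ?N \<omega>) \<le> upper f"
    by (intro upper_mono) (auto simp: indicator_def)
  then show "upper (indicator ?N) = 0"
    using assms(2) by (subst (asm) upper_top_mult) (auto simp: ennreal_top_mult top_unique split: if_splits)
qed (auto simp: less_top)

text \<open>Markov's inequality at level 0: \<open>top * f\<close> dominates the indicator of
  \<open>0 < f\<close>.\<close>

lemma upos_eq_0_imp_qs:
  assumes [measurable]: "f \<in> borel_measurable M" and "upos f = 0"
  shows "qs (\<lambda>\<omega>. f \<omega> \<le> 0)"
proof (rule qsI)
  let ?N = "{\<omega>\<in>space M. 0 < f \<omega>}"
  show "?N \<in> sets M" by simp
  have "upper (indicator ?N) \<le> upper (\<lambda>\<omega>. top * ennreal (f \<omega>))"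
    by (intro upper_mono) (auto simp: indicator_def ennreal_top_mult)
  then show "upper (indicator ?N) = 0"
    using assms(2) by (subst (asm) upper_top_mult) auto
qed auto

text \<open>By sublinearity and monotonicity the difference is at most \<open>E t\<close> of the
  positive part of \<open>X - Y\<close>, and the tower property removes \<open>E t\<close> under
  \<open>expect\<close>. The one-sided form is the one that transports inequalities.\<close>

lemma upos_E_diff:
  assumes "X \<in> H" "Y \<in> H"
  shows "upos (\<lambda>\<omega>. E t X \<omega> - E t Y \<omega>) \<le> upos (\<lambda>\<omega>. X \<omega> - Y \<omega>)"
proof -
  let ?Z = "\<lambda>\<omega>. max (X \<omega> - Y \<omega>) 0"
  have Z: "?Z \<in> H" using assms by (intro H_max H_diff H_const)
  have nn: "0 \<le> E t ?Z \<omega>" if "\<omega> \<in> space M" for \<omega>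
    using E_mono[OF Z H_const, of 0 \<omega> t] that by (simp add: E_const)
  have "upos (\<lambda>\<omega>. E t X \<omega> - E t Y \<omega>) \<le> upos (E t ?Z)"
    by (intro upos_mono order_trans[OF E_diff_le] E_mono assms Z H_diff) auto
  also have "\<dots> = ennreal (expect ?Z)"
    by (simp add: upper_H E_H Z nn expect_E)
  also have "\<dots> = upos (\<lambda>\<omega>. X \<omega> - Y \<omega>)"
    using assms by (simp add: upos_H H_diff)
  finally show ?thesis .
qed

text \<open>This contraction is what extends \<open>E t\<close> to the completion.\<close>

lemma upos_E_abs_diff:
  assumes "X \<in> H" "Y \<in> H"
  shows "upos (\<lambda>\<omega>. \<bar>E t X \<omega> - E t Y \<omega>\<bar>) \<le> upos (\<lambda>\<omega>. \<bar>X \<omega> - Y \<omega>\<bar>)"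
proof -
  let ?Z = "\<lambda>\<omega>. \<bar>X \<omega> - Y \<omega>\<bar>"
  have Z: "?Z \<in> H" using assms by (intro H_abs H_diff)
  have *: "E t U \<omega> - E t V \<omega> \<le> E t ?Z \<omega>" if "{U, V} = {X, Y}" "\<omega> \<in> space M" for U V \<omega>
  proof -
    have "U \<in> H" "V \<in> H" using that assms by auto
    moreover have "U \<omega> - V \<omega> \<le> ?Z \<omega>" for \<omega> using that(1) by (auto simp: doubleton_eq_iff)
    ultimately show ?thesis
      using that(2) by (intro order_trans[OF E_diff_le] E_mono Z H_diff) auto
  qed
  have le: "\<bar>E t X \<omega> - E t Y \<omega>\<bar> \<le> E t ?Z \<omega>" if "\<omega> \<in> space M" for \<omega>
    using *[of X Y \<omega>] *[of Y X \<omega>] that by (simp add: insert_commute abs_le_iff)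
  have "upos (\<lambda>\<omega>. \<bar>E t X \<omega> - E t Y \<omega>\<bar>) \<le> upos (E t ?Z)"
    by (intro upos_mono le)
  also have "\<dots> = ennreal (expect ?Z)"
    using le by (subst upper_H) (auto simp: E_H Z expect_E intro: order_trans[OF abs_ge_zero])
  also have "\<dots> = upos ?Z"
    using Z by (subst upper_H) auto
  finally show ?thesis .
qed

lemma upper_indicator_tendsto_0:
  assumes A: "\<And>n. A n \<in> sets M" and "decseq A" "(\<Inter>n. A n) = {}"
  shows "(\<lambda>n. upper (indicator (A n))) \<longlonglongrightarrow> 0"
proof -
  have "(\<lambda>n. expect (indicator (A n))) \<longlonglongrightarrow> 0"
  proof (rule E_continuous, safe)
    fix \<omega>
    show "decseq (\<lambda>i. indicator (A i) \<omega> :: real)"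
      using \<open>decseq A\<close> by (auto simp: decseq_def indicator_def)
    show "(\<lambda>i. indicator (A i) \<omega> :: real) \<longlonglongrightarrow> 0"
      using LIMSEQ_indicator_decseq[OF \<open>decseq A\<close>, of \<omega>] assms(3) by simp
  qed (simp add: A H_indicator_set)
  then have "(\<lambda>n. ennreal (expect (indicator (A n)))) \<longlonglongrightarrow> ennreal 0" by (rule tendsto_ennrealI)
  then show ?thesis by (simp add: upper_indicator A)
qed

text \<open>Egorov's argument: the events that \<open>h\<close> still exceeds \<open>e / 2\<close>
  at or after time \<open>n\<close> decrease to the empty set, so by continuity they contribute
  little in the end; the rest contributes at most \<open>e / 2\<close>.\<close>

lemma upos_bounded_convergence:
  fixes h :: "nat \<Rightarrow> 'a \<Rightarrow> real"
  assumes [measurable]: "\<And>n. h n \<in> borel_measurable M"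
    and bd: "\<And>n \<omega>. \<omega> \<in> space M \<Longrightarrow> \<bar>h n \<omega>\<bar> \<le> C"
    and lim: "qs (\<lambda>\<omega>. (\<lambda>n. h n \<omega>) \<longlonglongrightarrow> 0)"
  shows "(\<lambda>n. upos (\<lambda>\<omega>. \<bar>h n \<omega>\<bar>)) \<longlonglongrightarrow> 0"
  unfolding ennreal_tendsto_0_iff
proof (intro allI impI)
  fix e :: real assume "0 < e"
  obtain N where [measurable]: "N \<in> sets M" and N: "upper (indicator N) = 0"
    "\<And>\<omega>. \<omega> \<in> space M \<Longrightarrow> \<omega> \<notin> N \<Longrightarrow> (\<lambda>n. h n \<omega>) \<longlonglongrightarrow> 0"
    using lim unfolding qs_iff by blast
  \<comment> \<open>Points of \<open>N\<close> are removed so that the intersection over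
    \<open>n\<close> is really empty and not merely null, since continuity at 0 asks for pointwise
    convergence.\<close>
  define A where "A n = {\<omega>\<in>space M - N. \<exists>j\<ge>n. e / 2 < \<bar>h j \<omega>\<bar>}" for n
  have A[measurable]: "A n \<in> sets M" for n unfolding A_def by measurable
  have C: "0 \<le> C" using bd ex_space by (meson abs_ge_zero order_trans)
  have "(\<lambda>n. upper (indicator (A n))) \<longlonglongrightarrow> 0"
  proof (rule upper_indicator_tendsto_0)
    show "decseq A" unfolding decseq_def A_def by (auto intro: order_trans)
    have "\<exists>n. \<omega> \<notin> A n" for \<omega>
    proof (cases "\<omega> \<in> space M - N")
      case True
      then have "\<forall>\<^sub>F n in sequentially. norm (h n \<omega>) < e / 2"
        using tendsto_norm_zero[OF N(2), of \<omega>] \<open>0 < e\<close> by (intro order_tendstoD) auto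
      then show ?thesis
        unfolding eventually_sequentially A_def by force
    qed (auto simp: A_def)
    then show "(\<Inter>n. A n) = {}" by auto
  qed simp
  then have "(\<lambda>n. ennreal C * upper (indicator (A n))) \<longlonglongrightarrow> ennreal C * 0"
    using C by (simp add: ennreal_tendsto_0_cmult)
  then have "\<forall>\<^sub>F n in sequentially. ennreal C * upper (indicator (A n)) \<le> ennreal (e / 2)"
    using \<open>0 < e\<close> by (simp add: ennreal_tendsto_0_iff)
  then show "\<forall>\<^sub>F n in sequentially. upos (\<lambda>\<omega>. \<bar>h n \<omega>\<bar>) \<le> ennreal e"
  proof eventually_elim
    case (elim n)
    have "upos (\<lambda>\<omega>. \<bar>h n \<omega>\<bar>) \<le> upos (\<lambda>\<omega>. e / 2) + upos (\<lambda>\<omega>. C * indicator (A n) \<omega>)"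
    proof (rule upos_add_qs)
      show "qs (\<lambda>\<omega>. \<bar>h n \<omega>\<bar> \<le> e / 2 + C * indicator (A n) \<omega>)"
      proof (rule qsI[of N])
        fix \<omega> assume "\<omega> \<in> space M" "\<omega> \<notin> N"
        then show "\<bar>h n \<omega>\<bar> \<le> e / 2 + C * indicator (A n) \<omega>"
          using bd[of \<omega> n] \<open>0 < e\<close> by (cases "\<omega> \<in> A n") (auto simp: A_def not_less)
      qed (simp_all add: N)
    qed simp_all
    also have "upos (\<lambda>\<omega>. C * indicator (A n) \<omega>) = ennreal C * upper (indicator (A n))"
      using C by (subst upos_cmult) (auto simp: ennreal_indicator)
    also have "upos (\<lambda>\<omega>. e / 2) + ennreal C * upper (indicator (A n)) \<le> ennreal (e / 2) + ennreal (e / 2)"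
      using elim by (intro add_mono) (auto simp: upos_const)
    also have "\<dots> = ennreal e" using \<open>0 < e\<close> by (simp flip: ennreal_plus)
    finally show ?case .
  qed
qed

lemma upper_limit_le:
  fixes f :: "nat \<Rightarrow> 'a \<Rightarrow> ennreal"
  assumes [measurable]: "\<And>n. f n \<in> borel_measurable M"
    and lim: "qs (\<lambda>\<omega>. (\<lambda>n. f n \<omega>) \<longlonglongrightarrow> g \<omega>)"
    and le: "\<forall>\<^sub>F n in sequentially. upper (f n) \<le> C"
  shows "upper g \<le> C"
proof -
  have "upper g \<le> upper (\<lambda>\<omega>. liminf (\<lambda>n. f n \<omega>))"
    using lim by (intro upper_mono_qs) (auto elim!: qs_mono dest: lim_imp_Liminf[rotated])
  also have "\<dots> \<le> liminf (\<lambda>n. upper (f n))" by (rule upper_Fatou) simp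
  also have "\<dots> \<le> limsup (\<lambda>n. upper (f n))" by (rule Liminf_le_Limsup) simp
  also have "\<dots> \<le> C" using le by (rule Limsup_bounded)
  finally show ?thesis .
qed

end

section \<open>Integrable functions and completeness\<close>

context sl_expectation
begin

text \<open>The tail in the subtracted form \<open>(|f| - n)^+\<close> is Lipschitz in
  \<open>f\<close>, so tails obey a triangle inequality and survive limits; cutting \<open>f\<close>
  off at the level would create jumps.\<close>

definition sl_integrable :: "('a \<Rightarrow> real) \<Rightarrow> bool" where
  "sl_integrable f \<longleftrightarrow> f \<in> borel_measurable M \<and> (\<lambda>n. upos (\<lambda>\<omega>. \<bar>f \<omega>\<bar> - real n)) \<longlonglongrightarrow> 0"

lemma sl_integrable_borel [measurable_dest]: "sl_integrable f \<Longrightarrow> f \<in> borel_measurable M"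
  by (simp add: sl_integrable_def)

lemma sl_integrable_H:
  assumes Y: "Y \<in> H" shows "sl_integrable Y"
proof -
  let ?Z = "\<lambda>n \<omega>. max (\<bar>Y \<omega>\<bar> - real n) 0"
  have Z: "?Z n \<in> H" for n using Y by (intro H_max H_diff H_abs H_const)
  have "(\<lambda>n. expect (?Z n)) \<longlonglongrightarrow> 0"
  proof (rule E_continuous[OF Z], safe)
    fix \<omega>
    show "decseq (\<lambda>n. ?Z n \<omega>)" by (auto simp: decseq_def)
    obtain k where k: "\<bar>Y \<omega>\<bar> \<le> real k" using real_arch_simple by blast
    show "(\<lambda>n. ?Z n \<omega>) \<longlonglongrightarrow> 0"
      by (rule tendsto_eventually) (use k in \<open>auto simp: eventually_sequentially intro!: exI[of _ k]\<close>)
  qed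
  then have "(\<lambda>n. ennreal (expect (?Z n))) \<longlonglongrightarrow> ennreal 0" by (rule tendsto_ennrealI)
  moreover have "upos (\<lambda>\<omega>. \<bar>Y \<omega>\<bar> - real n) = ennreal (expect (?Z n))" for n
    using Y by (intro upos_H H_diff H_abs H_const)
  ultimately show ?thesis using Y by (simp add: sl_integrable_def H_borel)
qed

lemma sl_integrable_limit:
  assumes g: "\<And>n. sl_integrable (g n)" and f[measurable]: "f \<in> borel_measurable M"
    and lim: "(\<lambda>n. upos (\<lambda>\<omega>. \<bar>f \<omega> - g n \<omega>\<bar>)) \<longlonglongrightarrow> 0"
  shows "sl_integrable f"
  unfolding sl_integrable_def ennreal_tendsto_0_iff
proof (intro conjI allI impI f)
  note [measurable] = sl_integrable_borel[OF g]
  fix e :: real assume "0 < e"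
  then have "\<forall>\<^sub>F n in sequentially. upos (\<lambda>\<omega>. \<bar>f \<omega> - g n \<omega>\<bar>) \<le> ennreal (e/2)"
    using lim by (simp add: ennreal_tendsto_0_iff)
  then obtain m where m: "upos (\<lambda>\<omega>. \<bar>f \<omega> - g m \<omega>\<bar>) \<le> ennreal (e/2)"
    by (auto simp: eventually_sequentially)
  have "\<forall>\<^sub>F n in sequentially. upos (\<lambda>\<omega>. \<bar>g m \<omega>\<bar> - real n) \<le> ennreal (e/2)"
    using g[of m] \<open>0 < e\<close> by (simp add: ennreal_tendsto_0_iff sl_integrable_def)
  then show "\<forall>\<^sub>F n in sequentially. upos (\<lambda>\<omega>. \<bar>f \<omega>\<bar> - real n) \<le> ennreal e"
  proof eventually_elim
    case (elim n)
    have "upos (\<lambda>\<omega>. \<bar>f \<omega>\<bar> - real n) \<le> upos (\<lambda>\<omega>. \<bar>f \<omega> - g m \<omega>\<bar>) + upos (\<lambda>\<omega>. \<bar>g m \<omega>\<bar> - real n)"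
      by (intro upos_add) auto
    also have "\<dots> \<le> ennreal (e/2) + ennreal (e/2)" by (intro add_mono elim m)
    also have "\<dots> = ennreal e" using \<open>0 < e\<close> by (simp flip: ennreal_plus)
    finally show ?case .
  qed
qed

text \<open>
  Truncating and rounding keeps measurability with respect to any sub-\<open>\<sigma>\<close>-algebra, so adapted
  functions have adapted approximations in \<open>H\<close>.
\<close>

lemma sl_integrable_approx:
  assumes f: "sl_integrable f"
  shows "\<exists>Y. (\<forall>n. Y n \<in> H) \<and> (\<forall>n. bounded (Y n ` space M)) \<and>
    (\<forall>n t. f \<in> borel_measurable (F t) \<longrightarrow> Y n \<in> borel_measurable (F t)) \<and>
    (\<lambda>n. upos (\<lambda>\<omega>. \<bar>f \<omega> - Y n \<omega>\<bar>)) \<longlonglongrightarrow> 0"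
proof -
  note [measurable] = sl_integrable_borel[OF f]
  define c where "c n \<omega> = max (- real n) (min (real n) (f \<omega>))" for n \<omega>
  \<comment> \<open>Boundedness does not put \<open>c n\<close> into \<open>H\<close>, a finite
    range does: rounding down to multiples of \<open>1 / Suc n\<close> gives a simple function at a
    cost that vanishes with \<open>n\<close>.\<close>
  define k where "k n \<omega> = \<lfloor>real (Suc n) * c n \<omega>\<rfloor>" for n \<omega>
  define Y where "Y n \<omega> = indicator (space M) \<omega> * (real_of_int (k n \<omega>) / real (Suc n))" for n \<omega>
  have c: "\<bar>c n \<omega>\<bar> \<le> real n" for n \<omega> by (auto simp: c_def)
  have fc: "\<bar>f \<omega> - c n \<omega>\<bar> \<le> max (\<bar>f \<omega>\<bar> - real n) 0" for n \<omega> by (auto simp: c_def)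
  have cY: "\<bar>c n \<omega> - real_of_int (k n \<omega>) / real (Suc n)\<bar> \<le> 1 / real (Suc n)" for n \<omega>
  proof -
    have "c n \<omega> - real_of_int (k n \<omega>) / real (Suc n)
        = (real (Suc n) * c n \<omega> - real_of_int (k n \<omega>)) / real (Suc n)"
      by (simp add: diff_divide_distrib del: of_nat_Suc)
    also have "\<bar>\<dots>\<bar> \<le> 1 / real (Suc n)"
      unfolding abs_divide by (intro frac_le) (auto simp: k_def abs_le_iff, linarith+)
    finally show ?thesis .
  qed
  have rng: "k n ` space M \<subseteq> {- int (Suc n * n) - 1 .. int (Suc n * n)}" for n
  proof (rule image_subsetI)
    fix \<omega>
    have "\<bar>real (Suc n) * c n \<omega>\<bar> \<le> real (Suc n) * real n"
      unfolding abs_mult using c[of n \<omega>] by (intro mult_mono) auto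
    then have "- (real (Suc n) * real n) \<le> real (Suc n) * c n \<omega>"
      "real (Suc n) * c n \<omega> \<le> real (Suc n) * real n"
      by (simp_all only: abs_le_iff) linarith
    then have "real_of_int (- int (Suc n * n)) \<le> real (Suc n) * c n \<omega>"
      "real (Suc n) * c n \<omega> \<le> real_of_int (int (Suc n * n))"
      by (simp_all only: of_int_minus of_int_of_nat_eq of_nat_mult of_int_mult)
    then have "- int (Suc n * n) \<le> k n \<omega>" "k n \<omega> \<le> int (Suc n * n)"
      unfolding k_def by (auto simp: le_floor_iff floor_le_iff)
    then show "k n \<omega> \<in> {- int (Suc n * n) - 1 .. int (Suc n * n)}" by simp
  qed
  have sf: "simple_function M (\<lambda>\<omega>. real_of_int (k n \<omega>) / real (Suc n))" for n
  proof -
    have "finite (k n ` space M)" by (rule finite_subset[OF rng]) simp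
    moreover have "k n \<in> measurable M (count_space UNIV)"
      unfolding k_def c_def by measurable
    ultimately have "simple_function M (k n)"
      by (auto simp: simple_function_def intro: measurable_sets)
    then show ?thesis
      by (rule simple_function_compose1[where g="\<lambda>i. real_of_int i / real (Suc n)"])
  qed
  show ?thesis
  proof (intro exI[of _ Y] conjI allI impI)
    show "Y n \<in> H" for n unfolding Y_def[abs_def] using sf by (rule H_simple_function)
    have "Y n ` space M = (\<lambda>\<omega>. real_of_int (k n \<omega>) / real (Suc n)) ` space M" for n
      by (auto simp: Y_def intro!: image_cong)
    then show "bounded (Y n ` space M)" for n
      using sf[of n] by (auto simp: simple_function_def intro: finite_imp_bounded)
    show "Y n \<in> borel_measurable (F t)" if [measurable]: "f \<in> borel_measurable (F t)" for n t
    proof -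
      have "(\<lambda>\<omega>. real_of_int (k n \<omega>) / real (Suc n)) \<in> borel_measurable (F t)"
        unfolding k_def c_def by measurable
      then show ?thesis
        by (rule measurable_cong[THEN iffD1, rotated]) (simp add: Y_def space_F)
    qed
    have le: "upos (\<lambda>\<omega>. \<bar>f \<omega> - Y n \<omega>\<bar>) \<le> upos (\<lambda>\<omega>. \<bar>f \<omega>\<bar> - real n) + ennreal (1 / real (Suc n))" for n
    proof -
      have "upos (\<lambda>\<omega>. \<bar>f \<omega> - Y n \<omega>\<bar>) \<le> upos (\<lambda>\<omega>. max (\<bar>f \<omega>\<bar> - real n) 0) + upos (\<lambda>\<omega>. 1 / real (Suc n))"
      proof (rule upos_add)
        fix \<omega> assume "\<omega> \<in> space M"
        then have "Y n \<omega> = real_of_int (k n \<omega>) / real (Suc n)" by (simp add: Y_def)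
        then show "\<bar>f \<omega> - Y n \<omega>\<bar> \<le> max (\<bar>f \<omega>\<bar> - real n) 0 + 1 / real (Suc n)"
          using fc[of \<omega> n] cY[of n \<omega>] by linarith
      qed auto
      also have "upos (\<lambda>\<omega>. max (\<bar>f \<omega>\<bar> - real n) 0) = upos (\<lambda>\<omega>. \<bar>f \<omega>\<bar> - real n)"
        by (intro upper_cong) (auto simp: max_def ennreal_neg)
      finally show ?thesis by (simp add: upos_const)
    qed
    have "(\<lambda>n. ennreal (1 / real (Suc n))) \<longlonglongrightarrow> ennreal 0"
      by (intro tendsto_ennrealI LIMSEQ_Suc[OF lim_1_over_n])
    with f have "(\<lambda>n. upos (\<lambda>\<omega>. \<bar>f \<omega>\<bar> - real n) + ennreal (1 / real (Suc n))) \<longlonglongrightarrow> 0"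
      by (intro ennreal_tendsto_0_add) (auto simp: sl_integrable_def)
    then show "(\<lambda>n. upos (\<lambda>\<omega>. \<bar>f \<omega> - Y n \<omega>\<bar>)) \<longlonglongrightarrow> 0"
      by (rule ennreal_tendsto_0_le) (rule le)
  qed
qed

section \<open>Stability of integrability under domination and linear operations\<close>

lemma sl_integrable_mono:
  assumes g: "sl_integrable g" and f: "f \<in> borel_measurable M" and le: "qs (\<lambda>\<omega>. \<bar>f \<omega>\<bar> \<le> \<bar>g \<omega>\<bar>)"
  shows "sl_integrable f"
proof -
  note [measurable] = sl_integrable_borel[OF g]
  have "(\<lambda>n. upos (\<lambda>\<omega>. \<bar>g \<omega>\<bar> - real n)) \<longlonglongrightarrow> 0" using g by (simp add: sl_integrable_def)
  moreover have "upos (\<lambda>\<omega>. \<bar>f \<omega>\<bar> - real n) \<le> upos (\<lambda>\<omega>. \<bar>g \<omega>\<bar> - real n)" for n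
    using le by (intro upper_mono_qs) (auto elim!: qs_mono intro!: ennreal_leI)
  ultimately have "(\<lambda>n. upos (\<lambda>\<omega>. \<bar>f \<omega>\<bar> - real n)) \<longlonglongrightarrow> 0" by (rule ennreal_tendsto_0_le)
  with f show ?thesis by (simp add: sl_integrable_def)
qed

lemma sl_integrable_add:
  assumes f: "sl_integrable f" and g: "sl_integrable g"
  shows "sl_integrable (\<lambda>\<omega>. f \<omega> + g \<omega>)"
proof -
  note [measurable] = sl_integrable_borel[OF f] sl_integrable_borel[OF g]
  obtain Y where Y: "\<And>n. Y n \<in> H" "(\<lambda>n. upos (\<lambda>\<omega>. \<bar>f \<omega> - Y n \<omega>\<bar>)) \<longlonglongrightarrow> 0"
    using sl_integrable_approx[OF f] by blast
  obtain Z where Z: "\<And>n. Z n \<in> H" "(\<lambda>n. upos (\<lambda>\<omega>. \<bar>g \<omega> - Z n \<omega>\<bar>)) \<longlonglongrightarrow> 0"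
    using sl_integrable_approx[OF g] by blast
  note [measurable] = H_borel[OF Y(1)] H_borel[OF Z(1)]
  show ?thesis
  proof (rule sl_integrable_limit)
    show "sl_integrable (\<lambda>\<omega>. Y n \<omega> + Z n \<omega>)" for n
      using Y Z by (intro sl_integrable_H H_add)
    show "(\<lambda>n. upos (\<lambda>\<omega>. \<bar>f \<omega> + g \<omega> - (Y n \<omega> + Z n \<omega>)\<bar>)) \<longlonglongrightarrow> 0"
      by (rule ennreal_tendsto_0_le[OF ennreal_tendsto_0_add[OF Y(2) Z(2)]])
        (rule upos_add, auto)
  qed simp
qed

lemma sl_integrable_const: "sl_integrable (\<lambda>_. c)"
  by (intro sl_integrable_H H_const)

lemma sl_integrable_abs: "sl_integrable f \<Longrightarrow> sl_integrable (\<lambda>\<omega>. \<bar>f \<omega>\<bar>)"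
  by (auto simp: sl_integrable_def)

lemma sl_integrable_uminus: "sl_integrable f \<Longrightarrow> sl_integrable (\<lambda>\<omega>. - f \<omega>)"
  by (auto simp: sl_integrable_def)

lemma sl_integrable_diff: "sl_integrable f \<Longrightarrow> sl_integrable g \<Longrightarrow> sl_integrable (\<lambda>\<omega>. f \<omega> - g \<omega>)"
  using sl_integrable_add[of f "\<lambda>\<omega>. - g \<omega>"] sl_integrable_uminus[of g] by simp

lemma sl_integrable_indicator:
  assumes "sl_integrable f" "A \<in> sets M" shows "sl_integrable (\<lambda>\<omega>. indicator A \<omega> * f \<omega>)"
  using assms by (intro sl_integrable_mono[OF assms(1)] qs_space) (auto simp: indicator_def)

lemma upos_finite:
  assumes "sl_integrable f" shows "upos f < top"
proof -
  obtain Y where Y: "\<And>n. Y n \<in> H" "(\<lambda>n. upos (\<lambda>\<omega>. \<bar>f \<omega> - Y n \<omega>\<bar>)) \<longlonglongrightarrow> 0"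
    using sl_integrable_approx[OF assms] by blast
  note [measurable] = sl_integrable_borel[OF assms] H_borel[OF Y(1)]
  have "\<forall>\<^sub>F n in sequentially. upos (\<lambda>\<omega>. \<bar>f \<omega> - Y n \<omega>\<bar>) < 1"
    using Y(2) by (intro order_tendstoD) auto
  then obtain n where n: "upos (\<lambda>\<omega>. \<bar>f \<omega> - Y n \<omega>\<bar>) < 1"
    by (auto simp: eventually_sequentially)
  have "upos f \<le> upos (\<lambda>\<omega>. \<bar>f \<omega> - Y n \<omega>\<bar>) + upos (Y n)"
    by (intro upos_add) auto
  also have "\<dots> < top"
    using less_trans[OF n ennreal_one_less_top] upos_H_finite[OF Y(1), of n] by (auto simp: ennreal_add_eq_top less_top)
  finally show ?thesis .
qed

text \<open>The Riesz-Fischer argument. Along a subsequence with geometrically small increments the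
  sum of the increments has finite upper integral, so it is quasi-surely finite and the subsequence
  converges; Fatou's lemma then compares the limit with the whole sequence.\<close>

lemma Cauchy_imp_qs_limit:
  assumes Y: "\<And>n. Y n \<in> H"
    and Cauchy: "\<And>e::real. 0 < e \<Longrightarrow> \<exists>N. \<forall>m\<ge>N. \<forall>n\<ge>N. upos (\<lambda>\<omega>. \<bar>Y m \<omega> - Y n \<omega>\<bar>) \<le> ennreal e"
  obtains g r where "strict_mono r" "sl_integrable g"
    "(\<lambda>n. upos (\<lambda>\<omega>. \<bar>g \<omega> - Y n \<omega>\<bar>)) \<longlonglongrightarrow> 0"
    "qs (\<lambda>\<omega>. (\<lambda>n. Y (r n) \<omega>) \<longlonglongrightarrow> g \<omega>)"
proof -
  note [measurable] = H_borel[OF Y]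
  have "\<forall>j. \<exists>N. \<forall>m\<ge>N. \<forall>n\<ge>N. upos (\<lambda>\<omega>. \<bar>Y m \<omega> - Y n \<omega>\<bar>) \<le> ennreal ((1/2)^j)"
    using Cauchy by simp
  then obtain N where N: "\<And>j m n. N j \<le> m \<Longrightarrow> N j \<le> n \<Longrightarrow> upos (\<lambda>\<omega>. \<bar>Y m \<omega> - Y n \<omega>\<bar>) \<le> ennreal ((1/2)^j)"
    by metis
  \<comment> \<open>Partial sums of \<open>Suc (N i)\<close> increase strictly and stay above
    \<open>N j\<close>.\<close>
  define r where "r j = (\<Sum>i\<le>j. Suc (N i))" for j
  have r: "strict_mono r" by (rule strict_monoI_Suc) (simp add: r_def)
  have rN: "N j \<le> r j" for j
    unfolding r_def using member_le_sum[of j "{..j}" "\<lambda>i. Suc (N i)"] by simp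
  let ?d = "\<lambda>j \<omega>. \<bar>Y (r (Suc j)) \<omega> - Y (r j) \<omega>\<bar>"
  have "upper (\<lambda>\<omega>. \<Sum>j. ennreal (?d j \<omega>)) \<le> (\<Sum>j. upos (?d j))"
    by (intro upper_suminf) simp
  also have "\<dots> \<le> (\<Sum>j. ennreal ((1/2)^j))"
    using rN strict_mono_less_eq[OF r]
    by (intro suminf_le N) (auto intro: order_trans[OF rN])
  also have "\<dots> < top"
    unfolding less_top[symmetric] by (rule ennreal_suminf_neq_top) (auto intro: summable_geometric)
  finally have "qs (\<lambda>\<omega>. (\<Sum>j. ennreal (?d j \<omega>)) < top)"
    by (intro upper_finite_qs) auto
  moreover have "convergent (\<lambda>j. Y (r j) \<omega>)" if "(\<Sum>j. ennreal (?d j \<omega>)) < top" for \<omega>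
  proof -
    have "summable (\<lambda>j. ?d j \<omega>)" using that by (intro summable_suminf_not_top) auto
    then have "summable (\<lambda>j. Y (r (Suc j)) \<omega> - Y (r j) \<omega>)" by (rule summable_rabs_cancel)
    then have "convergent (\<lambda>n. \<Sum>j<n. Y (r (Suc j)) \<omega> - Y (r j) \<omega>)"
      by (simp add: summable_iff_convergent)
    then have "convergent (\<lambda>n. Y (r n) \<omega> - Y (r 0) \<omega>)" by (simp add: sum_lessThan_telescope[of "\<lambda>j. Y (r j) \<omega>"])
    then show ?thesis by (simp add: convergent_diff_const_right_iff)
  qed
  ultimately have conv: "qs (\<lambda>\<omega>. (\<lambda>j. Y (r j) \<omega>) \<longlonglongrightarrow> lim (\<lambda>j. Y (r j) \<omega>))"
    unfolding convergent_LIMSEQ_iff[symmetric] by (rule qs_mono)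
  \<comment> \<open>Where the subsequence diverges, a null event, \<open>lim\<close> is an
    unspecified number; \<open>g\<close> is measurable all the same.\<close>
  define g where "g \<omega> = lim (\<lambda>j. Y (r j) \<omega>)" for \<omega>
  have g[measurable]: "g \<in> borel_measurable M" unfolding g_def by measurable
  have lim: "(\<lambda>n. upos (\<lambda>\<omega>. \<bar>g \<omega> - Y n \<omega>\<bar>)) \<longlonglongrightarrow> 0"
    unfolding ennreal_tendsto_0_iff
  proof (intro allI impI)
    fix e :: real assume "0 < e"
    then obtain K where K: "\<And>m n. K \<le> m \<Longrightarrow> K \<le> n \<Longrightarrow> upos (\<lambda>\<omega>. \<bar>Y m \<omega> - Y n \<omega>\<bar>) \<le> ennreal e"
      using Cauchy by blast
    have "upos (\<lambda>\<omega>. \<bar>g \<omega> - Y n \<omega>\<bar>) \<le> ennreal e" if n: "K \<le> n" for n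
    proof (rule upper_limit_le)
      show "qs (\<lambda>\<omega>. (\<lambda>j. ennreal \<bar>Y (r j) \<omega> - Y n \<omega>\<bar>) \<longlonglongrightarrow> ennreal \<bar>g \<omega> - Y n \<omega>\<bar>)"
        using conv unfolding g_def[symmetric]
        by (rule qs_mono) (intro tendsto_ennrealI tendsto_intros)
      show "\<forall>\<^sub>F j in sequentially. upos (\<lambda>\<omega>. \<bar>Y (r j) \<omega> - Y n \<omega>\<bar>) \<le> ennreal e"
        unfolding eventually_sequentially using seq_suble[OF r] n
        by (intro exI[of _ K]) (auto intro!: K intro: order_trans)
    qed simp
    then show "\<forall>\<^sub>F n in sequentially. upos (\<lambda>\<omega>. \<bar>g \<omega> - Y n \<omega>\<bar>) \<le> ennreal e"
      unfolding eventually_sequentially by blast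
  qed
  have "sl_integrable g"
    by (rule sl_integrable_limit[OF sl_integrable_H[OF Y] g lim])
  then show ?thesis by (rule that[OF r _ lim conv[folded g_def]])
qed

lemma upos_tendsto_0_imp_Cauchy:
  fixes e :: real
  assumes Y: "\<And>n. Y n \<in> H" and "0 < e" and [measurable]: "g \<in> borel_measurable M"
    and lim: "(\<lambda>n. upos (\<lambda>\<omega>. \<bar>g \<omega> - Y n \<omega>\<bar>)) \<longlonglongrightarrow> 0"
  shows "\<exists>N. \<forall>m\<ge>N. \<forall>n\<ge>N. upos (\<lambda>\<omega>. \<bar>Y m \<omega> - Y n \<omega>\<bar>) \<le> ennreal e"
proof -
  note [measurable] = H_borel[OF Y]
  have "\<forall>\<^sub>F n in sequentially. upos (\<lambda>\<omega>. \<bar>g \<omega> - Y n \<omega>\<bar>) \<le> ennreal (e/2)"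
    using lim \<open>0 < e\<close> by (simp add: ennreal_tendsto_0_iff)
  then obtain N where N: "\<And>n. N \<le> n \<Longrightarrow> upos (\<lambda>\<omega>. \<bar>g \<omega> - Y n \<omega>\<bar>) \<le> ennreal (e/2)"
    by (auto simp: eventually_sequentially)
  have "upos (\<lambda>\<omega>. \<bar>Y m \<omega> - Y n \<omega>\<bar>) \<le> ennreal e" if "N \<le> m" "N \<le> n" for m n
  proof -
    have "upos (\<lambda>\<omega>. \<bar>Y m \<omega> - Y n \<omega>\<bar>) \<le> upos (\<lambda>\<omega>. \<bar>g \<omega> - Y m \<omega>\<bar>) + upos (\<lambda>\<omega>. \<bar>g \<omega> - Y n \<omega>\<bar>)"
      by (intro upos_add) auto
    also have "\<dots> \<le> ennreal (e/2) + ennreal (e/2)" by (intro add_mono N that)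
    also have "\<dots> = ennreal e" using \<open>0 < e\<close> by (simp flip: ennreal_plus)
    finally show ?thesis .
  qed
  then show ?thesis by blast
qed

lemma upos_tendsto_0_unique:
  assumes "\<And>n. Y n \<in> borel_measurable M" "f \<in> borel_measurable M" "g \<in> borel_measurable M"
    and f: "(\<lambda>n. upos (\<lambda>\<omega>. \<bar>f \<omega> - Y n \<omega>\<bar>)) \<longlonglongrightarrow> 0"
    and g: "(\<lambda>n. upos (\<lambda>\<omega>. \<bar>g \<omega> - Y n \<omega>\<bar>)) \<longlonglongrightarrow> 0"
  shows "qs (\<lambda>\<omega>. f \<omega> = g \<omega>)"
proof -
  note [measurable] = assms(1-3)
  have "upos (\<lambda>\<omega>. \<bar>f \<omega> - g \<omega>\<bar>) \<le> upos (\<lambda>\<omega>. \<bar>f \<omega> - Y n \<omega>\<bar>) + upos (\<lambda>\<omega>. \<bar>g \<omega> - Y n \<omega>\<bar>)" for n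
    by (intro upos_add) auto
  then have "(\<lambda>n::nat. upos (\<lambda>\<omega>. \<bar>f \<omega> - g \<omega>\<bar>)) \<longlonglongrightarrow> 0"
    by (rule ennreal_tendsto_0_le[OF ennreal_tendsto_0_add[OF f g]])
  then have "upos (\<lambda>\<omega>. \<bar>f \<omega> - g \<omega>\<bar>) = 0" by (simp add: LIMSEQ_const_iff)
  then have "qs (\<lambda>\<omega>. \<bar>f \<omega> - g \<omega>\<bar> \<le> 0)" by (intro upos_eq_0_imp_qs) auto
  then show ?thesis by (rule qs_mono) auto
qed

end

section \<open>The space \<open>L\<^sup>1\<close>\<close>

lemma LIMSEQ_enn2real_0_iff:
  assumes "\<And>n. f n < (top::ennreal)"
  shows "(\<lambda>n. enn2real (f n)) \<longlonglongrightarrow> 0 \<longleftrightarrow> f \<longlonglongrightarrow> 0"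
proof
  assume "(\<lambda>n. enn2real (f n)) \<longlonglongrightarrow> 0"
  then have "(\<lambda>n. ennreal (enn2real (f n))) \<longlonglongrightarrow> ennreal 0" by (rule tendsto_ennrealI)
  then show "f \<longlonglongrightarrow> 0" using assms by (simp add: ennreal_enn2real)
next
  assume "f \<longlonglongrightarrow> 0"
  then show "(\<lambda>n. enn2real (f n)) \<longlonglongrightarrow> 0"
    using tendsto_enn2real[of f 0 sequentially] by simp
qed

context sl_expectation
begin

lemma upos_abs_H: "Y \<in> H \<Longrightarrow> upos (\<lambda>\<omega>. \<bar>Y \<omega>\<bar>) = ennreal (expect (\<lambda>\<omega>. \<bar>Y \<omega>\<bar>))"
  by (rule upper_H[OF H_abs]) auto

lemma sl_integrable_cong_qs:
  "sl_integrable g \<Longrightarrow> f \<in> borel_measurable M \<Longrightarrow> qs (\<lambda>\<omega>. f \<omega> = g \<omega>) \<Longrightarrow> sl_integrable f"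
  by (erule sl_integrable_mono) (auto elim: qs_mono)

lemma upos_cong_qs:
  assumes "f \<in> borel_measurable M" "g \<in> borel_measurable M" "qs (\<lambda>\<omega>. f \<omega> = g \<omega>)"
  shows "upos f = upos g"
proof (rule antisym)
  show "upos f \<le> upos g" using assms by (intro upper_mono_qs) (auto elim: qs_mono)
  show "upos g \<le> upos f" using assms by (intro upper_mono_qs) (auto elim: qs_mono)
qed

text \<open>The norm limit \<open>g\<close> is also the quasi-sure limit along a subsequence, where
  it meets the quasi-sure limit \<open>X\<close> of the full sequence. In particular
  \<open>X\<close> is finite quasi-surely.\<close>

lemma represents_imp_limit:
  assumes "represents Xs X"
  obtains g where "sl_integrable g" "qs (\<lambda>\<omega>. X \<omega> = ereal (g \<omega>))"
    "(\<lambda>n. upos (\<lambda>\<omega>. \<bar>g \<omega> - Xs n \<omega>\<bar>)) \<longlonglongrightarrow> 0"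
proof -
  have H: "Xs n \<in> H" for n using assms by (auto simp: represents_def)
  have lim: "qs (\<lambda>\<omega>. (\<lambda>n. ereal (Xs n \<omega>)) \<longlonglongrightarrow> X \<omega>)" using assms by (auto simp: represents_def)
  have Cauchy: "\<exists>N. \<forall>m\<ge>N. \<forall>n\<ge>N. upos (\<lambda>\<omega>. \<bar>Xs m \<omega> - Xs n \<omega>\<bar>) \<le> ennreal e" if e: "0 < e" for e
  proof -
    obtain N where "\<forall>m\<ge>N. \<forall>n\<ge>N. expect (\<lambda>\<omega>. \<bar>Xs m \<omega> - Xs n \<omega>\<bar>) < e"
      using assms e unfolding represents_def by blast
    then show ?thesis
      by (intro exI[of _ N]) (force simp: upos_abs_H H_diff H intro!: ennreal_leI intro: less_imp_le)
  qed
  obtain g r where r: "strict_mono r" and g: "sl_integrable g"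
    "(\<lambda>n. upos (\<lambda>\<omega>. \<bar>g \<omega> - Xs n \<omega>\<bar>)) \<longlonglongrightarrow> 0" and gr: "qs (\<lambda>\<omega>. (\<lambda>n. Xs (r n) \<omega>) \<longlonglongrightarrow> g \<omega>)"
    by (rule Cauchy_imp_qs_limit[OF H Cauchy])
  have "qs (\<lambda>\<omega>. X \<omega> = ereal (g \<omega>))"
    using qs_conj[OF lim gr]
  proof (rule qs_mono, elim conjE)
    fix \<omega> assume X: "(\<lambda>n. ereal (Xs n \<omega>)) \<longlonglongrightarrow> X \<omega>" and "(\<lambda>n. Xs (r n) \<omega>) \<longlonglongrightarrow> g \<omega>"
    then have "(\<lambda>n. ereal (Xs (r n) \<omega>)) \<longlonglongrightarrow> ereal (g \<omega>)" by simp
    moreover have "(\<lambda>n. ereal (Xs (r n) \<omega>)) \<longlonglongrightarrow> X \<omega>"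
      using LIMSEQ_subseq_LIMSEQ[OF X r] by (simp add: o_def)
    ultimately show "X \<omega> = ereal (g \<omega>)" by (rule LIMSEQ_unique[rotated])
  qed
  with g show ?thesis by (intro that)
qed

text \<open>Norm convergence of the bounded approximations does not give the quasi-sure convergence
  that \<open>represents\<close> demands, hence the passage to a subsequence.\<close>

lemma ex_represents:
  assumes g: "sl_integrable g" and X: "qs (\<lambda>\<omega>. X \<omega> = ereal (g \<omega>))"
  shows "\<exists>Xs. (\<forall>n. Xs n \<in> H) \<and> (\<forall>n. bounded (Xs n ` space M)) \<and> represents Xs X"
proof -
  obtain Y where Y: "\<And>n. Y n \<in> H" "\<And>n. bounded (Y n ` space M)"
    and lim: "(\<lambda>n. upos (\<lambda>\<omega>. \<bar>g \<omega> - Y n \<omega>\<bar>)) \<longlonglongrightarrow> 0"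
    using sl_integrable_approx[OF g] by blast
  note gm = sl_integrable_borel[OF g]
  have Cauchy: "\<exists>N. \<forall>m\<ge>N. \<forall>n\<ge>N. upos (\<lambda>\<omega>. \<bar>Y m \<omega> - Y n \<omega>\<bar>) \<le> ennreal e" if "0 < e" for e
    by (rule upos_tendsto_0_imp_Cauchy[OF Y(1) that gm lim])
  obtain g' r where r: "strict_mono r" and g': "sl_integrable g'"
    "(\<lambda>n. upos (\<lambda>\<omega>. \<bar>g' \<omega> - Y n \<omega>\<bar>)) \<longlonglongrightarrow> 0" and gr: "qs (\<lambda>\<omega>. (\<lambda>n. Y (r n) \<omega>) \<longlonglongrightarrow> g' \<omega>)"
    by (rule Cauchy_imp_qs_limit[OF Y(1) Cauchy])
  have eq: "qs (\<lambda>\<omega>. g \<omega> = g' \<omega>)"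
    using Y g' g lim by (intro upos_tendsto_0_unique[of Y]) (auto dest: H_borel sl_integrable_borel)
  have "represents (\<lambda>n. Y (r n)) X"
    unfolding represents_def
  proof (intro conjI allI impI)
    fix e :: real assume "0 < e"
    \<comment> \<open>Half of \<open>e\<close> turns the non-strict Cauchy bound into the strict one
      of \<open>represents\<close>.\<close>
    then obtain N where N: "\<And>m n. N \<le> m \<Longrightarrow> N \<le> n \<Longrightarrow> upos (\<lambda>\<omega>. \<bar>Y m \<omega> - Y n \<omega>\<bar>) \<le> ennreal (e/2)"
      using Cauchy[of "e/2"] by auto
    have "expect (\<lambda>\<omega>. \<bar>Y (r m) \<omega> - Y (r n) \<omega>\<bar>) < e" if "N \<le> m" "N \<le> n" for m n
    proof -
      have "upos (\<lambda>\<omega>. \<bar>Y (r m) \<omega> - Y (r n) \<omega>\<bar>) \<le> ennreal (e/2)"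
        using that seq_suble[OF r] by (intro N) (auto intro: order_trans)
      then show ?thesis using \<open>0 < e\<close> by (simp add: upos_abs_H H_diff Y ennreal_le_iff)
    qed
    then show "\<exists>N. \<forall>m\<ge>N. \<forall>n\<ge>N. expect (\<lambda>\<omega>. \<bar>Y (r m) \<omega> - Y (r n) \<omega>\<bar>) < e" by blast
  next
    show "qs (\<lambda>\<omega>. (\<lambda>n. ereal (Y (r n) \<omega>)) \<longlonglongrightarrow> X \<omega>)"
      by (rule qs_mono[OF qs_conj[OF X qs_conj[OF eq gr]]]) simp
  qed (rule Y)
  then show ?thesis using Y by (intro exI[of _ "\<lambda>n. Y (r n)"]) auto
qed

text \<open>The dictionary between the completion and integrable real functions. Infinite values
  occur only on a null set, so the analysis below is done for
  \<open>real_of_ereal (X \<omega>)\<close>.\<close>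

lemma L1_iff:
  "X \<in> L1 \<longleftrightarrow> X \<in> borel_measurable M \<and> sl_integrable (\<lambda>\<omega>. real_of_ereal (X \<omega>)) \<and>
    qs (\<lambda>\<omega>. X \<omega> = ereal (real_of_ereal (X \<omega>)))"
proof safe
  assume "X \<in> L1"
  then obtain Xs where m[measurable]: "X \<in> borel_measurable M" and Xs: "represents Xs X"
    by (auto simp: L1_def completion_def)
  obtain g where g: "sl_integrable g" "qs (\<lambda>\<omega>. X \<omega> = ereal (g \<omega>))"
    by (rule represents_imp_limit[OF Xs])
  show "X \<in> borel_measurable M" by fact
  show "sl_integrable (\<lambda>\<omega>. real_of_ereal (X \<omega>))"
    by (rule sl_integrable_cong_qs[OF g(1)]) (auto intro: qs_mono[OF g(2)])
  show "qs (\<lambda>\<omega>. X \<omega> = ereal (real_of_ereal (X \<omega>)))"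
    by (rule qs_mono[OF g(2)]) simp
next
  assume "X \<in> borel_measurable M" "sl_integrable (\<lambda>\<omega>. real_of_ereal (X \<omega>))"
    "qs (\<lambda>\<omega>. X \<omega> = ereal (real_of_ereal (X \<omega>)))"
  then show "X \<in> L1"
    using ex_represents[of "\<lambda>\<omega>. real_of_ereal (X \<omega>)" X] by (auto simp: L1_def completion_def)
qed

text \<open>The approximations of an integrable function are truncated, hence bounded. Continuity at
  0 makes every function in \<open>H\<close> integrable, which leaves no room between the two
  completions.\<close>

lemma L1_eq_L1b: "L1 = L1b"
proof
  show "L1b \<subseteq> L1" by (auto simp: L1_def L1b_def completion_def)
  show "L1 \<subseteq> L1b"
  proof
    fix X assume "X \<in> L1"
    then have "X \<in> borel_measurable M" and
      "\<exists>Xs. (\<forall>n. Xs n \<in> H) \<and> (\<forall>n. bounded (Xs n ` space M)) \<and> represents Xs X"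
      by (auto simp: L1_iff intro: ex_represents)
    then show "X \<in> L1b" by (auto simp: L1b_def completion_def)
  qed
qed

text \<open>Nonnegativity of \<open>g\<close> links \<open>expect_L1\<close> to \<open>upos\<close>,
  which sees positive parts only. A sequence representing \<open>X\<close> may take negative values,
  yet these are bounded by its distance from \<open>g\<close>.\<close>

lemma expect_L1_eq:
  assumes g: "sl_integrable g" and nonneg: "\<And>\<omega>. \<omega> \<in> space M \<Longrightarrow> 0 \<le> g \<omega>"
    and X: "qs (\<lambda>\<omega>. X \<omega> = ereal (g \<omega>))"
  shows "expect_L1 X = enn2real (upos g)"
  unfolding expect_L1_def
proof (rule the_equality)
  note [measurable] = sl_integrable_borel[OF g]
  show *: "\<forall>Xs. represents Xs X \<longrightarrow> (\<lambda>n. expect (Xs n)) \<longlonglongrightarrow> enn2real (upos g)"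
  proof (intro allI impI)
    fix Xs assume Xs: "represents Xs X"
    obtain h where h: "sl_integrable h" "qs (\<lambda>\<omega>. X \<omega> = ereal (h \<omega>))"
      and lim: "(\<lambda>n. upos (\<lambda>\<omega>. \<bar>h \<omega> - Xs n \<omega>\<bar>)) \<longlonglongrightarrow> 0"
      by (rule represents_imp_limit[OF Xs])
    have H: "Xs n \<in> H" for n using Xs by (auto simp: represents_def)
    note [measurable] = sl_integrable_borel[OF h(1)] H_borel[OF H]
    have gh: "qs (\<lambda>\<omega>. g \<omega> = h \<omega>)"
      by (rule qs_mono[OF qs_conj[OF X h(2)]]) (metis ereal.inject)
    define a where "a n = enn2real (upos (\<lambda>\<omega>. \<bar>g \<omega> - Xs n \<omega>\<bar>))" for n
    have fin: "upos (\<lambda>\<omega>. \<bar>g \<omega> - Xs n \<omega>\<bar>) < top" for n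
      by (intro upos_finite sl_integrable_abs sl_integrable_diff g sl_integrable_H H)
    have a: "upos (\<lambda>\<omega>. \<bar>g \<omega> - Xs n \<omega>\<bar>) = ennreal (a n)" for n
      unfolding a_def using fin by (simp add: ennreal_enn2real)
    have "upos (\<lambda>\<omega>. \<bar>g \<omega> - Xs n \<omega>\<bar>) = upos (\<lambda>\<omega>. \<bar>h \<omega> - Xs n \<omega>\<bar>)" for n
      by (intro upos_cong_qs) (auto intro: qs_mono[OF gh])
    with lim have a0: "a \<longlonglongrightarrow> 0"
      unfolding a_def using LIMSEQ_enn2real_0_iff[OF fin] by simp
    define c where "c = enn2real (upos g)"
    have c: "upos g = ennreal c" "0 \<le> c"
      unfolding c_def using upos_finite[OF g] by (simp_all add: ennreal_enn2real)
    have a_nn: "0 \<le> a n" for n by (simp add: a_def)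
    \<comment> \<open>One \<open>a n\<close> compares the positive parts, the other bounds the
      negative part of \<open>Xs n\<close>.\<close>
    have "\<bar>expect (Xs n) - c\<bar> \<le> 2 * a n" for n
    proof -
      let ?p = "\<lambda>\<omega>. max (Xs n \<omega>) 0"
      have pH: "?p \<in> H" by (intro H_max H_const H)
      have p0: "0 \<le> expect ?p" by (rule expect_nonneg[OF pH]) simp
      have "upos g \<le> upos (Xs n) + upos (\<lambda>\<omega>. \<bar>g \<omega> - Xs n \<omega>\<bar>)"
        by (intro upos_add) auto
      then have 1: "c \<le> expect ?p + a n"
        using p0 a_nn c by (simp add: a upos_H H flip: ennreal_plus)
      have "upos (Xs n) \<le> upos g + upos (\<lambda>\<omega>. \<bar>g \<omega> - Xs n \<omega>\<bar>)"
        by (intro upos_add) auto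
      then have 2: "expect ?p \<le> c + a n"
        using p0 a_nn c by (simp add: a upos_H H flip: ennreal_plus)
      have 3: "expect (Xs n) \<le> expect ?p" by (intro expect_mono pH H) simp
      have "expect ?p - expect (Xs n) \<le> expect (\<lambda>\<omega>. ?p \<omega> - Xs n \<omega>)"
        by (intro expect_diff_le pH H)
      also have "(\<lambda>\<omega>. ?p \<omega> - Xs n \<omega>) = (\<lambda>\<omega>. max (- Xs n \<omega>) 0)" by (auto simp: max_def)
      finally have 4: "expect ?p - expect (Xs n) \<le> expect (\<lambda>\<omega>. max (- Xs n \<omega>) 0)" .
      have "upos (\<lambda>\<omega>. - Xs n \<omega>) \<le> upos (\<lambda>\<omega>. \<bar>g \<omega> - Xs n \<omega>\<bar>)"
        using nonneg by (intro upos_mono) force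
      then have 5: "expect (\<lambda>\<omega>. max (- Xs n \<omega>) 0) \<le> a n"
        using a_nn[of n] by (simp add: a upos_H H_uminus H ennreal_le_iff)
      show ?thesis using 1 2 3 4 5 by linarith
    qed
    then have "\<forall>\<^sub>F n in sequentially. norm (expect (Xs n) - c) \<le> 2 * a n" by simp
    moreover have "(\<lambda>n. 2 * a n) \<longlonglongrightarrow> 0" using tendsto_mult_left[OF a0, of 2] by simp
    ultimately have "(\<lambda>n. expect (Xs n) - c) \<longlonglongrightarrow> 0" by (rule Lim_null_comparison)
    then show "(\<lambda>n. expect (Xs n)) \<longlonglongrightarrow> c" by (simp add: LIM_zero_iff)
  qed
  obtain Ys where "represents Ys X" using ex_represents[OF g X] by blast
  then show "c = enn2real (upos g)"
    if "\<forall>Xs. represents Xs X \<longrightarrow> (\<lambda>n. expect (Xs n)) \<longlonglongrightarrow> c" for c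
    using that * LIMSEQ_unique by blast
qed

section \<open>Norm convergence and the extension of \<open>E k\<close> to the completion\<close>

lemma tendsto_L1_iff:
  assumes x: "sl_integrable x" and X: "qs (\<lambda>\<omega>. X \<omega> = ereal (x \<omega>))" and H: "\<And>n. Xs n \<in> H"
  shows "tendsto_L1 Xs X \<longleftrightarrow> (\<lambda>n. upos (\<lambda>\<omega>. \<bar>x \<omega> - Xs n \<omega>\<bar>)) \<longlonglongrightarrow> 0"
proof -
  have int: "sl_integrable (\<lambda>\<omega>. \<bar>x \<omega> - Xs n \<omega>\<bar>)" for n
    by (intro sl_integrable_abs sl_integrable_diff x sl_integrable_H H)
  have "norm_L1 (\<lambda>\<omega>. ereal (Xs n \<omega>) - X \<omega>) = enn2real (upos (\<lambda>\<omega>. \<bar>x \<omega> - Xs n \<omega>\<bar>))" for n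
    unfolding norm_L1_def
    by (rule expect_L1_eq[OF int]) (auto intro!: qs_mono[OF X] simp: abs_minus_commute)
  then show ?thesis
    unfolding tendsto_L1_def using LIMSEQ_enn2real_0_iff[OF upos_finite[OF int]] by simp
qed

lemma cond_L1_infinity: "cond_L1 \<infinity> X = X"
  by (simp add: cond_L1_def)

text \<open>The choice in \<open>cond_L1\<close> has to be shown possible: by contraction the images
  \<open>E k (Y n)\<close> of one approximating sequence converge, and the images of any other
  sequence with the same limit stay close to them.\<close>

lemma cond_L1_enat:
  assumes "X \<in> L1"
  shows "cond_L1 (enat k) X \<in> L1"
    and "(\<And>n. Xs n \<in> H) \<Longrightarrow> tendsto_L1 Xs X \<Longrightarrow> tendsto_L1 (\<lambda>n. E k (Xs n)) (cond_L1 (enat k) X)"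
proof -
  define x where "x \<omega> = real_of_ereal (X \<omega>)" for \<omega>
  have x: "sl_integrable x" and X: "qs (\<lambda>\<omega>. X \<omega> = ereal (x \<omega>))"
    using assms by (auto simp: L1_iff x_def[abs_def])
  note [measurable] = sl_integrable_borel[OF x]
  obtain Y where Y: "\<And>n. Y n \<in> H" and Ylim: "(\<lambda>n. upos (\<lambda>\<omega>. \<bar>x \<omega> - Y n \<omega>\<bar>)) \<longlonglongrightarrow> 0"
    using sl_integrable_approx[OF x] by blast
  have Cauchy: "\<exists>N. \<forall>m\<ge>N. \<forall>n\<ge>N. upos (\<lambda>\<omega>. \<bar>E k (Y m) \<omega> - E k (Y n) \<omega>\<bar>) \<le> ennreal e" if "0 < e" for e
    using upos_tendsto_0_imp_Cauchy[OF Y that _ Ylim] order_trans[OF upos_E_abs_diff[OF Y Y]]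
    by (meson sl_integrable_borel[OF x])
  obtain g r where "strict_mono r" and g: "sl_integrable g"
    and glim: "(\<lambda>n. upos (\<lambda>\<omega>. \<bar>g \<omega> - E k (Y n) \<omega>\<bar>)) \<longlonglongrightarrow> 0"
    and "qs (\<lambda>\<omega>. (\<lambda>n. E k (Y (r n)) \<omega>) \<longlonglongrightarrow> g \<omega>)"
    by (rule Cauchy_imp_qs_limit[of "\<lambda>n. E k (Y n)", OF E_H[OF Y] Cauchy])
  have gm[measurable]: "g \<in> borel_measurable M" by (rule sl_integrable_borel[OF g])
  have "tendsto_L1 (\<lambda>n. E k (Xs n)) (\<lambda>\<omega>. ereal (g \<omega>))"
    if H: "\<And>n. Xs n \<in> H" and "tendsto_L1 Xs X" for Xs
  proof -
    note [measurable] = H_borel[OF H] H_borel[OF Y] H_borel[OF E_H[OF H]] H_borel[OF E_H[OF Y]]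
    have Xlim: "(\<lambda>n. upos (\<lambda>\<omega>. \<bar>x \<omega> - Xs n \<omega>\<bar>)) \<longlonglongrightarrow> 0"
      using that by (simp add: tendsto_L1_iff[OF x X])
    have "upos (\<lambda>\<omega>. \<bar>g \<omega> - E k (Xs n) \<omega>\<bar>)
        \<le> upos (\<lambda>\<omega>. \<bar>g \<omega> - E k (Y n) \<omega>\<bar>) + (upos (\<lambda>\<omega>. \<bar>x \<omega> - Y n \<omega>\<bar>) + upos (\<lambda>\<omega>. \<bar>x \<omega> - Xs n \<omega>\<bar>))" for n
    proof -
      have "upos (\<lambda>\<omega>. \<bar>g \<omega> - E k (Xs n) \<omega>\<bar>)
          \<le> upos (\<lambda>\<omega>. \<bar>g \<omega> - E k (Y n) \<omega>\<bar>) + upos (\<lambda>\<omega>. \<bar>E k (Y n) \<omega> - E k (Xs n) \<omega>\<bar>)"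
        by (intro upos_add) auto
      also have "upos (\<lambda>\<omega>. \<bar>E k (Y n) \<omega> - E k (Xs n) \<omega>\<bar>) \<le> upos (\<lambda>\<omega>. \<bar>Y n \<omega> - Xs n \<omega>\<bar>)"
        by (intro upos_E_abs_diff Y H)
      also have "\<dots> \<le> upos (\<lambda>\<omega>. \<bar>x \<omega> - Y n \<omega>\<bar>) + upos (\<lambda>\<omega>. \<bar>x \<omega> - Xs n \<omega>\<bar>)"
        by (intro upos_add) auto
      finally show ?thesis by (simp add: add_left_mono)
    qed
    then have "(\<lambda>n. upos (\<lambda>\<omega>. \<bar>g \<omega> - E k (Xs n) \<omega>\<bar>)) \<longlonglongrightarrow> 0"
      by (rule ennreal_tendsto_0_le[OF ennreal_tendsto_0_add[OF glim ennreal_tendsto_0_add[OF Ylim Xlim]]])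
    then show ?thesis
      using g H by (subst tendsto_L1_iff[of g]) (auto intro: qs_space E_H)
  qed
  moreover have "(\<lambda>\<omega>. ereal (g \<omega>)) \<in> L1"
    using g gm by (auto simp: L1_iff intro: qs_space)
  ultimately have "\<exists>C. C \<in> L1 \<and>
      (\<forall>Xs. (\<forall>n. Xs n \<in> H) \<and> tendsto_L1 Xs X \<longrightarrow> tendsto_L1 (\<lambda>n. E k (Xs n)) C)"
    by blast
  from someI_ex[OF this]
  show "cond_L1 (enat k) X \<in> L1"
    and "(\<And>n. Xs n \<in> H) \<Longrightarrow> tendsto_L1 Xs X \<Longrightarrow> tendsto_L1 (\<lambda>n. E k (Xs n)) (cond_L1 (enat k) X)"
    by (auto simp: cond_L1_def)
qed

lemma expect_L1_tail:
  assumes "X \<in> L1"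
  defines "x \<equiv> \<lambda>\<omega>. real_of_ereal (X \<omega>)"
  shows "expect_L1 (\<lambda>\<omega>. indicator {\<omega> \<in> space M. ereal c \<le> \<bar>X \<omega>\<bar>} \<omega> * \<bar>X \<omega>\<bar>)
      = enn2real (upos (\<lambda>\<omega>. indicator {\<omega> \<in> space M. c \<le> \<bar>x \<omega>\<bar>} \<omega> * \<bar>x \<omega>\<bar>))"
    and "upos (\<lambda>\<omega>. indicator {\<omega> \<in> space M. c \<le> \<bar>x \<omega>\<bar>} \<omega> * \<bar>x \<omega>\<bar>) < top"
proof -
  have x: "sl_integrable x" and X: "qs (\<lambda>\<omega>. X \<omega> = ereal (x \<omega>))"
    using assms by (auto simp: L1_iff)
  note [measurable] = sl_integrable_borel[OF x]
  have int: "sl_integrable (\<lambda>\<omega>. indicator {\<omega> \<in> space M. c \<le> \<bar>x \<omega>\<bar>} \<omega> * \<bar>x \<omega>\<bar>)"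
    by (intro sl_integrable_indicator sl_integrable_abs x) simp
  show "upos (\<lambda>\<omega>. indicator {\<omega> \<in> space M. c \<le> \<bar>x \<omega>\<bar>} \<omega> * \<bar>x \<omega>\<bar>) < top"
    by (rule upos_finite[OF int])
  show "expect_L1 (\<lambda>\<omega>. indicator {\<omega> \<in> space M. ereal c \<le> \<bar>X \<omega>\<bar>} \<omega> * \<bar>X \<omega>\<bar>)
      = enn2real (upos (\<lambda>\<omega>. indicator {\<omega> \<in> space M. c \<le> \<bar>x \<omega>\<bar>} \<omega> * \<bar>x \<omega>\<bar>))"
    by (rule expect_L1_eq[OF int]) (auto intro!: qs_mono[OF X] simp: indicator_def)
qed

text \<open>The two tails control each other: for \<open>c >= 0\<close>, \<open>(|x| - c)^+\<close>
  is at most \<open>|x|\<close> on \<open>|x| >= c\<close> and 0 elsewhere, while on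
  \<open>|x| >= 2 * c\<close> one has \<open>|x| <= 2 * (|x| - c)^+\<close>. The subtracted form
  depends continuously on \<open>x\<close>.\<close>

lemma uniformly_integrable_iff:
  "uniformly_integrable K \<longleftrightarrow> K \<subseteq> L1 \<and>
    (\<forall>e>0. \<exists>c\<ge>0. \<forall>X\<in>K. upos (\<lambda>\<omega>. \<bar>real_of_ereal (X \<omega>)\<bar> - c) \<le> ennreal e)"
  unfolding uniformly_integrable_def
proof (intro conj_cong refl iffI allI impI)
  assume K: "K \<subseteq> L1"
  let ?f = "\<lambda>c X. expect_L1 (\<lambda>\<omega>. indicator {\<omega> \<in> space M. ereal c \<le> \<bar>X \<omega>\<bar>} \<omega> * \<bar>X \<omega>\<bar>)"
  let ?u = "\<lambda>c X. upos (\<lambda>\<omega>. indicator {\<omega> \<in> space M. c \<le> \<bar>real_of_ereal (X \<omega>)\<bar>} \<omega> * \<bar>real_of_ereal (X \<omega>)\<bar>)"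
  have f: "ennreal (?f c X) = ?u c X" "0 \<le> ?f c X" if "X \<in> K" for X c
    using expect_L1_tail[of X c] that K by (auto simp: ennreal_enn2real)
  show "\<exists>c\<ge>0. \<forall>X\<in>K. upos (\<lambda>\<omega>. \<bar>real_of_ereal (X \<omega>)\<bar> - c) \<le> ennreal e"
    if "uniform_limit K ?f (\<lambda>_. 0) at_top" "0 < e" for e :: real
  proof -
    have "\<forall>\<^sub>F c in at_top. \<forall>X\<in>K. dist (?f c X) 0 < e"
      using that by (auto simp: uniform_limit_iff)
    then obtain c0 where c0: "\<And>c. c0 \<le> c \<Longrightarrow> \<forall>X\<in>K. dist (?f c X) 0 < e"
      by (auto simp: eventually_at_top_linorder)
    \<comment> \<open>The level has to be nonnegative, otherwise subtracting it could increase
      \<open>|x|\<close>.\<close>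
    define c where "c = max c0 0"
    have "upos (\<lambda>\<omega>. \<bar>real_of_ereal (X \<omega>)\<bar> - c) \<le> ennreal e" if X: "X \<in> K" for X
    proof -
      have "upos (\<lambda>\<omega>. \<bar>real_of_ereal (X \<omega>)\<bar> - c) \<le> ?u c X"
        unfolding c_def by (intro upper_mono) (auto simp: indicator_def ennreal_neg intro!: ennreal_leI)
      also have "\<dots> = ennreal (?f c X)" using f X by simp
      also have "\<dots> \<le> ennreal e"
        using c0[of c] X by (intro ennreal_leI) (auto simp: c_def)
      finally show ?thesis .
    qed
    then show ?thesis by (intro exI[of _ c]) (auto simp: c_def)
  qed
  show "uniform_limit K ?f (\<lambda>_. 0) at_top"
    if *: "\<forall>e>0. \<exists>c\<ge>0. \<forall>X\<in>K. upos (\<lambda>\<omega>. \<bar>real_of_ereal (X \<omega>)\<bar> - c) \<le> ennreal e"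
    unfolding uniform_limit_iff eventually_at_top_linorder
  proof (intro allI impI)
    fix e :: real assume "0 < e"
    \<comment> \<open>The factor 2 from doubling the level still leaves
      \<open>2 * (e / 3) < e\<close>.\<close>
    then obtain c where "0 \<le> c" and c: "\<And>X. X \<in> K \<Longrightarrow> upos (\<lambda>\<omega>. \<bar>real_of_ereal (X \<omega>)\<bar> - c) \<le> ennreal (e/3)"
      using *[rule_format, of "e/3"] by auto
    have "dist (?f d X) 0 < e" if "2 * c \<le> d" and X: "X \<in> K" for d X
    proof -
      have [measurable]: "(\<lambda>\<omega>. real_of_ereal (X \<omega>)) \<in> borel_measurable M"
        using K X by (intro sl_integrable_borel) (auto simp: L1_iff)
      have "?u d X \<le> upos (\<lambda>\<omega>. 2 * max (\<bar>real_of_ereal (X \<omega>)\<bar> - c) 0)"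
        using that \<open>0 \<le> c\<close> by (intro upos_mono) (auto simp: indicator_def)
      also have "\<dots> = ennreal 2 * upos (\<lambda>\<omega>. max (\<bar>real_of_ereal (X \<omega>)\<bar> - c) 0)"
        by (rule upos_cmult[OF _ zero_le_numeral]) measurable
      also have "upos (\<lambda>\<omega>. max (\<bar>real_of_ereal (X \<omega>)\<bar> - c) 0) = upos (\<lambda>\<omega>. \<bar>real_of_ereal (X \<omega>)\<bar> - c)"
        by (intro upper_cong) (auto simp: max_def ennreal_neg)
      also have "ennreal 2 * \<dots> \<le> ennreal 2 * ennreal (e/3)"
        by (intro mult_left_mono c X) auto
      also have "\<dots> = ennreal (2 * (e/3))" using \<open>0 < e\<close> by (intro ennreal_mult[symmetric]) auto
      finally have "ennreal (?f d X) \<le> ennreal (2 * (e/3))" using f X by simp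
      then have "?f d X \<le> 2 * (e/3)" using \<open>0 < e\<close> by (simp add: ennreal_le_iff)
      then show ?thesis using f[OF X] \<open>0 < e\<close> by simp
    qed
    then show "\<exists>N. \<forall>n\<ge>N. \<forall>X\<in>K. dist (?f n X) 0 < e" by blast
  qed
qed

end

section \<open>Conditional domination\<close>

context sl_expectation
begin

text \<open>
  \<open>f \<le> \<E>\<^sub>t g\<close> for the extension of \<open>\<E>\<^sub>t\<close> to \<open>L\<^sup>1\<close>, without choosing a version of \<open>\<E>\<^sub>t g\<close>.
\<close>

definition below_E :: "nat \<Rightarrow> ('a \<Rightarrow> real) \<Rightarrow> ('a \<Rightarrow> real) \<Rightarrow> bool" where
  "below_E t f g \<longleftrightarrow> (\<exists>Y. (\<forall>n. Y n \<in> H) \<and> (\<lambda>n. upos (\<lambda>\<omega>. \<bar>g \<omega> - Y n \<omega>\<bar>)) \<longlonglongrightarrow> 0 \<and>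
    (\<lambda>n. upos (\<lambda>\<omega>. f \<omega> - E t (Y n) \<omega>)) \<longlonglongrightarrow> 0)"

lemma upos_max_0: "upos (\<lambda>\<omega>. max (f \<omega>) 0) = upos f"
  by (intro upper_cong) (auto simp: max_def ennreal_neg)

lemma borel_measurable_F_mono: "f \<in> borel_measurable (F s) \<Longrightarrow> s \<le> t \<Longrightarrow> f \<in> borel_measurable (F t)"
  by (rule borel_measurable_subalgebra[OF sets_F_mono]) (simp_all add: space_F)

text \<open>Any norm approximation of \<open>Z\<close> serves as witness, since its images under
  \<open>E s\<close> converge to the chosen version, which dominates \<open>X\<close>
  quasi-surely.\<close>

lemma cond_L1_le_imp_below_E:
  assumes X: "X \<in> L1" and Z: "Z \<in> L1" and le: "qs (\<lambda>\<omega>. X \<omega> \<le> cond_L1 (enat s) Z \<omega>)"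
  shows "below_E s (\<lambda>\<omega>. real_of_ereal (X \<omega>)) (\<lambda>\<omega>. real_of_ereal (Z \<omega>))"
proof -
  define x where "x \<omega> = real_of_ereal (X \<omega>)" for \<omega>
  define z where "z \<omega> = real_of_ereal (Z \<omega>)" for \<omega>
  define c where "c \<omega> = real_of_ereal (cond_L1 (enat s) Z \<omega>)" for \<omega>
  have x: "sl_integrable x" "qs (\<lambda>\<omega>. X \<omega> = ereal (x \<omega>))"
    using X by (auto simp: L1_iff x_def[abs_def])
  have z: "sl_integrable z" "qs (\<lambda>\<omega>. Z \<omega> = ereal (z \<omega>))"
    using Z by (auto simp: L1_iff z_def[abs_def])
  have c: "sl_integrable c" "qs (\<lambda>\<omega>. cond_L1 (enat s) Z \<omega> = ereal (c \<omega>))"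
    using cond_L1_enat(1)[OF Z] by (auto simp: L1_iff c_def[abs_def])
  obtain Y where Y: "\<And>n. Y n \<in> H" and lim: "(\<lambda>n. upos (\<lambda>\<omega>. \<bar>z \<omega> - Y n \<omega>\<bar>)) \<longlonglongrightarrow> 0"
    using sl_integrable_approx[OF z(1)] by blast
  note [measurable] = sl_integrable_borel[OF x(1)] sl_integrable_borel[OF z(1)]
    sl_integrable_borel[OF c(1)] H_borel[OF E_H[OF Y]]
  have "tendsto_L1 Y Z" using lim by (simp add: tendsto_L1_iff[OF z Y])
  from cond_L1_enat(2)[OF Z Y this] have "tendsto_L1 (\<lambda>n. E s (Y n)) (cond_L1 (enat s) Z)" .
  then have Elim: "(\<lambda>n. upos (\<lambda>\<omega>. \<bar>c \<omega> - E s (Y n) \<omega>\<bar>)) \<longlonglongrightarrow> 0"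
    by (simp add: tendsto_L1_iff[OF c E_H[OF Y]])
  have xc: "qs (\<lambda>\<omega>. x \<omega> \<le> c \<omega>)"
    by (rule qs_mono[OF qs_conj[OF le qs_conj[OF x(2) c(2)]]]) (metis ereal_less_eq(3))
  have "upos (\<lambda>\<omega>. x \<omega> - E s (Y n) \<omega>) \<le> upos (\<lambda>\<omega>. \<bar>c \<omega> - E s (Y n) \<omega>\<bar>)" for n
    by (intro upper_mono_qs) (auto intro!: qs_mono[OF xc] ennreal_leI)
  then have "(\<lambda>n. upos (\<lambda>\<omega>. x \<omega> - E s (Y n) \<omega>)) \<longlonglongrightarrow> 0"
    by (rule ennreal_tendsto_0_le[OF Elim])
  then show ?thesis
    using Y lim unfolding below_E_def x_def z_def by blast
qed

text \<open>Along the witness the excess of \<open>x\<close> over the chosen version is bounded by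
  two vanishing errors; its upper integral does not depend on \<open>n\<close> and is therefore
  0.\<close>

lemma below_E_imp_cond_L1_le:
  assumes X: "X \<in> L1" and Z: "Z \<in> L1"
    and below: "below_E s (\<lambda>\<omega>. real_of_ereal (X \<omega>)) (\<lambda>\<omega>. real_of_ereal (Z \<omega>))"
  shows "qs (\<lambda>\<omega>. X \<omega> \<le> cond_L1 (enat s) Z \<omega>)"
proof -
  define x where "x \<omega> = real_of_ereal (X \<omega>)" for \<omega>
  define z where "z \<omega> = real_of_ereal (Z \<omega>)" for \<omega>
  define c where "c \<omega> = real_of_ereal (cond_L1 (enat s) Z \<omega>)" for \<omega>
  have x: "sl_integrable x" "qs (\<lambda>\<omega>. X \<omega> = ereal (x \<omega>))"
    using X by (auto simp: L1_iff x_def[abs_def])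
  have z: "sl_integrable z" "qs (\<lambda>\<omega>. Z \<omega> = ereal (z \<omega>))"
    using Z by (auto simp: L1_iff z_def[abs_def])
  have c: "sl_integrable c" "qs (\<lambda>\<omega>. cond_L1 (enat s) Z \<omega> = ereal (c \<omega>))"
    using cond_L1_enat(1)[OF Z] by (auto simp: L1_iff c_def[abs_def])
  obtain Y where Y: "\<And>n. Y n \<in> H" and lim: "(\<lambda>n. upos (\<lambda>\<omega>. \<bar>z \<omega> - Y n \<omega>\<bar>)) \<longlonglongrightarrow> 0"
    and xlim: "(\<lambda>n. upos (\<lambda>\<omega>. x \<omega> - E s (Y n) \<omega>)) \<longlonglongrightarrow> 0"
    using below unfolding below_E_def x_def z_def by blast
  note [measurable] = sl_integrable_borel[OF x(1)] sl_integrable_borel[OF c(1)] H_borel[OF E_H[OF Y]]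
  have "tendsto_L1 Y Z" using lim by (simp add: tendsto_L1_iff[OF z Y])
  from cond_L1_enat(2)[OF Z Y this] have "tendsto_L1 (\<lambda>n. E s (Y n)) (cond_L1 (enat s) Z)" .
  then have Elim: "(\<lambda>n. upos (\<lambda>\<omega>. \<bar>c \<omega> - E s (Y n) \<omega>\<bar>)) \<longlonglongrightarrow> 0"
    by (simp add: tendsto_L1_iff[OF c E_H[OF Y]])
  have "upos (\<lambda>\<omega>. x \<omega> - c \<omega>) \<le> upos (\<lambda>\<omega>. x \<omega> - E s (Y n) \<omega>) + upos (\<lambda>\<omega>. \<bar>c \<omega> - E s (Y n) \<omega>\<bar>)" for n
    by (intro upos_add) auto
  then have "(\<lambda>n::nat. upos (\<lambda>\<omega>. x \<omega> - c \<omega>)) \<longlonglongrightarrow> 0"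
    by (rule ennreal_tendsto_0_le[OF ennreal_tendsto_0_add[OF xlim Elim]])
  then have "upos (\<lambda>\<omega>. x \<omega> - c \<omega>) = 0" by (simp add: LIMSEQ_const_iff)
  then have "qs (\<lambda>\<omega>. x \<omega> - c \<omega> \<le> 0)" by (intro upos_eq_0_imp_qs) auto
  from qs_conj[OF this qs_conj[OF x(2) c(2)]] show ?thesis
    by (rule qs_mono) auto
qed

text \<open>One witness close to each \<open>g n\<close> gives a diagonal sequence that approximates
  \<open>h\<close>. The fixed \<open>f\<close> will be the value at time \<open>s\<close>, and
  \<open>g n\<close> the later values tending to the limit.\<close>

lemma below_E_limit:
  assumes below: "\<And>n. below_E s f (g n)" and gm: "\<And>n. g n \<in> borel_measurable M" "h \<in> borel_measurable M"
    and lim: "(\<lambda>n. upos (\<lambda>\<omega>. \<bar>h \<omega> - g n \<omega>\<bar>)) \<longlonglongrightarrow> 0"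
  shows "below_E s f h"
proof -
  note [measurable] = gm
  have "\<exists>Y\<in>H. upos (\<lambda>\<omega>. \<bar>g n \<omega> - Y \<omega>\<bar>) \<le> ennreal (1 / real (Suc n)) \<and>
      upos (\<lambda>\<omega>. f \<omega> - E s Y \<omega>) \<le> ennreal (1 / real (Suc n))" for n
  proof -
    obtain Y where Y: "\<And>m. Y m \<in> H" and l: "(\<lambda>m. upos (\<lambda>\<omega>. \<bar>g n \<omega> - Y m \<omega>\<bar>)) \<longlonglongrightarrow> 0"
      "(\<lambda>m. upos (\<lambda>\<omega>. f \<omega> - E s (Y m) \<omega>)) \<longlonglongrightarrow> 0"
      using below[of n] unfolding below_E_def by blast
    have "0 < 1 / real (Suc n)" by simp
    with l have "\<forall>\<^sub>F m in sequentially. upos (\<lambda>\<omega>. \<bar>g n \<omega> - Y m \<omega>\<bar>) \<le> ennreal (1 / real (Suc n)) \<and>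
        upos (\<lambda>\<omega>. f \<omega> - E s (Y m) \<omega>) \<le> ennreal (1 / real (Suc n))"
      unfolding ennreal_tendsto_0_iff by (intro eventually_conj) blast+
    then show ?thesis using Y unfolding eventually_sequentially by blast
  qed
  then obtain Y where Y: "\<And>n. Y n \<in> H"
    and g: "\<And>n. upos (\<lambda>\<omega>. \<bar>g n \<omega> - Y n \<omega>\<bar>) \<le> ennreal (1 / real (Suc n))"
    and f: "\<And>n. upos (\<lambda>\<omega>. f \<omega> - E s (Y n) \<omega>) \<le> ennreal (1 / real (Suc n))"
    by metis
  note [measurable] = H_borel[OF Y]
  have null: "(\<lambda>n. ennreal (1 / real (Suc n))) \<longlonglongrightarrow> 0"
    using tendsto_ennrealI[OF LIMSEQ_Suc[OF lim_1_over_n]] by simp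
  have "upos (\<lambda>\<omega>. \<bar>h \<omega> - Y n \<omega>\<bar>) \<le> upos (\<lambda>\<omega>. \<bar>h \<omega> - g n \<omega>\<bar>) + ennreal (1 / real (Suc n))" for n
  proof -
    have "upos (\<lambda>\<omega>. \<bar>h \<omega> - Y n \<omega>\<bar>) \<le> upos (\<lambda>\<omega>. \<bar>h \<omega> - g n \<omega>\<bar>) + upos (\<lambda>\<omega>. \<bar>g n \<omega> - Y n \<omega>\<bar>)"
      by (intro upos_add) auto
    also note add_left_mono[OF g]
    finally show ?thesis .
  qed
  then have "(\<lambda>n. upos (\<lambda>\<omega>. \<bar>h \<omega> - Y n \<omega>\<bar>)) \<longlonglongrightarrow> 0"
    by (rule ennreal_tendsto_0_le[OF ennreal_tendsto_0_add[OF lim null]])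
  moreover have "(\<lambda>n. upos (\<lambda>\<omega>. f \<omega> - E s (Y n) \<omega>)) \<longlonglongrightarrow> 0"
    by (rule ennreal_tendsto_0_le[OF null f])
  ultimately show ?thesis using Y unfolding below_E_def by blast
qed

text \<open>In short \<open>f <= E k g <= E k (E i h) = E k h\<close>, the middle step by the
  one-sided contraction, the last by the tower property.\<close>

lemma below_E_trans:
  assumes "below_E k f g" "below_E i g h" "k \<le> i"
    and [measurable]: "f \<in> borel_measurable M" "g \<in> borel_measurable M"
  shows "below_E k f h"
proof -
  obtain Y where Y: "\<And>n. Y n \<in> H" and Yg: "(\<lambda>n. upos (\<lambda>\<omega>. \<bar>g \<omega> - Y n \<omega>\<bar>)) \<longlonglongrightarrow> 0"
    and Yf: "(\<lambda>n. upos (\<lambda>\<omega>. f \<omega> - E k (Y n) \<omega>)) \<longlonglongrightarrow> 0"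
    using assms(1) unfolding below_E_def by blast
  obtain Z where Z: "\<And>n. Z n \<in> H" and Zh: "(\<lambda>n. upos (\<lambda>\<omega>. \<bar>h \<omega> - Z n \<omega>\<bar>)) \<longlonglongrightarrow> 0"
    and Zg: "(\<lambda>n. upos (\<lambda>\<omega>. g \<omega> - E i (Z n) \<omega>)) \<longlonglongrightarrow> 0"
    using assms(2) unfolding below_E_def by blast
  note [measurable] = H_borel[OF Y] H_borel[OF Z] H_borel[OF E_H[OF Y]] H_borel[OF E_H[OF Z]]
    H_borel[OF E_H[OF E_H[OF Z]]]
  have "upos (\<lambda>\<omega>. f \<omega> - E k (Z n) \<omega>)
      \<le> upos (\<lambda>\<omega>. f \<omega> - E k (Y n) \<omega>) + (upos (\<lambda>\<omega>. \<bar>g \<omega> - Y n \<omega>\<bar>) + upos (\<lambda>\<omega>. g \<omega> - E i (Z n) \<omega>))" for n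
  proof -
    have "upos (\<lambda>\<omega>. f \<omega> - E k (Z n) \<omega>)
        \<le> upos (\<lambda>\<omega>. f \<omega> - E k (Y n) \<omega>) + upos (\<lambda>\<omega>. E k (Y n) \<omega> - E k (E i (Z n)) \<omega>)"
      using E_tower[OF Z \<open>k \<le> i\<close>] by (intro upos_add) auto
    also have "upos (\<lambda>\<omega>. E k (Y n) \<omega> - E k (E i (Z n)) \<omega>) \<le> upos (\<lambda>\<omega>. Y n \<omega> - E i (Z n) \<omega>)"
      by (intro upos_E_diff Y E_H Z)
    also have "\<dots> \<le> upos (\<lambda>\<omega>. \<bar>g \<omega> - Y n \<omega>\<bar>) + upos (\<lambda>\<omega>. g \<omega> - E i (Z n) \<omega>)"
      by (intro upos_add) auto
    finally show ?thesis by (simp add: add_left_mono)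
  qed
  then have "(\<lambda>n. upos (\<lambda>\<omega>. f \<omega> - E k (Z n) \<omega>)) \<longlonglongrightarrow> 0"
    by (rule ennreal_tendsto_0_le[OF ennreal_tendsto_0_add[OF Yf ennreal_tendsto_0_add[OF Yg Zg]]])
  then show ?thesis using Z Zh unfolding below_E_def by blast
qed

text \<open>Jensen's inequality for a nondecreasing convex function: \<open>E t\<close> of
  \<open>(Y - a)^+\<close> dominates both 0 and \<open>E t Y - a\<close>.\<close>

lemma below_E_pos_part:
  assumes "below_E t f g" and [measurable]: "f \<in> borel_measurable M" "g \<in> borel_measurable M"
  shows "below_E t (\<lambda>\<omega>. max (f \<omega> - a) 0) (\<lambda>\<omega>. max (g \<omega> - a) 0)"
proof -
  obtain Y where Y: "\<And>n. Y n \<in> H" and Yg: "(\<lambda>n. upos (\<lambda>\<omega>. \<bar>g \<omega> - Y n \<omega>\<bar>)) \<longlonglongrightarrow> 0"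
    and Yf: "(\<lambda>n. upos (\<lambda>\<omega>. f \<omega> - E t (Y n) \<omega>)) \<longlonglongrightarrow> 0"
    using assms(1) unfolding below_E_def by blast
  let ?Z = "\<lambda>n \<omega>. max (Y n \<omega> - a) 0"
  have Z: "?Z n \<in> H" for n by (intro H_max H_diff H_const Y)
  have E: "max (E t (Y n) \<omega> - a) 0 \<le> E t (?Z n) \<omega>" if \<omega>: "\<omega> \<in> space M" for n \<omega>
  proof -
    have "E t (\<lambda>_. 0) \<omega> \<le> E t (?Z n) \<omega>" by (intro E_mono Z H_const \<omega>) auto
    moreover have "E t (Y n) \<omega> - E t (\<lambda>_. a) \<omega> \<le> E t (\<lambda>\<omega>. Y n \<omega> - a) \<omega>"
      by (intro E_diff_le Y H_const \<omega>)
    moreover have "E t (\<lambda>\<omega>. Y n \<omega> - a) \<omega> \<le> E t (?Z n) \<omega>"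
      by (intro E_mono Z H_diff Y H_const \<omega>) auto
    ultimately show ?thesis using \<omega> by (simp add: E_const)
  qed
  have "upos (\<lambda>\<omega>. \<bar>max (g \<omega> - a) 0 - ?Z n \<omega>\<bar>) \<le> upos (\<lambda>\<omega>. \<bar>g \<omega> - Y n \<omega>\<bar>)" for n
    by (intro upos_mono) auto
  then have 1: "(\<lambda>n. upos (\<lambda>\<omega>. \<bar>max (g \<omega> - a) 0 - ?Z n \<omega>\<bar>)) \<longlonglongrightarrow> 0"
    by (rule ennreal_tendsto_0_le[OF Yg])
  have "upos (\<lambda>\<omega>. max (f \<omega> - a) 0 - E t (?Z n) \<omega>) \<le> upos (\<lambda>\<omega>. f \<omega> - E t (Y n) \<omega>)" for n
  proof -
    have "upos (\<lambda>\<omega>. max (f \<omega> - a) 0 - E t (?Z n) \<omega>) \<le> upos (\<lambda>\<omega>. max (f \<omega> - E t (Y n) \<omega>) 0)"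
      using E by (intro upos_mono) (fastforce simp: max_def split: if_splits)
    then show ?thesis by (simp add: upos_max_0)
  qed
  then have 2: "(\<lambda>n. upos (\<lambda>\<omega>. max (f \<omega> - a) 0 - E t (?Z n) \<omega>)) \<longlonglongrightarrow> 0"
    by (rule ennreal_tendsto_0_le[OF Yf])
  show ?thesis
    unfolding below_E_def using Z 1 2 by (intro exI[of _ ?Z]) blast
qed

text \<open>One trading step: \<open>w\<close> is the gain so far and \<open>A\<close> the event on
  which one unit is held while its price moves from \<open>y\<close> to \<open>y'\<close>. With
  approximations of \<open>w\<close> and \<open>y\<close> that are themselves
  \<open>F t\<close>-measurable, \<open>E t\<close> is evaluated exactly, and only
  \<open>y <= E t y'\<close> on \<open>A\<close> remains.\<close>

lemma below_E_stake:
  assumes w: "sl_integrable w" "w \<in> borel_measurable (F t)"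
    and y: "sl_integrable y" "y \<in> borel_measurable (F t)"
    and y': "y' \<in> borel_measurable M" and below: "below_E t y y'" and A: "A \<in> sets (F t)"
  shows "below_E t w (\<lambda>\<omega>. w \<omega> + indicator A \<omega> * (y' \<omega> - y \<omega>))"
proof -
  obtain W where W: "\<And>n. W n \<in> H" "\<And>n. W n \<in> borel_measurable (F t)"
    and Wlim: "(\<lambda>n. upos (\<lambda>\<omega>. \<bar>w \<omega> - W n \<omega>\<bar>)) \<longlonglongrightarrow> 0"
    using sl_integrable_approx[OF w(1)] w(2) by blast
  obtain V where V: "\<And>n. V n \<in> H" "\<And>n. V n \<in> borel_measurable (F t)"
    and Vlim: "(\<lambda>n. upos (\<lambda>\<omega>. \<bar>y \<omega> - V n \<omega>\<bar>)) \<longlonglongrightarrow> 0"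
    using sl_integrable_approx[OF y(1)] y(2) by blast
  obtain Y where Y: "\<And>n. Y n \<in> H" and Ylim: "(\<lambda>n. upos (\<lambda>\<omega>. \<bar>y' \<omega> - Y n \<omega>\<bar>)) \<longlonglongrightarrow> 0"
    and Yy: "(\<lambda>n. upos (\<lambda>\<omega>. y \<omega> - E t (Y n) \<omega>)) \<longlonglongrightarrow> 0"
    using below unfolding below_E_def by blast
  note [measurable] = sl_integrable_borel[OF w(1)] sl_integrable_borel[OF y(1)] y'
    H_borel[OF W(1)] H_borel[OF V(1)] H_borel[OF Y] H_borel[OF E_H[OF Y]]
  have AM: "A \<in> sets M" using A sets_F_subset by auto
  let ?X = "\<lambda>n \<omega>. W n \<omega> - indicator A \<omega> * V n \<omega>"
  let ?Z = "\<lambda>n \<omega>. ?X n \<omega> + indicator A \<omega> * Y n \<omega>"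
  have XH: "?X n \<in> H" for n by (intro H_diff H_indicator W V AM)
  have Z: "?Z n \<in> H" for n by (intro H_add XH H_indicator Y AM)
  have EZ: "E t (?Z n) \<omega> = ?X n \<omega> + indicator A \<omega> * E t (Y n) \<omega>" if "\<omega> \<in> space M" for n \<omega>
  proof -
    have "?X n \<in> borel_measurable (F t)" using W(2)[of n] V(2)[of n] A by measurable
    then have "E t (?Z n) \<omega> = ?X n \<omega> + E t (\<lambda>\<omega>. indicator A \<omega> * Y n \<omega>) \<omega>"
      using that by (intro E_add_adapted XH H_indicator Y AM)
    then show ?thesis using that by (simp add: E_indicator Y A)
  qed
  have "upos (\<lambda>\<omega>. \<bar>w \<omega> + indicator A \<omega> * (y' \<omega> - y \<omega>) - ?Z n \<omega>\<bar>)
      \<le> upos (\<lambda>\<omega>. \<bar>w \<omega> - W n \<omega>\<bar>) + (upos (\<lambda>\<omega>. \<bar>y \<omega> - V n \<omega>\<bar>) + upos (\<lambda>\<omega>. \<bar>y' \<omega> - Y n \<omega>\<bar>))" for n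
  proof -
    have "upos (\<lambda>\<omega>. \<bar>w \<omega> + indicator A \<omega> * (y' \<omega> - y \<omega>) - ?Z n \<omega>\<bar>)
        \<le> upos (\<lambda>\<omega>. \<bar>w \<omega> - W n \<omega>\<bar>) + upos (\<lambda>\<omega>. \<bar>y \<omega> - V n \<omega>\<bar> + \<bar>y' \<omega> - Y n \<omega>\<bar>)"
      by (intro upos_add) (auto simp: indicator_def)
    also have "\<dots> \<le> upos (\<lambda>\<omega>. \<bar>w \<omega> - W n \<omega>\<bar>) + (upos (\<lambda>\<omega>. \<bar>y \<omega> - V n \<omega>\<bar>) + upos (\<lambda>\<omega>. \<bar>y' \<omega> - Y n \<omega>\<bar>))"
      by (intro add_left_mono upos_add) auto
    finally show ?thesis .
  qed
  then have 1: "(\<lambda>n. upos (\<lambda>\<omega>. \<bar>w \<omega> + indicator A \<omega> * (y' \<omega> - y \<omega>) - ?Z n \<omega>\<bar>)) \<longlonglongrightarrow> 0"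
    by (rule ennreal_tendsto_0_le[OF ennreal_tendsto_0_add[OF Wlim ennreal_tendsto_0_add[OF Vlim Ylim]]])
  have "upos (\<lambda>\<omega>. w \<omega> - E t (?Z n) \<omega>)
      \<le> upos (\<lambda>\<omega>. \<bar>w \<omega> - W n \<omega>\<bar>) + (upos (\<lambda>\<omega>. \<bar>y \<omega> - V n \<omega>\<bar>) + upos (\<lambda>\<omega>. y \<omega> - E t (Y n) \<omega>))" for n
  proof -
    have "upos (\<lambda>\<omega>. w \<omega> - E t (?Z n) \<omega>)
        \<le> upos (\<lambda>\<omega>. \<bar>w \<omega> - W n \<omega>\<bar>) + upos (\<lambda>\<omega>. \<bar>y \<omega> - V n \<omega>\<bar> + max (y \<omega> - E t (Y n) \<omega>) 0)"
    proof (rule upos_add)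
      fix \<omega> assume "\<omega> \<in> space M"
      then show "w \<omega> - E t (?Z n) \<omega> \<le> \<bar>w \<omega> - W n \<omega>\<bar> + (\<bar>y \<omega> - V n \<omega>\<bar> + max (y \<omega> - E t (Y n) \<omega>) 0)"
        by (cases "\<omega> \<in> A") (auto simp: EZ max_def)
    qed auto
    also have "\<dots> \<le> upos (\<lambda>\<omega>. \<bar>w \<omega> - W n \<omega>\<bar>) +
        (upos (\<lambda>\<omega>. \<bar>y \<omega> - V n \<omega>\<bar>) + upos (\<lambda>\<omega>. max (y \<omega> - E t (Y n) \<omega>) 0))"
      by (intro add_left_mono upos_add) auto
    finally show ?thesis by (simp add: upos_max_0)
  qed
  then have 2: "(\<lambda>n. upos (\<lambda>\<omega>. w \<omega> - E t (?Z n) \<omega>)) \<longlonglongrightarrow> 0"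
    by (rule ennreal_tendsto_0_le[OF ennreal_tendsto_0_add[OF Wlim ennreal_tendsto_0_add[OF Vlim Yy]]])
  show ?thesis
    unfolding below_E_def using Z 1 2 by (intro exI[of _ ?Z]) blast
qed

end

section \<open>Crossings\<close>

text \<open>Two rationals fit between different lower and upper limits and would be crossed
  infinitely often. Rationals keep the exceptional events countable.\<close>

lemma ereal_LIMSEQ_if_no_crossing:
  fixes f :: "nat \<Rightarrow> real"
  assumes "\<And>a b :: rat. a < b \<Longrightarrow>
    \<not> ((\<forall>m. \<exists>n\<ge>m. of_rat b \<le> f n) \<and> (\<forall>m. \<exists>n\<ge>m. f n \<le> of_rat a))"
  shows "(\<lambda>n. ereal (f n)) \<longlonglongrightarrow> limsup (\<lambda>n. ereal (f n))"
proof -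
  have "liminf (\<lambda>n. ereal (f n)) = limsup (\<lambda>n. ereal (f n))"
  proof (rule antisym[OF Liminf_le_Limsup], simp, rule ccontr)
    assume "\<not> limsup (\<lambda>n. ereal (f n)) \<le> liminf (\<lambda>n. ereal (f n))"
    then have "liminf (\<lambda>n. ereal (f n)) < limsup (\<lambda>n. ereal (f n))" by simp
    then obtain a where a: "liminf (\<lambda>n. ereal (f n)) < ereal (of_rat a)"
      "ereal (of_rat a) < limsup (\<lambda>n. ereal (f n))"
      using ereal_dense3 by blast
    from a(2) obtain b where b: "ereal (of_rat a) < ereal (of_rat b)"
      "ereal (of_rat b) < limsup (\<lambda>n. ereal (f n))"
      using ereal_dense3 by blast
    have "\<exists>n\<ge>m. of_rat b \<le> f n" for m
    proof (rule ccontr)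
      assume *: "\<not> (\<exists>n\<ge>m. of_rat b \<le> f n)"
      have "\<forall>\<^sub>F n in sequentially. ereal (f n) \<le> ereal (of_rat b)"
        unfolding eventually_sequentially using * by (intro exI[of _ m]) force
      then have "limsup (\<lambda>n. ereal (f n)) \<le> ereal (of_rat b)" by (rule Limsup_bounded)
      with b(2) show False by simp
    qed
    moreover have "\<exists>n\<ge>m. f n \<le> of_rat a" for m
    proof (rule ccontr)
      assume *: "\<not> (\<exists>n\<ge>m. f n \<le> of_rat a)"
      have "\<forall>\<^sub>F n in sequentially. ereal (of_rat a) \<le> ereal (f n)"
        unfolding eventually_sequentially using * by (intro exI[of _ m]) force
      then have "ereal (of_rat a) \<le> liminf (\<lambda>n. ereal (f n))" by (rule Liminf_bounded)
      with a(1) show False by simp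
    qed
    moreover have "a < b" using b(1) by (simp add: of_rat_less)
    ultimately show False using assms by blast
  qed
  then show ?thesis by (intro Liminf_eq_Limsup) auto
qed

context sl_expectation
begin

section \<open>Approximation of events by events of a finite time\<close>

lemma sets_F_imp_M: "A \<in> sets (F t) \<Longrightarrow> A \<in> sets M"
  using sets_F_subset by auto

lemma upper_indicator_le_add:
  assumes "C \<subseteq> A \<union> B" "A \<in> sets M" "B \<in> sets M"
  shows "upper (indicator C) \<le> upper (indicator A) + upper (indicator B)"
proof -
  have "upper (indicator C) \<le> upper (\<lambda>\<omega>. indicator A \<omega> + indicator B \<omega>)"
    using assms(1) by (intro upper_mono) (auto simp: indicator_def)
  also have "\<dots> \<le> upper (indicator A) + upper (indicator B)"
    using assms by (intro upper_add) auto
  finally show ?thesis .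
qed

lemma upper_indicator_mono: "C \<subseteq> A \<Longrightarrow> upper (indicator C) \<le> upper (indicator A)"
  by (intro upper_mono) (auto simp: indicator_def)

text \<open>The density of an algebra in the generated sigma-algebra, with continuity from above in
  the role of sigma-additivity: it makes the tail of a countable union small, so that a finite
  union, approximable at a finite time, suffices.\<close>

lemma sets_approx_adapted:
  fixes e :: real
  assumes "A \<in> sets M" "0 < e"
  shows "\<exists>k. \<exists>B\<in>sets (F k). upper (indicator ((A - B) \<union> (B - A))) \<le> ennreal e"
proof -
  \<comment> \<open>Quantified over \<open>e\<close> so that the induction hypotheses are available
    with smaller errors.\<close>
  have "\<And>e::real. 0 < e \<Longrightarrow> \<exists>k. \<exists>B\<in>sets (F k). upper (indicator ((A - B) \<union> (B - A))) \<le> ennreal e"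
    using assms(1) unfolding sets_M
  proof (induction rule: sigma_sets.induct)
    case (Basic A)
    then obtain k where "A \<in> sets (F k)" by auto
    moreover have "upper (indicator ((A - A) \<union> (A - A))) = 0" by (simp add: upper_zero cong: upper_cong)
    ultimately show ?case by (metis zero_le)
  next
    case Empty
    have "upper (indicator (({} - {}) \<union> ({} - {}))) = 0" by (simp add: upper_zero cong: upper_cong)
    then show ?case using sets.empty_sets by (metis zero_le)
  next
    case (Compl A)
    then obtain k B where B: "B \<in> sets (F k)" "upper (indicator ((A - B) \<union> (B - A))) \<le> ennreal e"
      by blast
    have "upper (indicator ((space M - A - (space M - B)) \<union> (space M - B - (space M - A))))
        \<le> upper (indicator ((A - B) \<union> (B - A)))"
      by (rule upper_indicator_mono) auto
    moreover have "space M - B \<in> sets (F k)"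
      using B(1) sets.compl_sets[of B "F k"] by (simp add: space_F)
    ultimately show ?case using B(2) order_trans by blast
  next
    case (Union A)
    have A: "A i \<in> sets M" for i using Union(1) by (simp add: sets_M)
    have fin: "\<exists>k. \<exists>B\<in>sets (F k). upper (indicator (((\<Union>i<n. A i) - B) \<union> (B - (\<Union>i<n. A i)))) \<le> ennreal d"
      if "0 < d" for n and d :: real
      using that
    proof (induction n arbitrary: d)
      case 0
      have "upper (indicator (((\<Union>i<0. A i) - {}) \<union> ({} - (\<Union>i<0. A i)))) = 0"
        by (simp add: upper_zero cong: upper_cong)
      then show ?case using sets.empty_sets by (metis zero_le)
    next
      case (Suc n)
      let ?U = "\<Union>i<n. A i"
      have "0 < d / 2" using Suc.prems by simp
      with Suc.IH obtain k B where B: "B \<in> sets (F k)"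
        "upper (indicator ((?U - B) \<union> (B - ?U))) \<le> ennreal (d/2)" by blast
      obtain l C where C: "C \<in> sets (F l)"
        "upper (indicator ((A n - C) \<union> (C - A n))) \<le> ennreal (d/2)"
        using Union(2)[OF \<open>0 < d / 2\<close>] by blast
      have "B \<union> C \<in> sets (F (max k l))"
        using B(1) C(1) sets_F_mono[of k "max k l"] sets_F_mono[of l "max k l"] by auto
      moreover have "upper (indicator (((\<Union>i<Suc n. A i) - (B \<union> C)) \<union> ((B \<union> C) - (\<Union>i<Suc n. A i)))) \<le> ennreal d"
      proof -
        have "upper (indicator (((\<Union>i<Suc n. A i) - (B \<union> C)) \<union> ((B \<union> C) - (\<Union>i<Suc n. A i))))
            \<le> upper (indicator ((?U - B) \<union> (B - ?U))) + upper (indicator ((A n - C) \<union> (C - A n)))"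
          using sets_F_imp_M[OF B(1)] sets_F_imp_M[OF C(1)] A
          by (intro upper_indicator_le_add) (auto simp: less_Suc_eq)
        also have "\<dots> \<le> ennreal (d/2) + ennreal (d/2)" by (intro add_mono B C)
        also have "\<dots> = ennreal d" using Suc.prems by (simp flip: ennreal_plus)
        finally show ?thesis .
      qed
      ultimately show ?case by blast
    qed
    let ?T = "\<lambda>n. (\<Union>i. A i) - (\<Union>i<n. A i)"
    have T: "?T n \<in> sets M" for n using A by auto
    have "(\<lambda>n. upper (indicator (?T n))) \<longlonglongrightarrow> 0"
      by (rule upper_indicator_tendsto_0[OF T]) (auto simp: decseq_def)
    then have "\<forall>\<^sub>F n in sequentially. upper (indicator (?T n)) \<le> ennreal (e/2)"
      using Union.prems by (simp add: ennreal_tendsto_0_iff)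
    then obtain n where n: "upper (indicator (?T n)) \<le> ennreal (e/2)"
      by (auto simp: eventually_sequentially)
    let ?U = "\<Union>i<n. A i"
    obtain k B where B: "B \<in> sets (F k)" "upper (indicator ((?U - B) \<union> (B - ?U))) \<le> ennreal (e/2)"
      using fin[of "e/2" n] Union.prems by auto
    have "upper (indicator (((\<Union>i. A i) - B) \<union> (B - (\<Union>i. A i))))
        \<le> upper (indicator (?T n)) + upper (indicator ((?U - B) \<union> (B - ?U)))"
      using sets_F_imp_M[OF B(1)] A by (intro upper_indicator_le_add) auto
    also have "\<dots> \<le> ennreal (e/2) + ennreal (e/2)" by (intro add_mono B n)
    also have "\<dots> = ennreal e" using Union.prems by (simp flip: ennreal_plus)
    finally show ?case using B(1) by blast
  qed
  then show ?thesis using assms(2) by blast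
qed

text \<open>
  Starting at time \<open>k\<close>, one unit of \<open>y\<close> is held from the first time \<open>x \<ge> b\<close> (event \<open>P\<close>) until the
  next time \<open>x \<le> a\<close> (event \<open>Q\<close>). The conditional expectation of the gain \<open>W\<close> is nonnegative
  because \<open>y\<close> is a submartingale, yet a completed trade loses at least \<open>b - a\<close>.
\<close>

lemma crossing_bound:
  fixes x :: "nat \<Rightarrow> 'a \<Rightarrow> real" and a b c :: real and k n :: nat
  assumes x: "\<And>i. sl_integrable (x i)" "\<And>i. x i \<in> borel_measurable (F i)"
    and below: "\<And>i. below_E i (x i) (x (Suc i))"
    and ab: "a < b" and c: "0 \<le> c" and B: "B \<in> sets (F k)" and A: "A \<in> sets M"
  defines "Q \<equiv> {\<omega>\<in>space M. \<exists>j\<in>{k..k+n}. \<exists>l\<in>{j..k+n}. b \<le> x j \<omega> \<and> x l \<omega> \<le> a}"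
  shows "ennreal (b - a) * upper (indicator B)
    \<le> ennreal (b - a + c) * (upper (indicator ((A - B) \<union> (B - A))) + upper (indicator (A - Q)))
      + upos (\<lambda>\<omega>. max (x (k+n) \<omega> - a) 0 - c)"
proof -
  define y where "y i \<omega> = max (x i \<omega> - a) 0" for i \<omega>
  \<comment> \<open>Both events with index \<open>i\<close> are decided at time \<open>i\<close>, so
    \<open>P i - R i\<close> is an admissible holding for the step from \<open>i\<close> to
    \<open>Suc i\<close>. \<open>R\<close> increases with time, hence a closed trade is never
    reopened.\<close>
  define P where "P i = {\<omega>\<in>space M. \<exists>j\<in>{k..i}. b \<le> x j \<omega>}" for i
  define R where "R i = {\<omega>\<in>space M. \<exists>j\<in>{k..i}. \<exists>l\<in>{j..i}. b \<le> x j \<omega> \<and> x l \<omega> \<le> a}" for i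
  define W where "W m \<omega> = (\<Sum>i<m. indicator (P (k+i) - R (k+i)) \<omega> * (y (Suc (k+i)) \<omega> - y (k+i) \<omega>))" for m \<omega>
  have QR: "Q = R (k+n)" by (simp add: Q_def R_def)
  have xF: "x i \<in> borel_measurable (F j)" if "i \<le> j" for i j
    by (rule borel_measurable_F_mono[OF x(2) that])
  have P_sets: "P i \<in> sets (F i)" for i
  proof -
    have "{\<omega>\<in>space (F i). b \<le> x j \<omega>} \<in> sets (F i)" if "j \<in> {k..i}" for j
    proof -
      have [measurable]: "x j \<in> borel_measurable (F i)" using that by (intro xF) auto
      show ?thesis by measurable
    qed
    then have "(\<Union>j\<in>{k..i}. {\<omega>\<in>space (F i). b \<le> x j \<omega>}) \<in> sets (F i)"
      by (intro sets.finite_UN) auto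
    also have "(\<Union>j\<in>{k..i}. {\<omega>\<in>space (F i). b \<le> x j \<omega>}) = P i" by (auto simp: P_def space_F)
    finally show ?thesis .
  qed
  have R_sets: "R i \<in> sets (F i)" for i
  proof -
    have "{\<omega>\<in>space (F i). b \<le> x j \<omega> \<and> x l \<omega> \<le> a} \<in> sets (F i)" if "j \<in> {k..i}" "l \<in> {j..i}" for j l
    proof -
      have [measurable]: "x j \<in> borel_measurable (F i)" "x l \<in> borel_measurable (F i)"
        using that by (auto intro: xF)
      show ?thesis by measurable
    qed
    then have "(\<Union>j\<in>{k..i}. \<Union>l\<in>{j..i}. {\<omega>\<in>space (F i). b \<le> x j \<omega> \<and> x l \<omega> \<le> a}) \<in> sets (F i)"
      by (intro sets.finite_UN) auto
    also have "(\<Union>j\<in>{k..i}. \<Union>l\<in>{j..i}. {\<omega>\<in>space (F i). b \<le> x j \<omega> \<and> x l \<omega> \<le> a}) = R i"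
      by (auto simp: R_def space_F)
    finally show ?thesis .
  qed
  note PR_M = sets_F_imp_M[OF P_sets] sets_F_imp_M[OF R_sets]
  note [measurable] = sl_integrable_borel[OF x(1)]
  have y: "sl_integrable (y i)" "y i \<in> borel_measurable (F i)" "y i \<in> borel_measurable M" for i
  proof -
    show "y i \<in> borel_measurable M" unfolding y_def by measurable
    then show "sl_integrable (y i)"
      by (rule sl_integrable_mono[OF sl_integrable_add[OF sl_integrable_abs[OF x(1)[of i]] sl_integrable_const[of "\<bar>a\<bar>"]]])
        (auto simp: y_def intro!: qs_space)
    show "y i \<in> borel_measurable (F i)" unfolding y_def using x(2)[of i] by measurable
  qed
  \<comment> \<open>Each step is fair or favourable at time \<open>k + m\<close> by
    \<open>below_E_stake\<close>; transitivity brings this back to time \<open>k\<close>.\<close>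
  have W: "sl_integrable (W m) \<and> W m \<in> borel_measurable (F (k+m)) \<and> below_E k (\<lambda>_. 0) (W m)" for m
  proof (induction m)
    case 0
    have "below_E k (\<lambda>_. 0) (\<lambda>_. 0)"
      unfolding below_E_def
    proof (intro exI[of _ "\<lambda>_ _. 0"] conjI allI H_const)
      have "upos (\<lambda>\<omega>. 0 - E k (\<lambda>_. 0) \<omega>) = 0"
        by (simp add: E_const upper_zero cong: upper_cong)
      then show "(\<lambda>n::nat. upos (\<lambda>\<omega>. 0 - E k (\<lambda>_. 0) \<omega>)) \<longlonglongrightarrow> 0" by simp
    qed (simp add: upper_zero)
    then show ?case by (simp add: W_def[abs_def] sl_integrable_const)
  next
    case (Suc m)
    let ?K = "P (k+m) - R (k+m)"
    have K: "?K \<in> sets (F (k+m))" using P_sets R_sets by auto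
    have eq: "W (Suc m) = (\<lambda>\<omega>. W m \<omega> + indicator ?K \<omega> * (y (Suc (k+m)) \<omega> - y (k+m) \<omega>))"
      by (simp add: W_def fun_eq_iff)
    have "sl_integrable (W (Suc m))"
      unfolding eq using Suc y sets_F_imp_M[OF K]
      by (intro sl_integrable_add sl_integrable_indicator sl_integrable_diff) auto
    moreover have "W (Suc m) \<in> borel_measurable (F (k + Suc m))"
    proof -
      have [measurable]: "W m \<in> borel_measurable (F (Suc (k+m)))"
        using Suc by (auto intro: borel_measurable_F_mono)
      have [measurable]: "y (k+m) \<in> borel_measurable (F (Suc (k+m)))"
        by (rule borel_measurable_F_mono[OF y(2)]) simp
      have [measurable]: "y (Suc (k+m)) \<in> borel_measurable (F (Suc (k+m)))" by (rule y(2))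
      have [measurable]: "?K \<in> sets (F (Suc (k+m)))"
        using K sets_F_mono[of "k+m" "Suc (k+m)"] by auto
      show ?thesis unfolding eq by simp
    qed
    moreover have "below_E k (\<lambda>_. 0) (W (Suc m))"
    proof (rule below_E_trans)
      show "below_E k (\<lambda>_. 0) (W m)" using Suc by simp
      have "below_E (k+m) (y (k+m)) (y (Suc (k+m)))"
        unfolding y_def[abs_def] using below by (intro below_E_pos_part) auto
      then show "below_E (k+m) (W m) (W (Suc m))"
        unfolding eq using Suc y K by (intro below_E_stake) auto
      show "W m \<in> borel_measurable M" using Suc by (auto dest: sl_integrable_borel)
    qed auto
    ultimately show ?case by blast
  qed
  have P_Suc: "\<omega> \<in> P (Suc i) \<longleftrightarrow> \<omega> \<in> P i \<or> b \<le> x (Suc i) \<omega>" if "k \<le> i" "\<omega> \<in> space M" for i \<omega>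
    using that by (auto simp: P_def atLeastAtMostSuc_conv)
  have R_Suc: "\<omega> \<in> R (Suc i) \<longleftrightarrow> \<omega> \<in> R i \<or> (\<omega> \<in> P (Suc i) \<and> x (Suc i) \<omega> \<le> a)"
    if "k \<le> i" "\<omega> \<in> space M" for i \<omega>
  proof -
    have R: "\<omega> \<in> R i \<longleftrightarrow> (\<exists>j l. k \<le> j \<and> j \<le> l \<and> l \<le> i \<and> b \<le> x j \<omega> \<and> x l \<omega> \<le> a)" for i
      using that unfolding R_def by fastforce
    have P: "\<omega> \<in> P i \<longleftrightarrow> (\<exists>j. k \<le> j \<and> j \<le> i \<and> b \<le> x j \<omega>)" for i
      using that unfolding P_def by fastforce
    show ?thesis
    proof
      assume "\<omega> \<in> R (Suc i)"
      then obtain j l where jl: "k \<le> j" "j \<le> l" "l \<le> Suc i" "b \<le> x j \<omega>" "x l \<omega> \<le> a"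
        unfolding R by blast
      show "\<omega> \<in> R i \<or> (\<omega> \<in> P (Suc i) \<and> x (Suc i) \<omega> \<le> a)"
      proof (cases "l = Suc i")
        case True
        then show ?thesis using jl unfolding P by blast
      next
        case False
        with jl(3) have "l \<le> i" by simp
        then show ?thesis using jl unfolding R by blast
      qed
    next
      assume "\<omega> \<in> R i \<or> (\<omega> \<in> P (Suc i) \<and> x (Suc i) \<omega> \<le> a)"
      then show "\<omega> \<in> R (Suc i)" unfolding R P using le_SucI by blast
    qed
  qed
  \<comment> \<open>The three states are: not yet bought, holding, sold. The price \<open>y\<close>
    at purchase is at least \<open>b - a\<close> and at the sale it is 0, whence the loss. At
    \<open>m = 0\<close> the unit is already held if \<open>b <= x k\<close>, and a sale is
    impossible as \<open>a < b\<close>.\<close>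
  have inv: "(\<omega> \<notin> P (k+m) \<longrightarrow> W m \<omega> = 0) \<and>
      (\<omega> \<in> P (k+m) - R (k+m) \<longrightarrow> W m \<omega> \<le> y (k+m) \<omega> - (b - a)) \<and>
      (\<omega> \<in> R (k+m) \<longrightarrow> W m \<omega> \<le> - (b - a))" if \<omega>: "\<omega> \<in> space M" for \<omega> m
  proof (induction m)
    case 0
    show ?case using ab by (auto simp: W_def P_def R_def y_def)
  next
    case (Suc m)
    have RP: "\<omega> \<in> R i \<Longrightarrow> \<omega> \<in> P i" for i by (auto simp: R_def P_def)
    have eq: "W (Suc m) \<omega> = W m \<omega> + indicator (P (k+m) - R (k+m)) \<omega> * (y (Suc (k+m)) \<omega> - y (k+m) \<omega>)"
      by (simp add: W_def)
    have Pk: "\<omega> \<in> P (Suc (k + m)) \<longleftrightarrow> \<omega> \<in> P (k+m) \<or> b \<le> x (Suc (k+m)) \<omega>"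
      using P_Suc[of "k+m" \<omega>] \<omega> by simp
    have Rk: "\<omega> \<in> R (Suc (k + m)) \<longleftrightarrow> \<omega> \<in> R (k+m) \<or> (\<omega> \<in> P (Suc (k + m)) \<and> x (Suc (k+m)) \<omega> \<le> a)"
      using R_Suc[of "k+m" \<omega>] \<omega> by simp
    have yk: "y (Suc (k + m)) \<omega> = max (x (Suc (k+m)) \<omega> - a) 0" by (simp add: y_def)
    consider "\<omega> \<in> R (k+m)" "\<omega> \<in> P (k+m)" | "\<omega> \<notin> R (k+m)" "\<omega> \<in> P (k+m)" | "\<omega> \<notin> R (k+m)" "\<omega> \<notin> P (k+m)"
      using RP by blast
    then show ?case
    proof cases
      case 1
      then show ?thesis using Suc unfolding Diff_iff add_Suc_right Rk Pk eq by simp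
    next
      case 2
      then show ?thesis using Suc unfolding Diff_iff add_Suc_right Rk Pk eq yk by (auto simp: y_def)
    next
      case 3
      then show ?thesis using Suc ab unfolding Diff_iff add_Suc_right Rk Pk eq yk by auto
    qed
  qed
  \<comment> \<open>Chosen so that \<open>c - s = - (b - a)\<close>, the bound for a completed
    trade.\<close>
  define s where "s = b - a + c"
  have s: "0 \<le> s" using ab c by (simp add: s_def)
  define D where "D = (A - B) \<union> (B - A)"
  have BM: "B \<in> sets M" by (rule sets_F_imp_M[OF B])
  have D: "D \<in> sets M" unfolding D_def using A BM by auto
  have AQ: "A - Q \<in> sets M" unfolding QR using A PR_M by auto
  let ?J = "\<lambda>\<omega>. s * (indicator D \<omega> + indicator (A - Q) \<omega>)"
  let ?U = "\<lambda>\<omega>. c - s * indicator B \<omega>"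
  \<comment> \<open>On \<open>B\<close>, if \<open>A\<close> and \<open>Q\<close> hold too, the gain
    is at most \<open>- (b - a)\<close>. Elsewhere on \<open>B\<close> an error event occurs and
    \<open>?J\<close> offsets \<open>s * indicator B\<close>; then, as outside \<open>B\<close>, it
    is enough that \<open>y <= c + (y - c)^+\<close> at time \<open>k + n\<close>.\<close>
  have W_le: "W n \<omega> \<le> ?U \<omega> + ?J \<omega> + max (y (k+n) \<omega> - c) 0" if \<omega>: "\<omega> \<in> space M" for \<omega>
  proof -
    have y0: "0 \<le> y (k+n) \<omega>" by (simp add: y_def)
    have W1: "W n \<omega> \<le> y (k+n) \<omega>" using inv[OF \<omega>, of n] y0 ab by (cases "\<omega> \<in> R (k+n)"; cases "\<omega> \<in> P (k+n)") auto
    have W2: "W n \<omega> \<le> - (b - a)" if "\<omega> \<in> Q" using inv[OF \<omega>, of n] that by (simp add: QR)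
    consider "\<omega> \<in> B" "\<omega> \<in> A" "\<omega> \<in> Q" | "\<omega> \<in> B" "\<omega> \<in> A" "\<omega> \<notin> Q" | "\<omega> \<in> B" "\<omega> \<notin> A" | "\<omega> \<notin> B" by blast
    then show ?thesis
    proof cases
      case 1
      then show ?thesis using W2 by (simp add: D_def s_def)
    next
      case 4
      have "0 \<le> ?J \<omega>" using s by (intro mult_nonneg_nonneg) auto
      with 4 W1 show ?thesis by simp
    qed (use W1 ab s in \<open>auto simp: D_def indicator_def\<close>)
  qed
  obtain Z where Z: "\<And>m. Z m \<in> H" and ZW: "(\<lambda>m. upos (\<lambda>\<omega>. \<bar>W n \<omega> - Z m \<omega>\<bar>)) \<longlonglongrightarrow> 0"
    and EZ: "(\<lambda>m. upos (\<lambda>\<omega>. 0 - E k (Z m) \<omega>)) \<longlonglongrightarrow> 0"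
    using W[of n] unfolding below_E_def by blast
  have [measurable]: "W n \<in> borel_measurable M" using W by (auto dest: sl_integrable_borel)
  note [measurable] = H_borel[OF Z] H_borel[OF E_H[OF Z]] y(3) D BM AQ
  have bound: "ennreal (b - a) * upper (indicator B)
      \<le> ennreal s * (upper (indicator D) + upper (indicator (A - Q))) + upos (\<lambda>\<omega>. y (k+n) \<omega> - c)
        + (upos (\<lambda>\<omega>. \<bar>W n \<omega> - Z m \<omega>\<bar>) + upos (\<lambda>\<omega>. 0 - E k (Z m) \<omega>))" for m
  proof -
    \<comment> \<open>\<open>W n\<close> and \<open>y\<close> need not lie in \<open>H\<close>; the
      excess \<open>?r\<close> of \<open>Z m\<close> over the indicator terms does. The
      \<open>F k\<close>-measurable \<open>?U\<close> can be taken out of \<open>E k\<close>, and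
      \<open>?V\<close> is nonnegative, so its upper integral is its expectation, before and after
      applying \<open>E k\<close>.\<close>
    let ?r = "\<lambda>\<omega>. max (Z m \<omega> - (?U \<omega> + ?J \<omega>)) 0"
    let ?V = "\<lambda>\<omega>. ?J \<omega> + ?r \<omega>"
    have ind: "indicator S \<in> H" if "S \<in> sets M" for S by (rule H_indicator_set[OF that])
    have UH: "?U \<in> H" by (intro H_diff H_const H_scale ind BM)
    have JH: "?J \<in> H" by (intro H_scale H_add ind D AQ)
    have rH: "?r \<in> H" by (intro H_max H_diff H_add UH JH Z H_const)
    have VH: "?V \<in> H" by (intro H_add JH rH)
    have V0: "0 \<le> ?V \<omega>" for \<omega> using s by (intro add_nonneg_nonneg mult_nonneg_nonneg) auto
    have EV0: "0 \<le> E k ?V \<omega>" if \<omega>: "\<omega> \<in> space M" for \<omega>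
      using E_mono[OF VH H_const, of 0 \<omega> k] V0 \<omega> by (simp add: E_const)
    have EZ_le: "E k (Z m) \<omega> \<le> ?U \<omega> + E k ?V \<omega>" if \<omega>: "\<omega> \<in> space M" for \<omega>
    proof -
      have "E k (Z m) \<omega> \<le> E k (\<lambda>\<omega>. ?U \<omega> + ?V \<omega>) \<omega>"
        by (intro E_mono H_add UH VH Z \<omega>) auto
      also have "\<dots> = ?U \<omega> + E k ?V \<omega>"
        by (intro E_add_adapted UH VH \<omega> borel_measurable_diff borel_measurable_const
            borel_measurable_times borel_measurable_indicator B)
      finally show ?thesis .
    qed
    have "ennreal (b - a) * upper (indicator B) = upos (\<lambda>\<omega>. (b - a) * indicator B \<omega>)"
      using ab by (subst upos_cmult) (auto simp: ennreal_indicator)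
    also have "\<dots> \<le> upos (E k ?V) + upos (\<lambda>\<omega>. max (0 - E k (Z m) \<omega>) 0)"
    proof (rule upos_add)
      fix \<omega> assume \<omega>: "\<omega> \<in> space M"
      \<comment> \<open>On \<open>B\<close> the adapted part \<open>?U\<close> equals
        \<open>- (b - a)\<close>; off \<open>B\<close> the left side is 0.\<close>
      show "(b - a) * indicator B \<omega> \<le> E k ?V \<omega> + max (0 - E k (Z m) \<omega>) 0"
        using EZ_le[OF \<omega>] EV0[OF \<omega>] by (cases "\<omega> \<in> B") (auto simp: s_def)
    qed (use H_borel[OF E_H[OF VH]] in auto)
    also have "upos (E k ?V) = upos ?V"
      using EV0 V0 by (simp add: upper_H E_H VH expect_E)
    also have "upos ?V \<le> upos ?J + upos ?r"
      using H_borel[OF JH] H_borel[OF rH] by (intro upos_add) auto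
    also have "upos ?J = ennreal s * upos (\<lambda>\<omega>. indicator D \<omega> + indicator (A - Q) \<omega>)"
      using s by (intro upos_cmult) auto
    also have "upos (\<lambda>\<omega>. indicator D \<omega> + indicator (A - Q) \<omega>) \<le> upos (indicator D) + upos (indicator (A - Q))"
      by (intro upos_add) auto
    also have "\<dots> = upper (indicator D) + upper (indicator (A - Q))" by (simp add: ennreal_indicator)
    also have "upos ?r \<le> upos (\<lambda>\<omega>. max (y (k+n) \<omega> - c) 0) + upos (\<lambda>\<omega>. \<bar>W n \<omega> - Z m \<omega>\<bar>)"
    proof (rule upos_add)
      fix \<omega> assume \<omega>: "\<omega> \<in> space M"
      show "?r \<omega> \<le> max (y (k+n) \<omega> - c) 0 + \<bar>W n \<omega> - Z m \<omega>\<bar>"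
        using W_le[OF \<omega>] by linarith
    qed auto
    finally show ?thesis
      by (simp add: upos_max_0 add_left_mono add_right_mono mult_left_mono add.assoc)
  qed
  let ?C = "ennreal s * (upper (indicator D) + upper (indicator (A - Q))) + upos (\<lambda>\<omega>. y (k+n) \<omega> - c)"
  have "(\<lambda>m. ?C + (upos (\<lambda>\<omega>. \<bar>W n \<omega> - Z m \<omega>\<bar>) + upos (\<lambda>\<omega>. 0 - E k (Z m) \<omega>))) \<longlonglongrightarrow> ?C + 0"
    by (intro tendsto_add tendsto_const ennreal_tendsto_0_add ZW EZ)
  then have "ennreal (b - a) * upper (indicator B) \<le> ?C + 0"
    by (rule LIMSEQ_le_const) (use bound in blast)
  then show ?thesis by (simp add: s_def D_def y_def)
qed

text \<open>The order of choices matters: \<open>c\<close> from uniform integrability for all times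
  at once, then \<open>d\<close> from \<open>c\<close>, then \<open>k\<close> and \<open>B\<close>
  from \<open>d\<close>, and the horizon \<open>n\<close> last.\<close>

lemma crossing_null:
  fixes x :: "nat \<Rightarrow> 'a \<Rightarrow> real" and a b :: real
  assumes x: "\<And>i. sl_integrable (x i)" "\<And>i. x i \<in> borel_measurable (F i)"
    and below: "\<And>i. below_E i (x i) (x (Suc i))"
    and ui: "\<And>e::real. 0 < e \<Longrightarrow> \<exists>c\<ge>0. \<forall>n. upos (\<lambda>\<omega>. \<bar>x n \<omega>\<bar> - c) \<le> ennreal e"
    and ab: "a < b"
  shows "qs (\<lambda>\<omega>. \<not> ((\<forall>m. \<exists>n\<ge>m. b \<le> x n \<omega>) \<and> (\<forall>m. \<exists>n\<ge>m. x n \<omega> \<le> a)))"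
proof -
  define A where "A = {\<omega>\<in>space M. (\<forall>m. \<exists>n\<ge>m. b \<le> x n \<omega>) \<and> (\<forall>m. \<exists>n\<ge>m. x n \<omega> \<le> a)}"
  note [measurable] = sl_integrable_borel[OF x(1)]
  have A[measurable]: "A \<in> sets M" unfolding A_def by measurable
  have small: "ennreal (b - a) * upper (indicator A) \<le> ennreal e" if "0 < e" for e :: real
  proof -
    obtain c0 where "0 \<le> c0" and c0: "\<And>n. upos (\<lambda>\<omega>. \<bar>x n \<omega>\<bar> - c0) \<le> ennreal (e/4)"
      using ui[of "e/4"] \<open>0 < e\<close> by auto
    \<comment> \<open>As \<open>(x - a)^+ <= |x| + |a|\<close>, raising the level by
      \<open>|a|\<close> carries the tail bound for \<open>x\<close> over to the positive
      part.\<close>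
    define c where "c = c0 + \<bar>a\<bar>"
    have c: "0 \<le> c" using \<open>0 \<le> c0\<close> by (simp add: c_def)
    have yc: "upos (\<lambda>\<omega>. max (x i \<omega> - a) 0 - c) \<le> ennreal (e/4)" for i
    proof (rule order_trans[OF _ c0[of i]])
      have "upos (\<lambda>\<omega>. max (x i \<omega> - a) 0 - c) \<le> upos (\<lambda>\<omega>. max (\<bar>x i \<omega>\<bar> - c0) 0)"
        using \<open>0 \<le> c0\<close> by (intro upos_mono) (auto simp: c_def)
      then show "upos (\<lambda>\<omega>. max (x i \<omega> - a) 0 - c) \<le> upos (\<lambda>\<omega>. \<bar>x i \<omega>\<bar> - c0)"
        by (simp add: upos_max_0)
    qed
    \<comment> \<open>Three errors of size \<open>d\<close> occur: the symmetric difference and the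
      unfinished trades in \<open>crossing_bound\<close>, and the return from \<open>B\<close> to
      \<open>A\<close>. Together with the tail they make four quarters of \<open>e\<close>.\<close>
    define d where "d = e / 4 / (b - a + c)"
    have s: "0 < b - a + c" using ab c by simp
    have d: "0 < d" unfolding d_def using \<open>0 < e\<close> s by simp
    have sd: "(b - a + c) * d = e / 4"
      using nonzero_mult_div_cancel_left[OF less_imp_neq[OF s, symmetric], of "e / 4"]
      unfolding d_def times_divide_eq_right .
    obtain k B where B: "B \<in> sets (F k)" and BA: "upper (indicator ((A - B) \<union> (B - A))) \<le> ennreal d"
      using sets_approx_adapted[OF A d] by blast
    have [measurable]: "B \<in> sets M" by (rule sets_F_imp_M[OF B])
    define Q where "Q n = {\<omega>\<in>space M. \<exists>j\<in>{k..k+n}. \<exists>l\<in>{j..k+n}. b \<le> x j \<omega> \<and> x l \<omega> \<le> a}" for n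
    have "(\<lambda>n. upper (indicator (A - Q n))) \<longlonglongrightarrow> 0"
    proof (rule upper_indicator_tendsto_0)
      show "A - Q n \<in> sets M" for n unfolding Q_def by measurable
      show "decseq (\<lambda>n. A - Q n)"
        unfolding decseq_def Q_def by (auto; meson add_left_mono atLeastAtMost_iff order_trans)
      \<comment> \<open>On \<open>A\<close> large values recur after \<open>k\<close> and small
        values recur after those, so a trade is completed by some finite time.\<close>
      have "\<exists>n. \<omega> \<in> Q n" if "\<omega> \<in> A" for \<omega>
      proof -
        obtain j where j: "k \<le> j" "b \<le> x j \<omega>" using \<open>\<omega> \<in> A\<close> unfolding A_def by blast
        obtain l where l: "j \<le> l" "x l \<omega> \<le> a" using \<open>\<omega> \<in> A\<close> unfolding A_def by blast
        have "j \<in> {k..k+l}" "l \<in> {j..k+l}" using j l by auto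
        with j l \<open>\<omega> \<in> A\<close> have "\<omega> \<in> Q l" unfolding Q_def A_def by blast
        then show ?thesis ..
      qed
      then show "(\<Inter>n. A - Q n) = {}" by auto
    qed
    then have "\<forall>\<^sub>F n in sequentially. upper (indicator (A - Q n)) \<le> ennreal d"
      using d by (simp add: ennreal_tendsto_0_iff)
    then obtain n where n: "upper (indicator (A - Q n)) \<le> ennreal d"
      by (auto simp: eventually_sequentially)
    have "ennreal (b - a) * upper (indicator B)
        \<le> ennreal (b - a + c) * (upper (indicator ((A - B) \<union> (B - A))) + upper (indicator (A - Q n)))
          + upos (\<lambda>\<omega>. max (x (k+n) \<omega> - a) 0 - c)"
      unfolding Q_def by (rule crossing_bound[OF x below ab c B A])
    also have "\<dots> \<le> ennreal (b - a + c) * (ennreal d + ennreal d) + ennreal (e/4)"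
      by (intro add_mono mult_left_mono BA n yc) auto
    finally have 1: "ennreal (b - a) * upper (indicator B) \<le> ennreal (b - a + c) * (ennreal d + ennreal d) + ennreal (e/4)" .
    have "upper (indicator A) \<le> upper (indicator B) + upper (indicator ((A - B) \<union> (B - A)))"
      by (intro upper_indicator_le_add) auto
    also have "\<dots> \<le> upper (indicator B) + ennreal d" by (intro add_left_mono BA)
    finally have "ennreal (b - a) * upper (indicator A) \<le> ennreal (b - a) * (upper (indicator B) + ennreal d)"
      by (intro mult_left_mono) auto
    also have "\<dots> \<le> ennreal (b - a + c) * (ennreal d + ennreal d) + ennreal (e/4) + ennreal (b - a + c) * ennreal d"
      unfolding distrib_left using c by (intro add_mono 1[unfolded distrib_left] mult_right_mono ennreal_leI) auto
    also have "\<dots> = ennreal e"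
    proof -
      have "ennreal (b - a + c) * ennreal d = ennreal (e/4)"
        unfolding sd[symmetric] using s d by (intro ennreal_mult[symmetric]) auto
      then show ?thesis unfolding distrib_left using \<open>0 < e\<close> by (simp flip: ennreal_plus)
    qed
    finally show ?thesis .
  qed
  have "ennreal (b - a) * upper (indicator A) \<le> 0"
    by (rule ennreal_le_epsilon) (use small in auto)
  then have "upper (indicator A) = 0" using ab by (simp add: ennreal_eq_0_iff)
  then show ?thesis by (intro qsI[OF A]) (auto simp: A_def)
qed

end

section \<open>Convergence and closure\<close>

context sl_expectation
begin

lemma sl_submartingale_convergence:
  fixes x :: "nat \<Rightarrow> 'a \<Rightarrow> real"
  assumes x: "\<And>i. sl_integrable (x i)" "\<And>i. x i \<in> borel_measurable (F i)"
    and below: "\<And>i. below_E i (x i) (x (Suc i))"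
    and ui: "\<And>e::real. 0 < e \<Longrightarrow> \<exists>c\<ge>0. \<forall>n. upos (\<lambda>\<omega>. \<bar>x n \<omega>\<bar> - c) \<le> ennreal e"
  shows "qs (\<lambda>\<omega>. (\<lambda>n. ereal (x n \<omega>)) \<longlonglongrightarrow> limsup (\<lambda>n. ereal (x n \<omega>)))"
proof -
  define ab :: "nat \<Rightarrow> rat \<times> rat" where "ab = from_nat_into UNIV"
  have ab: "range ab = UNIV" unfolding ab_def by (rule range_from_nat_into) auto
  define C where "C p \<omega> \<longleftrightarrow> ((\<forall>m. \<exists>n\<ge>m. real_of_rat (snd p) \<le> x n \<omega>) \<and> (\<forall>m. \<exists>n\<ge>m. x n \<omega> \<le> real_of_rat (fst p)))"
    for p \<omega>
  have "qs (\<lambda>\<omega>. fst (ab i) < snd (ab i) \<longrightarrow> \<not> C (ab i) \<omega>)" for i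
  proof (cases "fst (ab i) < snd (ab i)")
    case True
    then have "qs (\<lambda>\<omega>. \<not> C (ab i) \<omega>)"
      unfolding C_def by (intro crossing_null x below ui) (auto simp: of_rat_less)
    then show ?thesis by (rule qs_mono) simp
  qed (auto intro: qs_space)
  then have "qs (\<lambda>\<omega>. \<forall>i. fst (ab i) < snd (ab i) \<longrightarrow> \<not> C (ab i) \<omega>)" by (rule qs_all_nat)
  then show ?thesis
  proof (rule qs_mono)
    fix \<omega> assume *: "\<forall>i. fst (ab i) < snd (ab i) \<longrightarrow> \<not> C (ab i) \<omega>"
    show "(\<lambda>n. ereal (x n \<omega>)) \<longlonglongrightarrow> limsup (\<lambda>n. ereal (x n \<omega>))"
    proof (rule ereal_LIMSEQ_if_no_crossing)
      fix a b :: rat assume "a < b"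
      obtain i where "ab i = (a, b)" using ab by (metis rangeE UNIV_I)
      with *[rule_format, of i] \<open>a < b\<close>
      show "\<not> ((\<forall>m. \<exists>n\<ge>m. real_of_rat b \<le> x n \<omega>) \<and> (\<forall>m. \<exists>n\<ge>m. x n \<omega> \<le> real_of_rat a))"
        by (simp add: C_def)
    qed
  qed
qed

text \<open>Vitali's convergence theorem. Fatou's lemma first shows that the limit is quasi-surely
  finite and then hands it the common tail bounds; with these, norm convergence reduces to that of
  clamped functions.\<close>

lemma uniformly_integrable_qs_limit:
  fixes x :: "nat \<Rightarrow> 'a \<Rightarrow> real"
  assumes x: "\<And>i. sl_integrable (x i)"
    and ui: "\<And>e::real. 0 < e \<Longrightarrow> \<exists>c\<ge>0. \<forall>n. upos (\<lambda>\<omega>. \<bar>x n \<omega>\<bar> - c) \<le> ennreal e"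
    and X[measurable]: "X \<in> borel_measurable M" and lim: "qs (\<lambda>\<omega>. (\<lambda>n. ereal (x n \<omega>)) \<longlonglongrightarrow> X \<omega>)"
  defines "z \<equiv> \<lambda>\<omega>. real_of_ereal (X \<omega>)"
  shows "qs (\<lambda>\<omega>. X \<omega> = ereal (z \<omega>))"
    and "sl_integrable z"
    and "\<And>c e. (\<And>n. upos (\<lambda>\<omega>. \<bar>x n \<omega>\<bar> - c) \<le> ennreal e) \<Longrightarrow> upos (\<lambda>\<omega>. \<bar>z \<omega>\<bar> - c) \<le> ennreal e"
    and "(\<lambda>n. upos (\<lambda>\<omega>. \<bar>z \<omega> - x n \<omega>\<bar>)) \<longlonglongrightarrow> 0"
proof -
  note [measurable] = sl_integrable_borel[OF x]
  have z[measurable]: "z \<in> borel_measurable M" unfolding z_def by measurable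
  obtain c1 where "0 \<le> c1" and c1: "\<And>n. upos (\<lambda>\<omega>. \<bar>x n \<omega>\<bar> - c1) \<le> ennreal 1"
    using ui[of 1] by auto
  have bd: "upos (\<lambda>\<omega>. \<bar>x n \<omega>\<bar>) \<le> ennreal 1 + ennreal c1" for n
  proof -
    have "upos (\<lambda>\<omega>. \<bar>x n \<omega>\<bar>) \<le> upos (\<lambda>\<omega>. \<bar>x n \<omega>\<bar> - c1) + upos (\<lambda>_. c1)"
      by (intro upos_add) auto
    also have "\<dots> \<le> ennreal 1 + ennreal c1" by (intro add_mono c1) (simp add: upos_const)
    finally show ?thesis .
  qed
  \<comment> \<open>Done for \<open>X\<close> itself in the extended reals:
    \<open>real_of_ereal\<close> turns infinite limits into 0 and would hide them.\<close>
  have "upper (\<lambda>\<omega>. e2ennreal \<bar>X \<omega>\<bar>) \<le> ennreal 1 + ennreal c1"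
  proof (rule upper_limit_le)
    show "qs (\<lambda>\<omega>. (\<lambda>n. ennreal \<bar>x n \<omega>\<bar>) \<longlonglongrightarrow> e2ennreal \<bar>X \<omega>\<bar>)"
    proof (rule qs_mono[OF lim])
      fix \<omega> assume "(\<lambda>n. ereal (x n \<omega>)) \<longlonglongrightarrow> X \<omega>"
      then have "(\<lambda>n. e2ennreal \<bar>ereal (x n \<omega>)\<bar>) \<longlonglongrightarrow> e2ennreal \<bar>X \<omega>\<bar>"
        by (intro tendsto_e2ennrealI tendsto_abs_ereal)
      then show "(\<lambda>n. ennreal \<bar>x n \<omega>\<bar>) \<longlonglongrightarrow> e2ennreal \<bar>X \<omega>\<bar>" by (simp add: e2ennreal_ereal)
    qed
  qed (use bd in auto)
  then have "upper (\<lambda>\<omega>. e2ennreal \<bar>X \<omega>\<bar>) < top" by (rule le_less_trans) simp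
  then have "qs (\<lambda>\<omega>. e2ennreal \<bar>X \<omega>\<bar> < top)" by (intro upper_finite_qs) auto
  then show Xz: "qs (\<lambda>\<omega>. X \<omega> = ereal (z \<omega>))"
    by (rule qs_mono) (auto simp: z_def ereal_real)
  have lim_z: "qs (\<lambda>\<omega>. (\<lambda>n. x n \<omega>) \<longlonglongrightarrow> z \<omega>)"
    by (rule qs_mono[OF qs_conj[OF lim Xz]]) auto
  show tail: "upos (\<lambda>\<omega>. \<bar>z \<omega>\<bar> - c) \<le> ennreal e" if "\<And>n. upos (\<lambda>\<omega>. \<bar>x n \<omega>\<bar> - c) \<le> ennreal e" for c e
  proof (rule upper_limit_le)
    show "qs (\<lambda>\<omega>. (\<lambda>n. ennreal (\<bar>x n \<omega>\<bar> - c)) \<longlonglongrightarrow> ennreal (\<bar>z \<omega>\<bar> - c))"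
      by (rule qs_mono[OF lim_z]) (intro tendsto_ennrealI tendsto_intros)
  qed (use that in auto)
  show "sl_integrable z"
    unfolding sl_integrable_def ennreal_tendsto_0_iff
  proof (intro conjI allI impI z)
    fix e :: real assume "0 < e"
    then obtain c where c: "\<And>n. upos (\<lambda>\<omega>. \<bar>x n \<omega>\<bar> - c) \<le> ennreal e" using ui by blast
    obtain k where k: "c \<le> real k" using real_arch_simple by blast
    have "upos (\<lambda>\<omega>. \<bar>z \<omega>\<bar> - real n) \<le> ennreal e" if "k \<le> n" for n
      using that k by (intro order_trans[OF _ tail[OF c]] upos_mono) auto
    then show "\<forall>\<^sub>F n in sequentially. upos (\<lambda>\<omega>. \<bar>z \<omega>\<bar> - real n) \<le> ennreal e"
      unfolding eventually_sequentially by blast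
  qed
  show "(\<lambda>n. upos (\<lambda>\<omega>. \<bar>z \<omega> - x n \<omega>\<bar>)) \<longlonglongrightarrow> 0"
    unfolding ennreal_tendsto_0_iff
  proof (intro allI impI)
    fix e :: real assume "0 < e"
    then obtain c where "0 \<le> c" and c: "\<And>n. upos (\<lambda>\<omega>. \<bar>x n \<omega>\<bar> - c) \<le> ennreal (e/3)"
      using ui[of "e/3"] by auto
    \<comment> \<open>Clamping to \<open>[-c, c]\<close> moves a number \<open>u\<close> by
      \<open>(|u| - c)^+\<close>, so the distance splits into a bounded part and two tails, a third
      of \<open>e\<close> each.\<close>
    define cl where "cl u = max (- c) (min c u)" for u
    have "(\<lambda>n. upos (\<lambda>\<omega>. \<bar>cl (z \<omega>) - cl (x n \<omega>)\<bar>)) \<longlonglongrightarrow> 0"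
    proof (rule upos_bounded_convergence[of _ "2 * c"])
      show "(\<lambda>\<omega>. cl (z \<omega>) - cl (x n \<omega>)) \<in> borel_measurable M" for n
        unfolding cl_def by measurable
      show "\<bar>cl (z \<omega>) - cl (x n \<omega>)\<bar> \<le> 2 * c" for n \<omega>
        using \<open>0 \<le> c\<close> by (auto simp: cl_def)
      show "qs (\<lambda>\<omega>. (\<lambda>n. cl (z \<omega>) - cl (x n \<omega>)) \<longlonglongrightarrow> 0)"
      proof (rule qs_mono[OF lim_z])
        fix \<omega> assume "(\<lambda>n. x n \<omega>) \<longlonglongrightarrow> z \<omega>"
        then have "(\<lambda>n. cl (z \<omega>) - cl (x n \<omega>)) \<longlonglongrightarrow> cl (z \<omega>) - cl (z \<omega>)"
          unfolding cl_def by (intro tendsto_intros)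
        then show "(\<lambda>n. cl (z \<omega>) - cl (x n \<omega>)) \<longlonglongrightarrow> 0" by simp
      qed
    qed
    then have "\<forall>\<^sub>F n in sequentially. upos (\<lambda>\<omega>. \<bar>cl (z \<omega>) - cl (x n \<omega>)\<bar>) \<le> ennreal (e/3)"
      using \<open>0 < e\<close> by (simp add: ennreal_tendsto_0_iff)
    then show "\<forall>\<^sub>F n in sequentially. upos (\<lambda>\<omega>. \<bar>z \<omega> - x n \<omega>\<bar>) \<le> ennreal e"
    proof eventually_elim
      case (elim n)
      have [measurable]: "(\<lambda>\<omega>. cl (z \<omega>) - cl (x n \<omega>)) \<in> borel_measurable M"
        unfolding cl_def by measurable
      have "upos (\<lambda>\<omega>. \<bar>z \<omega> - x n \<omega>\<bar>) \<le> upos (\<lambda>\<omega>. \<bar>cl (z \<omega>) - cl (x n \<omega>)\<bar>)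
          + upos (\<lambda>\<omega>. max (\<bar>z \<omega>\<bar> - c) 0 + max (\<bar>x n \<omega>\<bar> - c) 0)"
        by (intro upos_add) (auto simp: cl_def max_def min_def abs_if)
      also have "\<dots> \<le> upos (\<lambda>\<omega>. \<bar>cl (z \<omega>) - cl (x n \<omega>)\<bar>)
          + (upos (\<lambda>\<omega>. max (\<bar>z \<omega>\<bar> - c) 0) + upos (\<lambda>\<omega>. max (\<bar>x n \<omega>\<bar> - c) 0))"
        by (intro add_left_mono upos_add) auto
      also have "\<dots> \<le> ennreal (e/3) + (ennreal (e/3) + ennreal (e/3))"
        unfolding upos_max_0 by (intro add_mono elim tail c)
      also have "\<dots> = ennreal e" using \<open>0 < e\<close> by (simp flip: ennreal_plus)
      finally show ?case .
    qed
  qed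
qed

text \<open>A quasi-sure limit is determined up to a null set only, so existence is stated once and
  the closure properties for every measurable version of the limit.\<close>

lemma sl_submartingale_closure:
  assumes sub: "sl_submartingale (range enat) X" and ui: "uniformly_integrable (X ` range enat)"
  shows "(\<exists>X_inf \<in> borel_measurable M. qs (\<lambda>\<omega>. (\<lambda>n. X (enat n) \<omega>) \<longlonglongrightarrow> X_inf \<omega>)) \<and>
    (\<forall>X_inf \<in> borel_measurable M. qs (\<lambda>\<omega>. (\<lambda>n. X (enat n) \<omega>) \<longlonglongrightarrow> X_inf \<omega>) \<longrightarrow>
      sl_submartingale UNIV (X(\<infinity> := X_inf)) \<and>
      uniformly_integrable (range (X(\<infinity> := X_inf))) \<and>
      X_inf \<in> L1b)"
proof -
  define x where "x n \<omega> = real_of_ereal (X (enat n) \<omega>)" for n \<omega>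
  have XL1: "X (enat n) \<in> L1" and XF: "X (enat n) \<in> borel_measurable (F n)" for n
    using sub by (auto simp: sl_submartingale_def filt_def)
  have Xle: "qs (\<lambda>\<omega>. X (enat s) \<omega> \<le> cond_L1 (enat s) (X (enat t)) \<omega>)" if "s \<le> t" for s t
    using sub that by (auto simp: sl_submartingale_def)
  have Xm[measurable]: "X (enat n) \<in> borel_measurable M" for n
    using XL1 by (simp add: L1_iff)
  have x: "sl_integrable (x n)" and Xx: "qs (\<lambda>\<omega>. X (enat n) \<omega> = ereal (x n \<omega>))" for n
    using XL1[of n] by (simp_all add: L1_iff x_def[abs_def])
  have xF: "x n \<in> borel_measurable (F n)" for n
    unfolding x_def[abs_def] using XF[of n] by measurable
  have below: "below_E s (x s) (x t)" if "s \<le> t" for s t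
    using cond_L1_le_imp_below_E[OF XL1 XL1 Xle[OF that]] by (simp add: x_def[abs_def])
  have uix: "\<exists>c\<ge>0. \<forall>n. upos (\<lambda>\<omega>. \<bar>x n \<omega>\<bar> - c) \<le> ennreal e" if "0 < e" for e :: real
    using ui that unfolding uniformly_integrable_iff x_def by (simp add: ball_simps)
  have Xx_all: "qs (\<lambda>\<omega>. \<forall>n. X (enat n) \<omega> = ereal (x n \<omega>))"
    by (rule qs_all_nat[OF Xx])
  show ?thesis
  proof (intro conjI ballI impI)
    show "\<exists>X_inf \<in> borel_measurable M. qs (\<lambda>\<omega>. (\<lambda>n. X (enat n) \<omega>) \<longlonglongrightarrow> X_inf \<omega>)"
    \<comment> \<open>The limit superior is defined and measurable also where the sequence has no
      limit.\<close>
    proof (rule bexI[of _ "\<lambda>\<omega>. limsup (\<lambda>n. X (enat n) \<omega>)"])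
      have "qs (\<lambda>\<omega>. (\<lambda>n. ereal (x n \<omega>)) \<longlonglongrightarrow> limsup (\<lambda>n. ereal (x n \<omega>)))"
        by (rule sl_submartingale_convergence[OF x xF below uix]) auto
      from qs_conj[OF this Xx_all]
      show "qs (\<lambda>\<omega>. (\<lambda>n. X (enat n) \<omega>) \<longlonglongrightarrow> limsup (\<lambda>n. X (enat n) \<omega>))"
        by (rule qs_mono) simp
    qed measurable
  next
    fix X_inf assume Z: "X_inf \<in> borel_measurable M"
      and limX: "qs (\<lambda>\<omega>. (\<lambda>n. X (enat n) \<omega>) \<longlonglongrightarrow> X_inf \<omega>)"
    define z where "z \<omega> = real_of_ereal (X_inf \<omega>)" for \<omega>
    have lim: "qs (\<lambda>\<omega>. (\<lambda>n. ereal (x n \<omega>)) \<longlonglongrightarrow> X_inf \<omega>)"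
      by (rule qs_mono[OF qs_conj[OF limX Xx_all]]) (elim conjE, simp)
    note zlim = uniformly_integrable_qs_limit[OF x uix Z lim, folded z_def]
    have ZL1: "X_inf \<in> L1" using Z zlim(1,2) by (simp add: L1_iff z_def[abs_def])
    then show "X_inf \<in> L1b" by (simp add: L1_eq_L1b)
    have below_inf: "below_E s (x s) z" for s
    proof (rule below_E_limit)
      \<comment> \<open>The index is shifted by \<open>s\<close> because the submartingale property
        compares \<open>x s\<close> only with values from time \<open>s\<close> on.\<close>
      show "below_E s (x s) (x (n + s))" for n by (rule below) simp
      show "(\<lambda>n. upos (\<lambda>\<omega>. \<bar>z \<omega> - x (n + s) \<omega>\<bar>)) \<longlonglongrightarrow> 0"
        using LIMSEQ_ignore_initial_segment[OF zlim(4), of s] by simp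
    qed (use x zlim(2) in \<open>auto dest: sl_integrable_borel\<close>)
    have le_inf: "qs (\<lambda>\<omega>. X (enat s) \<omega> \<le> cond_L1 (enat s) X_inf \<omega>)" for s
      using below_inf[of s] by (intro below_E_imp_cond_L1_le XL1 ZL1) (simp add: x_def[abs_def] z_def[abs_def])
    show "sl_submartingale UNIV (X(\<infinity> := X_inf))"
      unfolding sl_submartingale_def
    proof (intro conjI ballI impI)
      fix t :: enat
      show "(X(\<infinity> := X_inf)) t \<in> L1" by (cases t) (auto simp: XL1 ZL1)
      show "(X(\<infinity> := X_inf)) t \<in> borel_measurable (filt t)"
        by (cases t) (auto simp: filt_def XF Z)
    next
      fix s t :: enat assume "s \<le> t"
      \<comment> \<open>For \<open>s = \<infinity>\<close> the order forces
        \<open>t = \<infinity>\<close>, and \<open>cond_L1\<close> is then the identity.\<close>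
      then show "qs (\<lambda>\<omega>. (X(\<infinity> := X_inf)) s \<omega> \<le> cond_L1 s ((X(\<infinity> := X_inf)) t) \<omega>)"
        by (cases s; cases t) (auto simp: Xle le_inf cond_L1_infinity intro: qs_space)
    qed
    have "range (X(\<infinity> := X_inf)) = insert X_inf (range (\<lambda>n. X (enat n)))"
    proof -
      have "(UNIV :: enat set) = insert \<infinity> (range enat)" by (metis UNIV_eq_I enat.exhaust insertCI rangeI infinity_enat_def not_infinity_eq)
      then show ?thesis by (auto simp: image_iff)
    qed
    moreover have "uniformly_integrable (insert X_inf (range (\<lambda>n. X (enat n))))"
      unfolding uniformly_integrable_iff
    proof (intro conjI allI impI)
      show "insert X_inf (range (\<lambda>n. X (enat n))) \<subseteq> L1" using XL1 ZL1 by auto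
      fix e :: real assume "0 < e"
      then obtain c where "0 \<le> c" and c: "\<And>n. upos (\<lambda>\<omega>. \<bar>x n \<omega>\<bar> - c) \<le> ennreal e"
        using uix by blast
      then show "\<exists>c\<ge>0. \<forall>X\<in>insert X_inf (range (\<lambda>n. X (enat n))).
          upos (\<lambda>\<omega>. \<bar>real_of_ereal (X \<omega>)\<bar> - c) \<le> ennreal e"
        using zlim(3)[OF _ c] unfolding x_def z_def by (intro exI[of _ c]) auto
    qed
    ultimately show "uniformly_integrable (range (X(\<infinity> := X_inf)))" by simp
  qed
qed

end

theorem theorem4p5:
  fixes M :: "'a measure"
    and F :: "nat \<Rightarrow> 'a measure"
    and H :: "('a \<Rightarrow> real) set"
    and E :: "nat \<Rightarrow> ('a \<Rightarrow> real) \<Rightarrow> 'a \<Rightarrow> real"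
    and X :: "enat \<Rightarrow> 'a \<Rightarrow> ereal"
  assumes "sl_expectation M F H E"
    and "sl_data.sl_submartingale M F H E (range enat) X"
    and "sl_data.uniformly_integrable M H E (X ` range enat)"
  shows "(\<exists>X_inf \<in> borel_measurable M.
            sl_data.qs M E (\<lambda>\<omega>. (\<lambda>n. X (enat n) \<omega>) \<longlonglongrightarrow> X_inf \<omega>)) \<and>
         (\<forall>X_inf \<in> borel_measurable M.
            sl_data.qs M E (\<lambda>\<omega>. (\<lambda>n. X (enat n) \<omega>) \<longlonglongrightarrow> X_inf \<omega>) \<longrightarrow>
              sl_data.sl_submartingale M F H E UNIV (X(\<infinity> := X_inf)) \<and>
              sl_data.uniformly_integrable M H E (range (X(\<infinity> := X_inf))) \<and>
              X_inf \<in> sl_data.L1b M H E)"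
  using sl_expectation.sl_submartingale_closure[OF assms] .

end
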